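(* Let $p > 3$ be a prime, let $V$ be a vector space over $\mathbb{Q}_p$ of dimension $d \geq 2$, let $W = V \wedge V$, and let $1 \leq r \leq \binom{d}{2}$. The decomposability map $$\Psi \colon \mathrm{Gr}(2,V)^r \dashrightarrow \mathrm{Gr}(r, W), \qquad (L_1, \dots, L_r) \mapsto \textstyle\bigwedge^2 L_1 \oplus \dots \oplus \bigwedge^2 L_r,$$ is an immersion on a dense open subset of its domain if and only if $r \leq \binom{d-2}{2} + 1$.
   Context: $\mathrm{Gr}(k,U)$ denotes the Grassmannian variety of $k$-dimensional subspaces of a finite-dimensional $\mathbb{Q}_p$-vector space $U$. The rational map $\Psi$ is defined on the Zariski dense open set of tuples $(L_1,\dots,L_r)$ for which the lines $\bigwedge^2 L_i \subset W$ are linearly independent; equivalently $\Psi(\langle x_1,y_1\rangle,\dots,\langle x_r,y_r\rangle) = \langle x_1\wedge y_1,\dots,x_r\wedge y_r\rangle$. "Immersion at a point" means that the differential of $\Psi$ at that point is injective. "Dense open" is in the Zariski topology. *)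

theory Defs
  imports "HOL-Analysis.Analysis" "Berlekamp_Zassenhaus.Finite_Field"
begin

section \<open>The field of p-adic numbers\<close>

text \<open>
  The prime \<open>p\<close> is the cardinality of a type of class \<open>prime_card\<close>. The ring \<open>\<int>\<^sub>p\<close> is the inverse
  limit of the rings \<open>\<int>/p\<^sup>n\<close>, with \<open>\<int>/p\<^sup>n\<close> represented by \<open>{0..<p\<^sup>n}\<close>: the condition below
  also forces the \<open>n\<close>-th component into that range. The field \<open>\<rat>\<^sub>p\<close> is its field of fractions.
\<close>

typedef (overloaded) ('p::prime_card) padic_int =
  "{x :: nat \<Rightarrow> int. \<forall>n. x (Suc n) mod int CARD('p) ^ n = x n}"
  morphisms padic_res Abs_padic_int
  by (intro exI[of _ "\<lambda>_. 0"]) simp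

setup_lifting type_definition_padic_int

lemma mod_pow_Suc: "(a::int) mod q ^ Suc n mod q ^ n = a mod q ^ n"
  by (rule mod_mod_cancel) simp

instantiation padic_int :: (prime_card) comm_ring_1
begin

lift_definition zero_padic_int :: "'a padic_int" is "\<lambda>_. 0" by simp

lift_definition one_padic_int :: "'a padic_int" is "\<lambda>n. 1 mod int CARD('a) ^ n"
  by (simp only: mod_pow_Suc)

lift_definition plus_padic_int :: "'a padic_int \<Rightarrow> 'a padic_int \<Rightarrow> 'a padic_int"
  is "\<lambda>x y n. (x n + y n) mod int CARD('a) ^ n"
  by (simp only: mod_pow_Suc) (metis mod_add_eq)

lift_definition uminus_padic_int :: "'a padic_int \<Rightarrow> 'a padic_int"
  is "\<lambda>x n. (- x n) mod int CARD('a) ^ n"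
  by (simp only: mod_pow_Suc) (metis mod_minus_eq)

lift_definition minus_padic_int :: "'a padic_int \<Rightarrow> 'a padic_int \<Rightarrow> 'a padic_int"
  is "\<lambda>x y n. (x n - y n) mod int CARD('a) ^ n"
  by (simp only: mod_pow_Suc) (metis mod_diff_eq)

lift_definition times_padic_int :: "'a padic_int \<Rightarrow> 'a padic_int \<Rightarrow> 'a padic_int"
  is "\<lambda>x y n. (x n * y n) mod int CARD('a) ^ n"
  by (simp only: mod_pow_Suc) (metis mod_mult_eq)

lemma padic_res_mod: "padic_res (x :: 'a padic_int) n mod int CARD('a) ^ n = padic_res x n"
proof -
  have "padic_res x (Suc n) mod int CARD('a) ^ n = padic_res x n"
    using padic_res[of x] by simp
  then show ?thesis by (metis mod_mod_trivial)
qed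

instance
proof
  fix a b c :: "'a padic_int"
  show "a * b * c = a * (b * c)"
    by transfer (simp add: mod_mult_left_eq mod_mult_right_eq mult.assoc)
  show "a * b = b * a" by transfer (simp add: mult.commute)
  show "1 * a = a"
    by (simp add: padic_res_inject[symmetric] one_padic_int.rep_eq times_padic_int.rep_eq
        mod_mult_left_eq padic_res_mod)
  show "a + b + c = a + (b + c)"
    by transfer (simp add: mod_add_left_eq mod_add_right_eq add.assoc)
  show "a + b = b + a" by transfer (simp add: add.commute)
  show "0 + a = a"
    by (simp add: padic_res_inject[symmetric] zero_padic_int.rep_eq plus_padic_int.rep_eq
        padic_res_mod)
  show "- a + a = 0" by transfer (simp add: mod_add_left_eq)
  show "a - b = a + - b" by transfer (simp add: mod_add_right_eq)
  show "(a + b) * c = a * c + b * c"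
    by transfer (simp add: mod_mult_left_eq mod_add_eq distrib_right)
  have "padic_res (1::'a padic_int) 1 \<noteq> padic_res 0 1"
    using prime_gt_1_nat[OF prime_card[where 'a='a]]
    by (simp add: one_padic_int.rep_eq zero_padic_int.rep_eq)
  then show "(0::'a padic_int) \<noteq> 1" by metis
qed

end

lemma padic_res_mod_le:
  "m \<le> n \<Longrightarrow> padic_res (x :: 'p::prime_card padic_int) n mod int CARD('p) ^ m = padic_res x m"
proof (induction n rule: dec_induct)
  case base
  show ?case by (rule padic_res_mod)
next
  case (step n)
  have "padic_res x (Suc n) mod int CARD('p) ^ n = padic_res x n"
    using padic_res[of x] by simp
  then have "padic_res x n mod int CARD('p) ^ m = padic_res x (Suc n) mod int CARD('p) ^ m"
    by (metis le_imp_power_dvd mod_mod_cancel step.hyps(1))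
  then show ?case using step.IH by simp
qed

instance padic_int :: (prime_card) idom
proof
  fix a b :: "'a padic_int"
  let ?p = "int CARD('a)"
  assume "a \<noteq> 0" "b \<noteq> 0"
  then obtain m n where m: "padic_res a m \<noteq> 0" and n: "padic_res b n \<noteq> 0"
    unfolding padic_res_inject[symmetric] zero_padic_int.rep_eq by blast
  have pe: "prime_elem ?p" using prime_card_int by (rule prime_imp_prime_elem)
  have p0: "?p \<noteq> 0" "\<not> is_unit ?p" using pe by (auto simp: prime_elem_def)
  define x y where "x = padic_res a (m + n)" and "y = padic_res b (m + n)"
  have "\<not> ?p ^ m dvd x" "\<not> ?p ^ n dvd y"
    using m n padic_res_mod_le[of m "m + n" a] padic_res_mod_le[of n "m + n" b]
    by (auto simp: x_def y_def dvd_eq_mod_eq_0)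
  then have xy: "x \<noteq> 0" "y \<noteq> 0" "multiplicity ?p x < m" "multiplicity ?p y < n"
    by (auto intro!: multiplicity_lessI simp: p0)
  have "multiplicity ?p (x * y) < m + n"
    using xy by (simp add: prime_elem_multiplicity_mult_distrib[OF pe])
  then have "\<not> ?p ^ (m + n) dvd x * y"
    using xy p0 by (simp add: power_dvd_iff_le_multiplicity)
  then have "padic_res (a * b) (m + n) \<noteq> 0"
    by (simp add: times_padic_int.rep_eq x_def y_def dvd_eq_mod_eq_0)
  then show "a * b \<noteq> 0" by (auto simp: zero_padic_int.rep_eq)
qed

type_synonym 'p padic = "'p padic_int fract"


section \<open>The exterior square\<close>

definition alternating_bilinear ::
  "('k::field \<Rightarrow> 'v::ab_group_add \<Rightarrow> 'v) \<Rightarrow> ('k \<Rightarrow> 'u::ab_group_add \<Rightarrow> 'u) \<Rightarrow> ('v \<Rightarrow> 'v \<Rightarrow> 'u) \<Rightarrow> bool"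
  where "alternating_bilinear s s' \<beta> \<longleftrightarrow>
    (\<forall>x. Vector_Spaces.linear s s' (\<beta> x)) \<and>
    (\<forall>y. Vector_Spaces.linear s s' (\<lambda>x. \<beta> x y)) \<and>
    (\<forall>x. \<beta> x x = 0)"

text \<open>
  The universal property of \<open>\<wedge> : V \<times> V \<rightarrow> W = V \<wedge> V\<close>. A definition cannot quantify over the type
  of the target space, so it is stated for forms with values in the ground field. The lemma
  \<open>exterior_square_universal\<close> derives it for every target space.
\<close>

definition exterior_square ::
  "('k::field \<Rightarrow> 'v::ab_group_add \<Rightarrow> 'v) \<Rightarrow> ('k \<Rightarrow> 'w::ab_group_add \<Rightarrow> 'w) \<Rightarrow> ('v \<Rightarrow> 'v \<Rightarrow> 'w) \<Rightarrow> bool"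
  where "exterior_square s s' wedge \<longleftrightarrow>
    alternating_bilinear s s' wedge \<and>
    (\<forall>\<beta>. alternating_bilinear s (*) \<beta> \<longrightarrow>
      (\<exists>!f. Vector_Spaces.linear s' (*) f \<and> (\<forall>x y. f (wedge x y) = \<beta> x y)))"

lemma vector_space_mult: "vector_space ((*) :: 'k::field \<Rightarrow> 'k \<Rightarrow> 'k)"
  by unfold_locales (auto simp: algebra_simps)

lemma functional_separates:
  fixes s :: "'k::field \<Rightarrow> 'u::ab_group_add \<Rightarrow> 'u"
  assumes "vector_space s" "\<And>\<phi>. Vector_Spaces.linear s (*) \<phi> \<Longrightarrow> \<phi> x = \<phi> y"
  shows "x = y"
proof (rule ccontr)
  assume ne: "x \<noteq> y"
  interpret vector_space_pair s "(*)"
    using assms(1) vector_space_mult by (simp add: vector_space_pair_def)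
  have ind: "vs1.independent {x - y}" using ne by simp
  define \<phi> where "\<phi> = construct {x - y} (\<lambda>_. 1)"
  have lin: "Vector_Spaces.linear s (*) \<phi>"
    unfolding \<phi>_def using ind by (rule linear_construct)
  have "\<phi> (x - y) = 1" unfolding \<phi>_def using ind by (simp add: construct_basis)
  moreover have "\<phi> (x - y) = \<phi> x - \<phi> y" using lin by (rule linear_diff)
  ultimately show False using assms(2)[OF lin] by simp
qed

lemma exterior_square_span:
  fixes s :: "'k::field \<Rightarrow> 'v::ab_group_add \<Rightarrow> 'v"
  assumes "vector_space s'" "exterior_square s s' wedge"
  shows "Modules.module.span s' {wedge x y | x y. True} = UNIV"
proof (rule ccontr)
  interpret vector_space_pair s' "(*)"
    using assms(1) vector_space_mult by (simp add: vector_space_pair_def)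
  let ?X = "{wedge x y | x y. True}"
  assume "vs1.span ?X \<noteq> UNIV"
  then obtain v where v: "v \<notin> vs1.span ?X" by auto
  obtain B where B: "B \<subseteq> ?X" "vs1.independent B" "?X \<subseteq> vs1.span B"
    by (rule vs1.maximal_independent_subset[of ?X])
  have vB: "v \<notin> vs1.span B" using v vs1.span_mono[OF B(1)] by blast
  then have ind: "vs1.independent (insert v B)" using B(2) vs1.independent_insert by auto
  define f where "f = construct (insert v B) (\<lambda>b. if b = v then (1::'k) else 0)"
  have lin: "Vector_Spaces.linear s' (*) f"
    unfolding f_def using ind by (rule linear_construct)
  have "f v = 1" unfolding f_def using ind by (simp add: construct_basis)
  have "v \<notin> B" using vB vs1.span_base by blast
  then have fB: "f b = 0" if "b \<in> B" for b
    using that unfolding f_def using ind by (subst construct_basis) auto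
  have lin0: "Vector_Spaces.linear s' (*) (\<lambda>_. 0::'k)" by (rule linear_zero)
  have f0: "f w = 0" if "w \<in> ?X" for w
    by (rule linear_eq_on[OF lin lin0, where B = B]) (use that B(3) fB in auto)
  have "vector_space s"
    using assms(2) by (auto simp: exterior_square_def alternating_bilinear_def Vector_Spaces.linear_def)
  then interpret V: vector_space_pair s "(*)"
    using vector_space_mult by (simp add: vector_space_pair_def)
  have "alternating_bilinear s (*) (\<lambda>_ _. 0::'k)"
    by (simp add: alternating_bilinear_def V.linear_zero)
  then have "f = (\<lambda>_. 0)"
    using assms(2) lin lin0 f0 unfolding exterior_square_def by blast
  with \<open>f v = 1\<close> show False by simp
qed

lemma exterior_square_universal:
  assumes "vector_space s'" "vector_space t" "exterior_square s s' wedge"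
    and \<beta>: "alternating_bilinear s t \<beta>"
  shows "\<exists>!f. Vector_Spaces.linear s' t f \<and> (\<forall>x y. f (wedge x y) = \<beta> x y)"
proof -
  interpret vector_space_pair s' t
    using assms by (simp add: vector_space_pair_def)
  interpret T: vector_space_pair t "(*)"
    using assms(2) vector_space_mult by (simp add: vector_space_pair_def)
  interpret K: vector_space_pair s' "(*)"
    using assms(1) vector_space_mult by (simp add: vector_space_pair_def)
  let ?X = "{wedge x y | x y. True}"
  obtain B where B: "B \<subseteq> ?X" "vs1.independent B" "?X \<subseteq> vs1.span B"
    by (rule vs1.maximal_independent_subset[of ?X])
  have spB: "vs1.span B = UNIV"
    using exterior_square_span[OF assms(1,3)] vs1.span_minimal[OF B(3) vs1.subspace_span] by blast
  have "\<forall>b\<in>B. \<exists>x y. b = wedge x y" using B(1) by blast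
  then obtain p q where pq: "\<And>b. b \<in> B \<Longrightarrow> b = wedge (p b) (q b)" by metis
  define f where "f = construct B (\<lambda>b. \<beta> (p b) (q b))"
  have lin: "Vector_Spaces.linear s' t f"
    unfolding f_def using B(2) by (rule linear_construct)
  have fB: "f b = \<beta> (p b) (q b)" if "b \<in> B" for b
    unfolding f_def using B(2) that by (rule construct_basis)
  have "f (wedge x y) = \<beta> x y" for x y
  proof (rule functional_separates[OF assms(2)])
    fix \<phi> assume \<phi>: "Vector_Spaces.linear t (*) \<phi>"
    have "alternating_bilinear s (*) (\<lambda>x y. \<phi> (\<beta> x y))"
      unfolding alternating_bilinear_def
    proof (intro conjI allI)
      fix x y
      have "Vector_Spaces.linear s t (\<beta> x)" "Vector_Spaces.linear s t (\<lambda>x. \<beta> x y)" "\<beta> x x = 0"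
        using \<beta> by (auto simp: alternating_bilinear_def)
      then show "Vector_Spaces.linear s (*) (\<lambda>y. \<phi> (\<beta> x y))"
        "Vector_Spaces.linear s (*) (\<lambda>x. \<phi> (\<beta> x y))" "\<phi> (\<beta> x x) = 0"
        using Vector_Spaces.linear_compose[OF _ \<phi>] T.linear_0[OF \<phi>] by (auto simp: o_def)
    qed
    then obtain g where g: "Vector_Spaces.linear s' (*) g"
      "\<And>x y. g (wedge x y) = \<phi> (\<beta> x y)"
      using assms(3) unfolding exterior_square_def by metis
    have "Vector_Spaces.linear s' (*) (\<lambda>w. \<phi> (f w))"
      using Vector_Spaces.linear_compose[OF lin \<phi>] by (simp add: o_def)
    then have "\<phi> (f (wedge x y)) = g (wedge x y)"
    proof (rule K.linear_eq_on[OF _ g(1), where B = B])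
      show "wedge x y \<in> vs1.span B" using spB by simp
      show "\<phi> (f b) = g b" if "b \<in> B" for b
        using fB[OF that] pq[OF that] g(2) by metis
    qed
    then show "\<phi> (f (wedge x y)) = \<phi> (\<beta> x y)" using g(2) by simp
  qed
  moreover have "g = h" if "Vector_Spaces.linear s' t g" "Vector_Spaces.linear s' t h"
    "\<forall>x y. g (wedge x y) = \<beta> x y" "\<forall>x y. h (wedge x y) = \<beta> x y" for g h
  proof
    fix w show "g w = h w"
      by (rule linear_eq_on[OF that(1,2), where B = ?X])
        (use that(3,4) exterior_square_span[OF assms(1,3)] in auto)
  qed
  ultimately show ?thesis using lin by blast
qed


section \<open>Zariski topology and regular functions\<close>

text \<open>
  Polynomial functions on the affine space \<open>U\<^sup>J\<close>: the algebra of functions generated by the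
  coordinates \<open>a \<mapsto> \<phi> (a j)\<close> with \<open>\<phi>\<close> a linear functional on \<open>U\<close>.
\<close>

inductive_set polyfuns ::
  "('k::field \<Rightarrow> 'u::ab_group_add \<Rightarrow> 'u) \<Rightarrow> 'j set \<Rightarrow> (('j \<Rightarrow> 'u) \<Rightarrow> 'k) set"
  for s J where
  const: "(\<lambda>_. c) \<in> polyfuns s J"
| coord: "j \<in> J \<Longrightarrow> Vector_Spaces.linear s (*) \<phi> \<Longrightarrow> (\<lambda>a. \<phi> (a j)) \<in> polyfuns s J"
| add: "P \<in> polyfuns s J \<Longrightarrow> Q \<in> polyfuns s J \<Longrightarrow> (\<lambda>a. P a + Q a) \<in> polyfuns s J"
| mult: "P \<in> polyfuns s J \<Longrightarrow> Q \<in> polyfuns s J \<Longrightarrow> (\<lambda>a. P a * Q a) \<in> polyfuns s J"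

definition affine_zariski ::
  "('k::field \<Rightarrow> 'u::ab_group_add \<Rightarrow> 'u) \<Rightarrow> 'j set \<Rightarrow> ('j \<Rightarrow> 'u) topology"
  where "affine_zariski s J =
    topology (\<lambda>A. \<exists>F \<subseteq> polyfuns s J. A = {a \<in> J \<rightarrow>\<^sub>E UNIV. \<exists>P\<in>F. P a \<noteq> 0})"

lemma openin_affine_zariski:
  "openin (affine_zariski s J) A \<longleftrightarrow>
    (\<exists>F \<subseteq> polyfuns s J. A = {a \<in> J \<rightarrow>\<^sub>E UNIV. \<exists>P\<in>F. P a \<noteq> 0})"
proof -
  let ?op = "\<lambda>A. \<exists>F \<subseteq> polyfuns s J. A = {a \<in> J \<rightarrow>\<^sub>E UNIV. \<exists>P\<in>F. P a \<noteq> 0}"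
  have "istopology ?op"
    unfolding istopology_def
  proof (intro conjI allI impI)
    fix A B assume "?op A" "?op B"
    then obtain F G where F: "F \<subseteq> polyfuns s J" "A = {a \<in> J \<rightarrow>\<^sub>E UNIV. \<exists>P\<in>F. P a \<noteq> 0}"
      and G: "G \<subseteq> polyfuns s J" "B = {a \<in> J \<rightarrow>\<^sub>E UNIV. \<exists>P\<in>G. P a \<noteq> 0}" by blast
    let ?H = "{\<lambda>a. P a * Q a | P Q. P \<in> F \<and> Q \<in> G}"
    have "?H \<subseteq> polyfuns s J" using F(1) G(1) by (auto intro: polyfuns.mult)
    moreover have "A \<inter> B = {a \<in> J \<rightarrow>\<^sub>E UNIV. \<exists>P\<in>?H. P a \<noteq> 0}"
      unfolding F(2) G(2) by fastforce
    ultimately show "?op (A \<inter> B)" by blast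
  next
    fix \<A> assume "\<forall>A\<in>\<A>. ?op A"
    from bchoice[OF this] obtain F where F: "\<forall>A\<in>\<A>. F A \<subseteq> polyfuns s J \<and>
      A = {a \<in> J \<rightarrow>\<^sub>E UNIV. \<exists>P\<in>F A. P a \<noteq> 0}" by blast
    have "\<Union>\<A> = {a \<in> J \<rightarrow>\<^sub>E UNIV. \<exists>P\<in>(\<Union>A\<in>\<A>. F A). P a \<noteq> 0}"
      using F by (simp add: set_eq_iff)
    moreover have "(\<Union>A\<in>\<A>. F A) \<subseteq> polyfuns s J" using F by blast
    ultimately show "?op (\<Union>\<A>)" by blast
  qed
  then show ?thesis unfolding affine_zariski_def by (simp add: topology_inverse')
qed

lemma topspace_affine_zariski:
  fixes s :: "'a::field \<Rightarrow> 'u::ab_group_add \<Rightarrow> 'u"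
  shows "topspace (affine_zariski s J) = (J \<rightarrow>\<^sub>E UNIV)"
proof
  show "topspace (affine_zariski s J) \<subseteq> J \<rightarrow>\<^sub>E UNIV"
    using openin_topspace[of "affine_zariski s J"] unfolding openin_affine_zariski by blast
  have "{\<lambda>_. 1} \<subseteq> polyfuns s J" by (simp add: polyfuns.const)
  moreover have "(J \<rightarrow>\<^sub>E UNIV) = {a \<in> J \<rightarrow>\<^sub>E UNIV. \<exists>P\<in>{\<lambda>_. 1 :: 'a}. P a \<noteq> 0}" by simp
  ultimately have "openin (affine_zariski s J) (J \<rightarrow>\<^sub>E UNIV)"
    unfolding openin_affine_zariski by blast
  then show "J \<rightarrow>\<^sub>E UNIV \<subseteq> topspace (affine_zariski s J)" by (rule openin_subset)
qed

definition quotient_top :: "'a topology \<Rightarrow> ('a \<Rightarrow> 'x) \<Rightarrow> 'x topology"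
  where "quotient_top T \<pi> =
    topology (\<lambda>A. A \<subseteq> \<pi> ` topspace T \<and> openin T {a \<in> topspace T. \<pi> a \<in> A})"

lemma openin_quotient_top:
  "openin (quotient_top T \<pi>) A \<longleftrightarrow>
    A \<subseteq> \<pi> ` topspace T \<and> openin T {a \<in> topspace T. \<pi> a \<in> A}"
proof -
  let ?op = "\<lambda>A. A \<subseteq> \<pi> ` topspace T \<and> openin T {a \<in> topspace T. \<pi> a \<in> A}"
  have "istopology ?op"
    unfolding istopology_def
  proof (intro conjI[of "\<forall>A B. _ A B"] allI impI)
    fix A B assume "?op A" "?op B"
    moreover have "{a \<in> topspace T. \<pi> a \<in> A \<inter> B} =
      {a \<in> topspace T. \<pi> a \<in> A} \<inter> {a \<in> topspace T. \<pi> a \<in> B}" by blast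
    ultimately show "?op (A \<inter> B)" by (auto intro: openin_Int)
  next
    fix \<A> assume \<A>: "\<forall>A\<in>\<A>. ?op A"
    have "{a \<in> topspace T. \<pi> a \<in> \<Union>\<A>} = (\<Union>A\<in>\<A>. {a \<in> topspace T. \<pi> a \<in> A})" by blast
    moreover have "openin T (\<Union>A\<in>\<A>. {a \<in> topspace T. \<pi> a \<in> A})" using \<A> by blast
    ultimately show "?op (\<Union>\<A>)" using \<A> by auto
  qed
  then show ?thesis unfolding quotient_top_def by (simp add: topology_inverse')
qed

lemma topspace_quotient_top: "topspace (quotient_top T \<pi>) = \<pi> ` topspace T"
proof
  have "{a \<in> topspace T. \<pi> a \<in> \<pi> ` topspace T} = topspace T" by blast
  then show "\<pi> ` topspace T \<subseteq> topspace (quotient_top T \<pi>)"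
    by (intro openin_subset) (simp add: openin_quotient_top)
  show "topspace (quotient_top T \<pi>) \<subseteq> \<pi> ` topspace T"
    using openin_topspace[of "quotient_top T \<pi>"] by (simp only: openin_quotient_top)
qed

lemma quotient_map_quotient_top: "quotient_map T (quotient_top T \<pi>) \<pi>"
  unfolding quotient_map_def by (auto simp: openin_quotient_top topspace_quotient_top)

text \<open>
  A variety \<open>X\<close> is presented as a quotient \<open>\<pi> : S \<rightarrow> X\<close> of a Zariski open subset \<open>S\<close> of an affine
  space \<open>U\<^sup>J\<close>. Functions regular at \<open>x\<close> are those whose pullback to \<open>S\<close> is a quotient of
  polynomials near a point of the fibre over \<open>x\<close>. They are total functions on the type of points,
  and only their values near \<open>x\<close> matter. The Grassmannians below satisfy what makes this
  the usual local ring: \<open>\<pi>\<close> has regular local sections through every point of \<open>S\<close>.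
\<close>

definition regular_funs ::
  "('k::field \<Rightarrow> 'u::ab_group_add \<Rightarrow> 'u) \<Rightarrow> 'j set \<Rightarrow> ('j \<Rightarrow> 'u) set \<Rightarrow> (('j \<Rightarrow> 'u) \<Rightarrow> 'x) \<Rightarrow> 'x
    \<Rightarrow> ('x \<Rightarrow> 'k) set"
  where "regular_funs s J S \<pi> x =
    {f. \<exists>a\<in>S. \<pi> a = x \<and> (\<exists>P\<in>polyfuns s J. \<exists>Q\<in>polyfuns s J.
      Q a \<noteq> 0 \<and> (\<forall>b\<in>S. Q b \<noteq> 0 \<longrightarrow> f (\<pi> b) = P b / Q b))}"


section \<open>Tangent spaces and differentials\<close>

text \<open>
  The tangent space at \<open>x\<close> consists of the point derivations of the functions \<open>R\<close> regular at \<open>x\<close>.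
  A derivation depends only on germs: if \<open>f\<close> vanishes on a neighbourhood \<open>N\<close> of \<open>x\<close>, then
  \<open>f = f h\<close> for the indicator function \<open>h \<in> R\<close> of the complement of \<open>N\<close>, so \<open>D f = 0\<close> by the
  Leibniz rule. Extensionality makes equality of derivations mean equality on \<open>R\<close>.
\<close>

definition tangent_space :: "('x \<Rightarrow> 'k::field) set \<Rightarrow> 'x \<Rightarrow> (('x \<Rightarrow> 'k) \<Rightarrow> 'k) set"
  where "tangent_space R x = {D \<in> extensional R.
    (\<forall>f\<in>R. \<forall>g\<in>R. D (\<lambda>y. f y + g y) = D f + D g) \<and>
    (\<forall>c. \<forall>f\<in>R. D (\<lambda>y. c * f y) = c * D f) \<and>
    (\<forall>f\<in>R. \<forall>g\<in>R. D (\<lambda>y. f y * g y) = f x * D g + g x * D f)}"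

definition differential ::
  "('y \<Rightarrow> 'k::field) set \<Rightarrow> ('x \<Rightarrow> 'y) \<Rightarrow> (('x \<Rightarrow> 'k) \<Rightarrow> 'k) \<Rightarrow> (('y \<Rightarrow> 'k) \<Rightarrow> 'k)"
  where "differential R' F D = (\<lambda>f\<in>R'. D (f \<circ> F))"


section \<open>Grassmannians\<close>

definition Gr :: "('k::field \<Rightarrow> 'u::ab_group_add \<Rightarrow> 'u) \<Rightarrow> nat \<Rightarrow> 'u set set"
  where "Gr s k = {L. Modules.module.subspace s L \<and> vector_space.dim s L = k}"

definition frame_span :: "('k::field \<Rightarrow> 'u::ab_group_add \<Rightarrow> 'u) \<Rightarrow> nat \<Rightarrow> (nat \<Rightarrow> 'u) \<Rightarrow> 'u set"
  where "frame_span s k a = Modules.module.span s (a ` {..<k})"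

definition frames :: "('k::field \<Rightarrow> 'u::ab_group_add \<Rightarrow> 'u) \<Rightarrow> nat \<Rightarrow> (nat \<Rightarrow> 'u) set"
  where "frames s k = {a \<in> {..<k} \<rightarrow>\<^sub>E UNIV. frame_span s k a \<in> Gr s k}"

definition Gr_regular ::
  "('k::field \<Rightarrow> 'u::ab_group_add \<Rightarrow> 'u) \<Rightarrow> nat \<Rightarrow> 'u set \<Rightarrow> ('u set \<Rightarrow> 'k) set"
  where "Gr_regular s k = regular_funs s {..<k} (frames s k) (frame_span s k)"

text \<open>
  A point of \<open>Gr(k, U)\<^sup>r\<close> is an extensional function on \<open>{..<r}\<close>. Its variety structure is
  the quotient of the affine open set of \<open>r\<close>-tuples of frames, so that the topology is the
  Zariski topology of the product variety (not the product topology).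
\<close>

definition pow_span ::
  "('k::field \<Rightarrow> 'u::ab_group_add \<Rightarrow> 'u) \<Rightarrow> nat \<Rightarrow> nat \<Rightarrow> (nat \<times> nat \<Rightarrow> 'u) \<Rightarrow> (nat \<Rightarrow> 'u set)"
  where "pow_span s k r a = (\<lambda>i\<in>{..<r}. frame_span s k (\<lambda>j. a (i, j)))"

definition pow_frames ::
  "('k::field \<Rightarrow> 'u::ab_group_add \<Rightarrow> 'u) \<Rightarrow> nat \<Rightarrow> nat \<Rightarrow> (nat \<times> nat \<Rightarrow> 'u) set"
  where "pow_frames s k r =
    {a \<in> ({..<r} \<times> {..<k}) \<rightarrow>\<^sub>E UNIV. pow_span s k r a \<in> {..<r} \<rightarrow>\<^sub>E Gr s k}"

definition Gr_pow_zariski ::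
  "('k::field \<Rightarrow> 'u::ab_group_add \<Rightarrow> 'u) \<Rightarrow> nat \<Rightarrow> nat \<Rightarrow> (nat \<Rightarrow> 'u set) topology"
  where "Gr_pow_zariski s k r =
    quotient_top (subtopology (affine_zariski s ({..<r} \<times> {..<k})) (pow_frames s k r))
      (pow_span s k r)"

definition Gr_pow_regular ::
  "('k::field \<Rightarrow> 'u::ab_group_add \<Rightarrow> 'u) \<Rightarrow> nat \<Rightarrow> nat \<Rightarrow> (nat \<Rightarrow> 'u set) \<Rightarrow> ((nat \<Rightarrow> 'u set) \<Rightarrow> 'k) set"
  where "Gr_pow_regular s k r =
    regular_funs s ({..<r} \<times> {..<k}) (pow_frames s k r) (pow_span s k r)"

lemma topspace_Gr_pow_zariski:
  assumes "vector_space s" "k \<ge> 1"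
  shows "topspace (Gr_pow_zariski s k r) = ({..<r} \<rightarrow>\<^sub>E Gr s k)"
proof -
  interpret vector_space s by fact
  have "pow_frames s k r \<subseteq> ({..<r} \<times> {..<k}) \<rightarrow>\<^sub>E UNIV" by (auto simp: pow_frames_def)
  then have top: "topspace (Gr_pow_zariski s k r) = pow_span s k r ` pow_frames s k r"
    unfolding Gr_pow_zariski_def
    by (simp add: topspace_quotient_top topspace_affine_zariski Int_absorb1)
  have "L \<in> pow_span s k r ` pow_frames s k r" if L: "L \<in> {..<r} \<rightarrow>\<^sub>E Gr s k" for L
  proof -
    have "\<exists>a. frame_span s k a = L i" if "i < r" for i
    proof -
      have "L i \<in> Gr s k" using L that by auto
      then have sub: "subspace (L i)" and dim: "dim (L i) = k" by (auto simp: Gr_def)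
      obtain B where B: "B \<subseteq> L i" "independent B" "L i \<subseteq> span B" "card B = dim (L i)"
        by (rule basis_exists)
      have "span B = L i" using B sub by (metis span_minimal subset_antisym)
      moreover have "finite B" using B(4) dim assms(2) by (metis card.infinite not_one_le_zero)
      then obtain a where "bij_betw a {..<k} B"
        using B(4) dim by (metis ex_bij_betw_nat_finite atLeast0LessThan)
      ultimately show ?thesis by (auto simp: frame_span_def bij_betw_def)
    qed
    then obtain a where a: "\<And>i. i < r \<Longrightarrow> frame_span s k (a i) = L i" by metis
    define b where "b = (\<lambda>(i, j)\<in>{..<r} \<times> {..<k}. a i j)"
    have "(\<lambda>j. b (i, j)) ` {..<k} = a i ` {..<k}" if "i < r" for i
      using that by (auto simp: b_def)
    then have "pow_span s k r b = L"
      using a L by (auto simp: pow_span_def frame_span_def fun_eq_iff PiE_def extensional_def)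
    moreover have "b \<in> ({..<r} \<times> {..<k}) \<rightarrow>\<^sub>E UNIV" by (auto simp: b_def)
    ultimately show ?thesis using L by (auto simp: pow_frames_def)
  qed
  moreover have "pow_span s k r ` pow_frames s k r \<subseteq> {..<r} \<rightarrow>\<^sub>E Gr s k"
    by (auto simp: pow_frames_def)
  ultimately show ?thesis unfolding top by blast
qed


section \<open>The decomposability map\<close>

definition ext2 ::
  "('k::field \<Rightarrow> 'w::ab_group_add \<Rightarrow> 'w) \<Rightarrow> ('v \<Rightarrow> 'v \<Rightarrow> 'w) \<Rightarrow> 'v set \<Rightarrow> 'w set"
  where "ext2 s' wedge L = Modules.module.span s' {wedge x y | x y. x \<in> L \<and> y \<in> L}"

definition decomp_domain ::
  "('k::field \<Rightarrow> 'v::ab_group_add \<Rightarrow> 'v) \<Rightarrow> ('k \<Rightarrow> 'w::ab_group_add \<Rightarrow> 'w) \<Rightarrow> ('v \<Rightarrow> 'v \<Rightarrow> 'w)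
    \<Rightarrow> nat \<Rightarrow> (nat \<Rightarrow> 'v set) set"
  where "decomp_domain s s' wedge r = {L \<in> {..<r} \<rightarrow>\<^sub>E Gr s 2.
    \<forall>w. (\<forall>i<r. w i \<in> ext2 s' wedge (L i)) \<and> (\<Sum>i<r. w i) = 0 \<longrightarrow> (\<forall>i<r. w i = 0)}"

definition decomp_map ::
  "('k::field \<Rightarrow> 'w::ab_group_add \<Rightarrow> 'w) \<Rightarrow> ('v \<Rightarrow> 'v \<Rightarrow> 'w) \<Rightarrow> nat \<Rightarrow> (nat \<Rightarrow> 'v set) \<Rightarrow> 'w set"
  where "decomp_map s' wedge r L = Modules.module.span s' (\<Union>i<r. ext2 s' wedge (L i))"

definition decomp_immersion_at ::
  "('k::field \<Rightarrow> 'v::ab_group_add \<Rightarrow> 'v) \<Rightarrow> ('k \<Rightarrow> 'w::ab_group_add \<Rightarrow> 'w) \<Rightarrow> ('v \<Rightarrow> 'v \<Rightarrow> 'w)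
    \<Rightarrow> nat \<Rightarrow> (nat \<Rightarrow> 'v set) \<Rightarrow> bool"
  where "decomp_immersion_at s s' wedge r L \<longleftrightarrow>
    inj_on (differential (Gr_regular s' r (decomp_map s' wedge r L)) (decomp_map s' wedge r))
      (tangent_space (Gr_pow_regular s 2 r L) L)"

end

theory Submission
  imports Defs "Jordan_Normal_Form.Determinant"
begin

text \<open>
  Write \<open>L\<^sub>i = \<langle>x\<^sub>i, y\<^sub>i\<rangle>\<close>, \<open>w\<^sub>i = x\<^sub>i \<and> y\<^sub>i\<close> and \<open>E = \<langle>w\<^sub>1, \<dots>, w\<^sub>r\<rangle>\<close>. A tangent vector at the tuple of the \<open>L\<^sub>i\<close> is
  given by velocities of the \<open>x\<^sub>i\<close> and \<open>y\<^sub>i\<close> modulo \<open>L\<^sub>i\<close>, and the differential of \<open>\<Psi>\<close> sends it to the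
  velocities \<open>x\<^sub>i' \<and> y\<^sub>i + x\<^sub>i \<and> y\<^sub>i'\<close> of the \<open>w\<^sub>i\<close> modulo \<open>E\<close>. These fill the space \<open>L\<^sub>i \<and> V\<close>, so that \<open>\<Psi>\<close>
  is an immersion at the tuple if and only if \<open>E \<inter> (L\<^sub>i \<and> V) = \<langle>w\<^sub>i\<rangle>\<close> for each \<open>i\<close>. This condition is
  called transversality below.

  Since \<open>W / (L\<^sub>i \<and> V)\<close> is the exterior square of \<open>V / L\<^sub>i\<close>, transversality says that the \<open>r - 1\<close>
  vectors \<open>w\<^sub>j\<close> with \<open>j \<noteq> i\<close> stay independent in a space of dimension \<open>(d - 2) choose 2\<close>. This forces
  \<open>r - 1 \<le> (d - 2) choose 2\<close> (\<open>card_le_if_transversal\<close>). Conversely, under this bound the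
  transversal tuples contain the nonvanishing locus of a polynomial \<open>G\<close> in the frames, a product over
  \<open>i\<close> of determinants, each of which is nonzero at a tuple of coordinate planes
  (\<open>generic_polynomial\<close>). Over an infinite field such a locus meets every nonempty Zariski open
  set, and its image among the tuples of planes is open because the projection from frames to planes
  is the quotient by a group action.

  The equivalence of immersion and transversality has to be proved for derivations of rings of regular
  functions. If a derivation \<open>D\<close> is killed by the differential of \<open>\<Psi>\<close>, its values on the coordinates of
  a normalised frame are the velocities \<open>x\<^sub>i', y\<^sub>i'\<close>. Applying \<open>D\<close> to the pullbacks of chart coordinates
  of the target shows that the velocity of each \<open>w\<^sub>i\<close> lies in \<open>E\<close>, and transversality makes all velocities
  vanish (\<open>deriv_zero_if_kills_pullbacks\<close>). If instead transversality fails at \<open>i\<close>, there is a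
  nontrivial relation \<open>\<Sum>\<^sub>j c\<^sub>j w\<^sub>j = u \<and> y\<^sub>i + x\<^sub>i \<and> v\<close> with \<open>c\<^sub>i = 0\<close>. Differentiation along the curve
  \<open>t \<mapsto> \<langle>x\<^sub>i + t u, y\<^sub>i + t v\<rangle>\<close> is a nonzero derivation, and it is killed because the image of the
  curve depends, up to a change of frame, on \<open>t\<^sup>2\<close> only (\<open>transversal_if_immersion\<close>).
\<close>

section \<open>Independent families and dual functionals\<close>

definition indep_family ::
  "('k::field \<Rightarrow> 'u::ab_group_add \<Rightarrow> 'u) \<Rightarrow> nat \<Rightarrow> (nat \<Rightarrow> 'u) \<Rightarrow> bool"
  where "indep_family s k a \<longleftrightarrow> (\<forall>c. (\<Sum>l<k. s (c l) (a l)) = 0 \<longrightarrow> (\<forall>l<k. c l = 0))"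

definition dual_basis ::
  "('k::field \<Rightarrow> 'u::ab_group_add \<Rightarrow> 'u) \<Rightarrow> nat \<Rightarrow> (nat \<Rightarrow> 'u) \<Rightarrow> (nat \<Rightarrow> 'u \<Rightarrow> 'k) \<Rightarrow> bool"
  where "dual_basis s d e e' \<longleftrightarrow> (\<forall>n. Vector_Spaces.linear s (*) (e' n)) \<and>
    (\<forall>m<d. \<forall>n<d. e' m (e n) = (if m = n then 1 else 0)) \<and>
    (\<forall>x. x = (\<Sum>n<d. s (e' n x) (e n)))"

lemma linear_rules:
  assumes "Vector_Spaces.linear s s' f"
  shows "f (x + y) = f x + f y" "f (x - y) = f x - f y" "f (- x) = - f x" "f 0 = 0"
    "f (s c x) = s' c (f x)" "f (\<Sum>i\<in>A. g i) = (\<Sum>i\<in>A. f (g i))"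
proof -
  interpret Vector_Spaces.linear s s' f by fact
  show "f (x + y) = f x + f y" "f (x - y) = f x - f y" "f (- x) = - f x" "f 0 = 0"
    "f (s c x) = s' c (f x)" "f (\<Sum>i\<in>A. g i) = (\<Sum>i\<in>A. f (g i))"
    by (simp_all add: add diff neg zero scale sum)
qed

lemma linear_functionalI:
  fixes s :: "'k::field \<Rightarrow> 'u::ab_group_add \<Rightarrow> 'u"
  assumes "vector_space s" "\<And>x y. f (x + y) = f x + f y" "\<And>c x. f (s c x) = c * f x"
  shows "Vector_Spaces.linear s (*) f"
  using assms vector_space_mult by (simp add: Vector_Spaces.linear_iff)

lemma linear_functional_combination:
  fixes s :: "'k::field \<Rightarrow> 'u::ab_group_add \<Rightarrow> 'u"
  assumes "Vector_Spaces.linear s (*) f" "Vector_Spaces.linear s (*) g"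
  shows "Vector_Spaces.linear s (*) (\<lambda>x. c * f x + c' * g x)"
  using assms by (auto simp: Vector_Spaces.linear_iff algebra_simps)

lemma sum_delta_mult:
  fixes c :: "nat \<Rightarrow> 'k::field"
  assumes "m < k"
  shows "(\<Sum>l<k. c l * (if m = l then 1 else 0)) = c m"
    "(\<Sum>l<k. c l * (if l = m then 1 else 0)) = c m"
  using assms by (simp_all add: if_distrib[of "\<lambda>x. _ * x"] cong: if_cong)

context vector_space
begin

lemma sum_delta_scale:
  fixes k :: nat
  assumes "m < k"
  shows "(\<Sum>l<k. scale (if l = m then c else 0) (a l)) = scale c (a m)"
proof -
  have "(\<Sum>l<k. scale (if l = m then c else 0) (a l)) = (\<Sum>l<k. if l = m then scale c (a l) else 0)"
    by (intro sum.cong) auto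
  also have "\<dots> = scale c (a m)" using assms by (subst sum.delta) auto
  finally show ?thesis .
qed

lemma span_family: "span (a ` {..<k::nat}) = {(\<Sum>l<k. scale (c l) (a l)) | c. True}"
proof
  let ?S = "{(\<Sum>l<k. scale (c l) (a l)) | c. True}"
  have "subspace ?S"
    unfolding subspace_def
  proof (intro conjI ballI allI)
    show "0 \<in> ?S" by (auto intro!: exI[of _ "\<lambda>_. 0"])
  next
    fix x y assume "x \<in> ?S" "y \<in> ?S"
    then obtain c c' where "x = (\<Sum>l<k. scale (c l) (a l))" "y = (\<Sum>l<k. scale (c' l) (a l))"
      by blast
    then have "x + y = (\<Sum>l<k. scale (c l + c' l) (a l))"
      by (simp add: scale_left_distrib sum.distrib)
    then show "x + y \<in> ?S" by (auto intro!: exI[of _ "\<lambda>l. c l + c' l"])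
  next
    fix t x assume "x \<in> ?S"
    then obtain c where "x = (\<Sum>l<k. scale (c l) (a l))" by blast
    then have "scale t x = (\<Sum>l<k. scale (t * c l) (a l))"
      by (simp add: scale_sum_right)
    then show "scale t x \<in> ?S" by (auto intro!: exI[of _ "\<lambda>l. t * c l"])
  qed
  moreover have "a ` {..<k} \<subseteq> ?S"
  proof
    fix x assume "x \<in> a ` {..<k}"
    then obtain m where "m < k" "x = a m" by auto
    then show "x \<in> ?S"
      using sum_delta_scale[of m k 1 a] by (auto intro!: exI[of _ "\<lambda>l. if l = m then 1 else 0"])
  qed
  ultimately show "span (a ` {..<k}) \<subseteq> ?S" by (rule span_minimal[rotated])
  show "?S \<subseteq> span (a ` {..<k})"
    by (auto intro!: span_sum span_scale intro: span_base)
qed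

lemma indep_family_iff: "indep_family scale k a \<longleftrightarrow> inj_on a {..<k} \<and> independent (a ` {..<k})"
proof
  assume a: "indep_family scale k a"
  have inj: "inj_on a {..<k}"
  proof (rule inj_onI)
    fix l m assume lm: "l \<in> {..<k}" "m \<in> {..<k}" "a l = a m"
    let ?c = "\<lambda>n. (if n = l then 1 else 0) - (if n = m then 1 else 0) :: 'a"
    have "(\<Sum>n<k. scale (?c n) (a n)) = 0"
      using lm by (simp only: scale_left_diff_distrib sum_subtractf) (simp add: sum_delta_scale)
    then have "\<forall>n<k. ?c n = 0"
      using spec[OF a[unfolded indep_family_def], of ?c] by simp
    then have "?c l = 0" using lm by blast
    then show "l = m" by (simp split: if_splits)
  qed
  have "independent (a ` {..<k})"
  proof (subst dependent_finite)
    show "finite (a ` {..<k})" by simp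
    show "\<nexists>u. (\<exists>v\<in>a ` {..<k}. u v \<noteq> 0) \<and> (\<Sum>v\<in>a ` {..<k}. scale (u v) v) = 0"
      using a inj by (auto simp: sum.reindex indep_family_def)
  qed
  with inj show "inj_on a {..<k} \<and> independent (a ` {..<k})" ..
next
  assume a: "inj_on a {..<k} \<and> independent (a ` {..<k})"
  show "indep_family scale k a"
    unfolding indep_family_def
  proof (intro allI impI)
    fix c l assume c: "(\<Sum>l<k. scale (c l) (a l)) = 0" and l: "l < k"
    let ?u = "c \<circ> the_inv_into {..<k} a"
    have u: "?u (a l) = c l" if "l < k" for l
      using a that by (simp add: the_inv_into_f_f)
    have "(\<Sum>v\<in>a ` {..<k}. scale (?u v) v) = (\<Sum>l<k. scale (?u (a l)) (a l))"
      using a by (subst sum.reindex) auto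
    also have "\<dots> = 0" using c u by simp
    finally have "?u (a l) = 0"
      using independentD[of "a ` {..<k}" "a ` {..<k}" ?u "a l"] a l by auto
    then show "c l = 0" using u l by simp
  qed
qed

lemma indep_family_iff_dim: "indep_family scale k a \<longleftrightarrow> dim (span (a ` {..<k})) = k"
proof
  assume "indep_family scale k a"
  then show "dim (span (a ` {..<k})) = k"
    by (simp add: indep_family_iff dim_eq_card_independent card_image)
next
  assume k: "dim (span (a ` {..<k})) = k"
  obtain B where B: "B \<subseteq> a ` {..<k}" "independent B" "a ` {..<k} \<subseteq> span B"
    "card B = dim (a ` {..<k})" by (rule basis_exists)
  have "card (a ` {..<k}) \<le> card B" using B(4) k card_image_le[of "{..<k}" a] by simp
  then have "B = a ` {..<k}" using B(1) by (simp add: card_seteq)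
  moreover from this have "inj_on a {..<k}" using B(4) k by (simp add: eq_card_imp_inj_on)
  ultimately show "indep_family scale k a" using B(2) by (simp add: indep_family_iff)
qed

lemma subspace_separation:
  assumes "subspace E" "x \<notin> E"
  obtains \<phi> where "Vector_Spaces.linear scale (*) \<phi>" "\<phi> x = 1" "\<And>y. y \<in> E \<Longrightarrow> \<phi> y = 0"
proof -
  interpret P: vector_space_pair scale "(*) :: 'a \<Rightarrow> 'a \<Rightarrow> 'a"
    using vector_space_mult vector_space_axioms by (simp add: vector_space_pair_def)
  obtain B where B: "B \<subseteq> E" "independent B" "E \<subseteq> span B"
    by (rule maximal_independent_subset)
  have x: "x \<notin> span B" using assms B(1) span_minimal[of B E] by blast
  then have ind: "independent (insert x B)" using B(2) by (simp add: independent_insert)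
  define \<phi> where "\<phi> = P.construct (insert x B) (\<lambda>b. if b = x then 1 else 0)"
  have lin: "Vector_Spaces.linear scale (*) \<phi>"
    unfolding \<phi>_def using ind by (rule P.linear_construct)
  have "\<phi> x = 1" unfolding \<phi>_def using ind by (simp add: P.construct_basis)
  moreover have "\<phi> y = 0" if "y \<in> E" for y
  proof (rule P.linear_eq_0_on_span[OF lin])
    show "y \<in> span B" using that B(3) by blast
    fix b assume b: "b \<in> B"
    then have "b \<noteq> x" using x span_base by blast
    then show "\<phi> b = 0" unfolding \<phi>_def using ind b by (simp add: P.construct_basis)
  qed
  ultimately show ?thesis using lin that by blast
qed

lemma dual_functionals:
  assumes "indep_family scale k a"
  obtains \<phi> where "\<And>m. Vector_Spaces.linear scale (*) (\<phi> m)"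
    "\<And>m l. m < k \<Longrightarrow> l < k \<Longrightarrow> \<phi> m (a l) = (if m = l then 1 else 0)"
proof -
  interpret P: vector_space_pair scale "(*) :: 'a \<Rightarrow> 'a \<Rightarrow> 'a"
    using vector_space_mult vector_space_axioms by (simp add: vector_space_pair_def)
  have inj: "inj_on a {..<k}" and ind: "independent (a ` {..<k})"
    using assms by (auto simp: indep_family_iff)
  define \<phi> where "\<phi> m = P.construct (a ` {..<k}) (\<lambda>b. if b = a m then 1 else 0)" for m
  have "Vector_Spaces.linear scale (*) (\<phi> m)" for m
    unfolding \<phi>_def using ind by (rule P.linear_construct)
  moreover have "\<phi> m (a l) = (if m = l then 1 else 0)" if "m < k" "l < k" for m l
    unfolding \<phi>_def using that inj by (subst P.construct_basis[OF ind]) (auto simp: inj_on_eq_iff)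
  ultimately show ?thesis using that by blast
qed

lemma indep_family_dual:
  fixes k :: nat
  assumes "\<And>m. m < k \<Longrightarrow> Vector_Spaces.linear scale (*) (\<phi> m)"
    "\<And>m l. m < k \<Longrightarrow> l < k \<Longrightarrow> \<phi> m (a l) = (if m = l then 1 else 0)"
  shows "indep_family scale k a"
  unfolding indep_family_def
proof (intro allI impI)
  fix c m assume c: "(\<Sum>l<k. scale (c l) (a l)) = 0" and m: "m < k"
  have "\<phi> m (\<Sum>l<k. scale (c l) (a l)) = (\<Sum>l<k. c l * \<phi> m (a l))"
    by (simp add: linear_rules[OF assms(1)[OF m]])
  also have "\<dots> = (\<Sum>l<k. c l * (if m = l then 1 else 0))" using assms(2) m by simp
  also have "\<dots> = c m" using m by (rule sum_delta_mult)
  finally show "c m = 0" using c linear_rules(4)[OF assms(1)[OF m]] by simp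
qed

lemma extend_to_dual_basis:
  assumes a: "indep_family scale k a" and d: "dim UNIV = d" "d > 0"
  obtains e e' where "k \<le> d" "dual_basis scale d e e'" "\<And>l. l < k \<Longrightarrow> e l = a l"
proof -
  have inj: "inj_on a {..<k}" and ind: "independent (a ` {..<k})"
    using a by (auto simp: indep_family_iff)
  obtain B where B: "a ` {..<k} \<subseteq> B" "independent B" "UNIV \<subseteq> span B"
    by (rule maximal_independent_subset_extend[OF subset_UNIV ind])
  have "span B = span UNIV" using B(3) by (simp add: top.extremum_unique)
  then have cardB: "card B = d" using B(2) d(1) dim_eq_card[of B UNIV] by simp
  then have fin: "finite B" using d(2) by (metis card.infinite not_less0)
  have ak: "card (a ` {..<k}) = k" using inj by (simp add: card_image)
  have kd: "k \<le> d" using card_mono[OF fin B(1)] ak cardB by simp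
  have "card (B - a ` {..<k}) = d - k" using B(1) cardB ak by (simp add: card_Diff_subset)
  then obtain h where h: "bij_betw h {0..<d - k} (B - a ` {..<k})"
    using ex_bij_betw_nat_finite[of "B - a ` {..<k}"] fin by auto
  define e where "e l = (if l < k then a l else h (l - k))" for l
  have e_im: "e ` {..<d} = B"
  proof -
    have "e ` {..<d} = e ` {..<k} \<union> e ` {k..<d}"
      using kd by (metis image_Un ivl_disj_un_one(2))
    also have "e ` {..<k} = a ` {..<k}" by (auto simp: e_def)
    also have "e ` {k..<d} = h ` {0..<d - k}"
    proof -
      have *: "{k..<d} = (\<lambda>i. i + k) ` {0..<d - k}" using kd by (simp add: image_add_atLeastLessThan')
      show ?thesis unfolding * image_image by (simp add: e_def)
    qed
    finally show ?thesis using h B(1) by (auto simp: bij_betw_def)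
  qed
  have "inj_on e {..<d}" using e_im cardB by (simp add: eq_card_imp_inj_on)
  then have eind: "indep_family scale d e" using e_im B(2) by (simp add: indep_family_iff)
  obtain e' where lin: "\<And>m. Vector_Spaces.linear scale (*) (e' m)"
    and e': "\<And>m l. m < d \<Longrightarrow> l < d \<Longrightarrow> e' m (e l) = (if m = l then 1 else 0)"
    using dual_functionals[OF eind] by blast
  have "x = (\<Sum>n<d. scale (e' n x) (e n))" for x
  proof -
    have "x \<in> span (e ` {..<d})" using B(3) e_im by auto
    then obtain c where c: "x = (\<Sum>n<d. scale (c n) (e n))" by (auto simp: span_family)
    have "e' n x = c n" if "n < d" for n
    proof -
      have "e' n x = (\<Sum>l<d. c l * e' n (e l))" unfolding c by (simp add: linear_rules[OF lin])
      also have "\<dots> = (\<Sum>l<d. c l * (if n = l then 1 else 0))" using e' that by simp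
      finally show ?thesis using that by (simp add: sum_delta_mult)
    qed
    then show ?thesis using c by simp
  qed
  then have "dual_basis scale d e e'" using lin e' by (simp add: dual_basis_def)
  then show ?thesis using that kd by (simp add: e_def)
qed

end

section \<open>Determinants of square families of scalars\<close>

text \<open>
  Matrices are functions on pairs of indices here, so that the entries can in turn depend on a point
  of an affine space.
\<close>

definition fdet :: "nat \<Rightarrow> (nat \<Rightarrow> nat \<Rightarrow> 'k::field) \<Rightarrow> 'k"
  where "fdet k A = Determinant.det (Matrix.mat k k (\<lambda>(i, j). A i j))"

definition fadj :: "nat \<Rightarrow> (nat \<Rightarrow> nat \<Rightarrow> 'k::field) \<Rightarrow> nat \<Rightarrow> nat \<Rightarrow> 'k"
  where "fadj k A j l = (-1) ^ (l + j) *
    fdet (k - 1) (\<lambda>m n. A (insert_index l m) (insert_index j n))"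

lemma fdet_leibniz:
  "fdet k A = (\<Sum>p | p permutes {0..<k}. signof p * (\<Prod>i = 0..<k. A i (p i)))"
proof -
  have "fdet k A = (\<Sum>p | p permutes {0..<k}. signof p *
    (\<Prod>i = 0..<k. Matrix.mat k k (\<lambda>(i, j). A i j) $$ (i, p i)))"
    unfolding fdet_def by (subst det_def'[of _ k]) auto
  also have "\<dots> = (\<Sum>p | p permutes {0..<k}. signof p * (\<Prod>i = 0..<k. A i (p i)))"
    by (intro sum.cong prod.cong arg_cong2[where f = "(*)"] refl)
      (auto dest: permutes_in_image)
  finally show ?thesis .
qed

lemma fdet_delta:
  assumes "\<And>i j. i < k \<Longrightarrow> j < k \<Longrightarrow> A i j = (if i = j then 1 else 0)"
  shows "fdet k A = 1"
proof -
  have "Matrix.mat k k (\<lambda>(i, j). A i j) = 1\<^sub>m k" using assms by (auto simp: one_mat_def)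
  then show ?thesis by (simp add: fdet_def)
qed

lemma fdet_nonzero_kernel:
  assumes "fdet k A \<noteq> 0" "\<And>i. i < k \<Longrightarrow> (\<Sum>j<k. A i j * c j) = 0" "j < k"
  shows "c j = 0"
proof -
  let ?A = "Matrix.mat k k (\<lambda>(i, j). A i j)" and ?c = "Matrix.vec k c"
  have "?A *\<^sub>v ?c = 0\<^sub>v k"
    using assms(2) by (auto simp: scalar_prod_def atLeast0LessThan)
  then have "?c = 0\<^sub>v k"
    using assms(1) det_0_iff_vec_prod_zero_field[of ?A k] vec_carrier[of k c]
    unfolding fdet_def by (metis mat_carrier)
  then show ?thesis using assms(3) by (metis index_vec index_zero_vec(1))
qed

lemma fdet_fadj:
  assumes "i < k" "l < k"
  shows "(\<Sum>j<k. A i j * fadj k A j l) = (if i = l then fdet k A else 0)"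
proof -
  let ?A = "Matrix.mat k k (\<lambda>(i, j). A i j)"
  have adj: "adj_mat ?A $$ (j, l) = fadj k A j l" if "j < k" for j
    using assms that
    by (auto simp: adj_mat_def cofactor_def fadj_def fdet_def mat_delete_def insert_index_def
        intro!: arg_cong[where f = Determinant.det] eq_matI)
  have "(?A * adj_mat ?A) $$ (i, l) = (\<Sum>j<k. A i j * fadj k A j l)"
    using assms adj_mat(1)[of ?A k] adj by (auto simp: scalar_prod_def atLeast0LessThan)
  moreover have "(?A * adj_mat ?A) $$ (i, l) = (if i = l then fdet k A else 0)"
    using assms adj_mat(2)[of ?A k] by (simp add: fdet_def)
  ultimately show ?thesis by simp
qed

lemma fdet_2: "fdet 2 A = A 0 0 * A 1 1 - A 0 1 * A 1 0"
proof -
  have 1: "fdet (Suc 0) B = B 0 0" for B :: "nat \<Rightarrow> nat \<Rightarrow> 'a"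
    by (simp add: fdet_def det_single)
  have "fdet 2 A = (\<Sum>j<2. A 0 j * fadj 2 A j 0)" using fdet_fadj[of 0 2 0 A] by simp
  then show ?thesis
    by (simp add: numeral_2_eq_2 fadj_def 1 insert_index_def)
qed

section \<open>Polynomial functions\<close>

lemma polyfuns_sum:
  "(\<And>i. i \<in> A \<Longrightarrow> P i \<in> polyfuns s J) \<Longrightarrow> (\<lambda>a. \<Sum>i\<in>A. P i a) \<in> polyfuns s J"
  by (induction A rule: infinite_finite_induct) (auto intro: polyfuns.intros)

lemma polyfuns_prod:
  "(\<And>i. i \<in> A \<Longrightarrow> P i \<in> polyfuns s J) \<Longrightarrow> (\<lambda>a. \<Prod>i\<in>A. P i a) \<in> polyfuns s J"
  by (induction A rule: infinite_finite_induct) (auto intro: polyfuns.intros)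

lemma polyfuns_diff:
  assumes "P \<in> polyfuns s J" "Q \<in> polyfuns s J"
  shows "(\<lambda>a. P a - Q a) \<in> polyfuns s J"
  using polyfuns.add[OF assms(1) polyfuns.mult[OF polyfuns.const[of "-1"] assms(2)]] by simp

lemma polyfuns_fdet:
  assumes "\<And>i j. i < k \<Longrightarrow> j < k \<Longrightarrow> A i j \<in> polyfuns s J"
  shows "(\<lambda>a. fdet k (\<lambda>i j. A i j a)) \<in> polyfuns s J"
  unfolding fdet_leibniz
proof (intro polyfuns_sum polyfuns.mult polyfuns_prod polyfuns.const)
  fix p i assume "p \<in> {p. p permutes {0..<k}}" "i \<in> {0..<k}"
  then show "A i (p i) \<in> polyfuns s J"
    using assms permutes_in_image[of p "{0..<k}" i] by auto
qed

lemma polyfuns_fadj: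
  assumes "\<And>i j. i < k \<Longrightarrow> j < k \<Longrightarrow> A i j \<in> polyfuns s J" "j < k" "l < k"
  shows "(\<lambda>a. fadj k (\<lambda>i j. A i j a) j l) \<in> polyfuns s J"
  unfolding fadj_def
proof (intro polyfuns.mult polyfuns.const polyfuns_fdet)
  fix m n assume "m < k - 1" "n < k - 1"
  then show "A (insert_index l m) (insert_index j n) \<in> polyfuns s J"
    using assms by (intro assms(1)) (auto simp: insert_index_def)
qed

lemma polyfuns_cong:
  "P \<in> polyfuns s J \<Longrightarrow> (\<And>j. j \<in> J \<Longrightarrow> a j = b j) \<Longrightarrow> P a = P b"
  by (induction P rule: polyfuns.induct) auto

text \<open>
  Composition with a polynomial map. It suffices that the functionals of the coordinates of the
  map are polynomial, since these generate all polynomial functions.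
\<close>

lemma polyfuns_compose:
  assumes "P \<in> polyfuns s' J'"
    "\<And>j \<phi>. j \<in> J' \<Longrightarrow> Vector_Spaces.linear s' (*) \<phi> \<Longrightarrow> (\<lambda>a. \<phi> (F a j)) \<in> polyfuns s J"
  shows "(\<lambda>a. P (F a)) \<in> polyfuns s J"
  using assms by (induction P rule: polyfuns.induct) (auto intro: polyfuns.intros)

definition line_point ::
  "('k::field \<Rightarrow> 'u::ab_group_add \<Rightarrow> 'u) \<Rightarrow> 'j set \<Rightarrow> ('j \<Rightarrow> 'u) \<Rightarrow> ('j \<Rightarrow> 'u) \<Rightarrow> 'k \<Rightarrow> ('j \<Rightarrow> 'u)"
  where "line_point s J a v t = (\<lambda>j\<in>J. a j + s t (v j))"

lemma line_point_in [simp]: "line_point s J a v t \<in> J \<rightarrow>\<^sub>E UNIV"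
  by (simp add: line_point_def)

lemma line_point_0:
  assumes "vector_space s" "a \<in> J \<rightarrow>\<^sub>E UNIV"
  shows "line_point s J a v 0 = a"
proof -
  interpret vector_space s by fact
  show ?thesis using assms(2) by (auto simp: line_point_def fun_eq_iff PiE_def extensional_def)
qed

lemma line_point_1:
  assumes "vector_space s" "b \<in> J \<rightarrow>\<^sub>E UNIV"
  shows "line_point s J a (\<lambda>j. b j - a j) 1 = b"
proof -
  interpret vector_space s by fact
  show ?thesis using assms(2) by (auto simp: line_point_def fun_eq_iff PiE_def extensional_def)
qed

text \<open>
  Restricted to a line, a polynomial function is a polynomial in the parameter. This reduces
  derivatives and density to polynomials in one variable.
\<close>

lemma polyfuns_line:
  assumes "P \<in> polyfuns s J"
  shows "\<exists>p. \<forall>t. P (line_point s J a v t) = poly p t"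
  using assms
proof (induction P rule: polyfuns.induct)
  case (const c)
  show ?case by (rule exI[of _ "[:c:]"]) simp
next
  case (coord j \<phi>)
  then show ?case
    by (intro exI[of _ "[:\<phi> (a j), \<phi> (v j):]"]) (simp add: line_point_def linear_rules[of s "(*)" \<phi>])
next
  case (add P Q)
  then show ?case by (metis poly_add)
next
  case (mult P Q)
  then show ?case by (metis poly_mult)
qed

lemma poly_eq_infinite:
  fixes p q :: "'k::field poly"
  assumes "infinite (UNIV :: 'k set)" "r \<noteq> 0" "\<And>t. poly r t \<noteq> 0 \<Longrightarrow> poly p t = poly q t"
  shows "p = q"
proof (rule ccontr)
  assume "p \<noteq> q"
  then have "r * (p - q) \<noteq> 0" using assms(2) by simp
  then have "finite {t. poly (r * (p - q)) t = 0}" by (rule poly_roots_finite)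
  moreover have "{t. poly (r * (p - q)) t = 0} = UNIV" using assms(3) by auto
  ultimately show False using assms(1) by metis
qed

text \<open>
  Affine space over an infinite field is irreducible: on the line through two points at which two
  polynomial functions do not vanish, both vanish only finitely often.
\<close>

lemma polyfuns_common_nonzero:
  fixes s :: "'k::field \<Rightarrow> 'u::ab_group_add \<Rightarrow> 'u"
  assumes inf: "infinite (UNIV :: 'k set)" and "vector_space s"
    and P: "P \<in> polyfuns s J" "a \<in> J \<rightarrow>\<^sub>E UNIV" "P a \<noteq> 0"
    and Q: "Q \<in> polyfuns s J" "b \<in> J \<rightarrow>\<^sub>E UNIV" "Q b \<noteq> 0"
  obtains c where "c \<in> J \<rightarrow>\<^sub>E UNIV" "P c \<noteq> 0" "Q c \<noteq> 0"
proof -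
  let ?l = "line_point s J a (\<lambda>j. b j - a j)"
  obtain p where p: "\<And>t. P (?l t) = poly p t" using polyfuns_line[OF P(1)] by blast
  obtain q where q: "\<And>t. Q (?l t) = poly q t" using polyfuns_line[OF Q(1)] by blast
  have "poly p 0 \<noteq> 0" using p[of 0] P assms(2) by (simp add: line_point_0)
  then have "p \<noteq> 0" by auto
  have "poly q 1 \<noteq> 0" using q[of 1] Q assms(2) by (simp add: line_point_1)
  then have "q \<noteq> 0" by auto
  have "\<exists>t. poly p t \<noteq> 0 \<and> poly q t \<noteq> 0"
  proof (rule ccontr)
    assume "\<not> ?thesis"
    then have "q = 0" using poly_eq_infinite[OF inf \<open>p \<noteq> 0\<close>, of q 0] by fastforce
    with \<open>q \<noteq> 0\<close> show False ..
  qed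
  then obtain t where "P (?l t) \<noteq> 0" "Q (?l t) \<noteq> 0" using p q by auto
  from that[OF line_point_in this] show ?thesis .
qed

lemma polyfuns_prod_nonzero:
  fixes s :: "'k::field \<Rightarrow> 'u::ab_group_add \<Rightarrow> 'u"
  assumes inf: "infinite (UNIV :: 'k set)" and "vector_space s" and "finite A"
    and "\<And>i. i \<in> A \<Longrightarrow> P i \<in> polyfuns s J \<and> (\<exists>a \<in> J \<rightarrow>\<^sub>E UNIV. P i a \<noteq> 0)"
  shows "\<exists>a \<in> J \<rightarrow>\<^sub>E UNIV. (\<Prod>i\<in>A. P i a) \<noteq> 0"
  using assms(3,4)
proof (induction A)
  case empty
  show ?case by (auto intro: exI[of _ "\<lambda>j\<in>J. 0"])
next
  case (insert i A)
  obtain a where a: "a \<in> J \<rightarrow>\<^sub>E UNIV" "P i a \<noteq> 0" using insert.prems by blast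
  obtain b where b: "b \<in> J \<rightarrow>\<^sub>E UNIV" "(\<Prod>i\<in>A. P i b) \<noteq> 0" using insert by blast
  have "(\<lambda>a. \<Prod>i\<in>A. P i a) \<in> polyfuns s J" using insert.prems by (intro polyfuns_prod) auto
  then obtain c where "c \<in> J \<rightarrow>\<^sub>E UNIV" "P i c \<noteq> 0" "(\<Prod>i\<in>A. P i c) \<noteq> 0"
    using polyfuns_common_nonzero[OF inf assms(2), of "P i" J a "\<lambda>a. \<Prod>i\<in>A. P i a" b]
      a b insert.prems by blast
  then show ?case using insert.hyps by auto
qed

text \<open>
  The derivative at \<open>0\<close> of a function of one variable that agrees near \<open>0\<close> with a quotient of
  polynomials. It does not depend on the quotient because the field is infinite.
\<close>

definition rational_germ :: "('k::field \<Rightarrow> 'k) \<Rightarrow> 'k poly \<Rightarrow> 'k poly \<Rightarrow> bool"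
  where "rational_germ h p q \<longleftrightarrow> poly q 0 \<noteq> 0 \<and> (\<forall>t. poly q t \<noteq> 0 \<longrightarrow> h t = poly p t / poly q t)"

definition quotient_deriv :: "'k::field poly \<Rightarrow> 'k poly \<Rightarrow> 'k"
  where "quotient_deriv p q =
    (poly (pderiv p) 0 * poly q 0 - poly p 0 * poly (pderiv q) 0) / (poly q 0)\<^sup>2"

definition germ_deriv :: "('k::field \<Rightarrow> 'k) \<Rightarrow> 'k"
  where "germ_deriv h = (THE c. \<exists>p q. rational_germ h p q \<and> c = quotient_deriv p q)"

lemma germ_deriv_eq:
  fixes h :: "'k::field \<Rightarrow> 'k"
  assumes inf: "infinite (UNIV :: 'k set)" and h: "rational_germ h p q"
  shows "germ_deriv h = quotient_deriv p q"
  unfolding germ_deriv_def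
proof (rule the_equality)
  show "\<exists>p' q'. rational_germ h p' q' \<and> quotient_deriv p q = quotient_deriv p' q'"
    using h by blast
next
  fix c assume "\<exists>p q. rational_germ h p q \<and> c = quotient_deriv p q"
  then obtain p' q' where h': "rational_germ h p' q'" and c: "c = quotient_deriv p' q'" by blast
  have q0: "poly q 0 \<noteq> 0" "poly q' 0 \<noteq> 0" using h h' by (auto simp: rational_germ_def)
  then have "poly (q * q') 0 \<noteq> 0" by simp
  then have "q * q' \<noteq> 0" by (metis poly_0)
  then have eq: "p * q' = p' * q"
  proof (rule poly_eq_infinite[OF inf])
    fix t assume "poly (q * q') t \<noteq> 0"
    then have "poly q t \<noteq> 0" "poly q' t \<noteq> 0" by auto
    moreover from this have "h t = poly p t / poly q t" "h t = poly p' t / poly q' t"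
      using h h' by (auto simp: rational_germ_def)
    ultimately show "poly (p * q') t = poly (p' * q) t" by (simp add: field_simps)
  qed
  have e0: "poly p 0 * poly q' 0 = poly p' 0 * poly q 0" using eq by (metis poly_mult)
  have "poly (pderiv (p * q')) 0 = poly (pderiv (p' * q)) 0" using eq by simp
  then have e1: "poly p 0 * poly (pderiv q') 0 + poly (pderiv p) 0 * poly q' 0
      = poly p' 0 * poly (pderiv q) 0 + poly (pderiv p') 0 * poly q 0"
    by (simp add: pderiv_mult algebra_simps)
  define a b a' b' A B A' B' where d: "a = poly p 0" "b = poly q 0" "a' = poly p' 0"
    "b' = poly q' 0" "A = poly (pderiv p) 0" "B = poly (pderiv q) 0"
    "A' = poly (pderiv p') 0" "B' = poly (pderiv q') 0"
  have f: "a * b' = a' * b" "a * B' + A * b' = a' * B + A' * b" using e0 e1 unfolding d by auto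
  have "(A * b - a * B) * b'^2 = (A' * b' - a' * B') * b^2"
  proof -
    have "(A * b - a * B) * b'^2 = b * b' * (A * b') - B * b' * (a * b')"
      by (simp add: algebra_simps power2_eq_square)
    also have "\<dots> = b * b' * (A * b' - a' * B)"
      unfolding f(1) by (simp add: algebra_simps)
    also have "A * b' - a' * B = A' * b - a * B'"
      using f(2) by (simp add: algebra_simps)
    also have "b * b' * (A' * b - a * B') = b * b' * (A' * b) - B' * b * (a * b')"
      by (simp add: algebra_simps)
    also have "\<dots> = (A' * b' - a' * B') * b^2"
      unfolding f(1) by (simp add: algebra_simps power2_eq_square)
    finally show ?thesis .
  qed
  then show "c = quotient_deriv p q"
    unfolding c quotient_deriv_def d[symmetric] using q0 unfolding d[symmetric]
    by (simp add: frac_eq_eq)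
qed

lemma rational_germ_combine:
  assumes "rational_germ g p q" "rational_germ h p' q'"
  shows "rational_germ (\<lambda>t. g t + h t) (p * q' + p' * q) (q * q')"
    "rational_germ (\<lambda>t. g t * h t) (p * p') (q * q')"
    "rational_germ (\<lambda>t. c * g t) (Polynomial.smult c p) q"
  using assms by (auto simp: rational_germ_def field_simps)

lemma quotient_deriv_combine:
  assumes "poly q 0 \<noteq> 0" "poly q' 0 \<noteq> 0"
  shows "quotient_deriv (p * q' + p' * q) (q * q') = quotient_deriv p q + quotient_deriv p' q'"
    "quotient_deriv (p * p') (q * q') =
      poly p 0 / poly q 0 * quotient_deriv p' q' + poly p' 0 / poly q' 0 * quotient_deriv p q"
    "quotient_deriv (Polynomial.smult c p) q = c * quotient_deriv p q"
  using assms
  by (simp_all add: quotient_deriv_def pderiv_mult pderiv_add pderiv_smult field_simps power2_eq_square)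

section \<open>Homogeneous presentations of varieties\<close>

text \<open>
  What a presentation of a variety as a quotient of an open set \<open>S\<close> of an affine space must satisfy for
  the arguments below. The assumption \<open>fibre\<close> replaces a group that acts by polynomial maps on \<open>S\<close> and
  has the fibres of \<open>\<pi>\<close> as orbits: it provides for two points of one fibre a polynomial
  transformation of \<open>S\<close> over \<open>\<pi>\<close> that moves one to the other.
\<close>

locale homogeneous_presentation =
  fixes s :: "'k::field \<Rightarrow> 'u::ab_group_add \<Rightarrow> 'u" and J :: "'j set"
    and S :: "('j \<Rightarrow> 'u) set" and \<pi> :: "('j \<Rightarrow> 'u) \<Rightarrow> 'x"
  assumes vs: "vector_space s"
    and inf: "infinite (UNIV :: 'k set)"
    and S_sub: "S \<subseteq> J \<rightarrow>\<^sub>E UNIV"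
    and fibre: "\<And>a a'. a \<in> S \<Longrightarrow> a' \<in> S \<Longrightarrow> \<pi> a = \<pi> a' \<Longrightarrow>
      \<exists>F. (\<forall>j\<in>J. \<forall>\<phi>. Vector_Spaces.linear s (*) \<phi> \<longrightarrow> (\<lambda>b. \<phi> (F b j)) \<in> polyfuns s J) \<and>
        (\<forall>b\<in>S. F b \<in> S \<and> \<pi> (F b) = \<pi> b) \<and> F a = a'"
    and S_open: "\<And>a. a \<in> S \<Longrightarrow>
      \<exists>\<psi>\<in>polyfuns s J. \<psi> a \<noteq> 0 \<and> (\<forall>b\<in>J \<rightarrow>\<^sub>E UNIV. \<psi> b \<noteq> 0 \<longrightarrow> b \<in> S)"
begin

abbreviation R :: "'x \<Rightarrow> ('x \<Rightarrow> 'k) set" where "R x \<equiv> regular_funs s J S \<pi> x"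

text \<open>
  The definition of a regular function at a point of the variety refers to some point of the fibre.
  A transformation from \<open>fibre\<close> carries a presentation as a quotient to any other point.
\<close>

lemma regular_funsE:
  assumes "f \<in> R (\<pi> a)" "a \<in> S"
  obtains P Q where "P \<in> polyfuns s J" "Q \<in> polyfuns s J" "Q a \<noteq> 0"
    "\<And>b. b \<in> S \<Longrightarrow> Q b \<noteq> 0 \<Longrightarrow> f (\<pi> b) = P b / Q b"
proof -
  obtain a0 P Q where a0: "a0 \<in> S" "\<pi> a0 = \<pi> a"
    and PQ: "P \<in> polyfuns s J" "Q \<in> polyfuns s J" "Q a0 \<noteq> 0"
      "\<And>b. b \<in> S \<Longrightarrow> Q b \<noteq> 0 \<Longrightarrow> f (\<pi> b) = P b / Q b"
    using assms(1) unfolding regular_funs_def by blast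
  obtain F where F: "\<And>j \<phi>. j \<in> J \<Longrightarrow> Vector_Spaces.linear s (*) \<phi> \<Longrightarrow> (\<lambda>b. \<phi> (F b j)) \<in> polyfuns s J"
    "\<And>b. b \<in> S \<Longrightarrow> F b \<in> S" "\<And>b. b \<in> S \<Longrightarrow> \<pi> (F b) = \<pi> b" "F a = a0"
    using fibre[OF assms(2) a0(1)] a0(2) by metis
  show ?thesis
  proof (rule that)
    show "(\<lambda>b. P (F b)) \<in> polyfuns s J" "(\<lambda>b. Q (F b)) \<in> polyfuns s J"
      using PQ F(1) by (auto intro: polyfuns_compose)
    show "Q (F a) \<noteq> 0" using PQ F by simp
    fix b assume "b \<in> S" "Q (F b) \<noteq> 0"
    then show "f (\<pi> b) = P (F b) / Q (F b)" using PQ(4)[of "F b"] F(2,3)[of b] by simp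
  qed
qed

lemma regular_funsI:
  assumes "a \<in> S" "P \<in> polyfuns s J" "Q \<in> polyfuns s J" "Q a \<noteq> 0"
    "\<And>b. b \<in> S \<Longrightarrow> Q b \<noteq> 0 \<Longrightarrow> f (\<pi> b) = P b / Q b"
  shows "f \<in> R (\<pi> a)"
  using assms unfolding regular_funs_def by blast

lemma regular_const: "a \<in> S \<Longrightarrow> (\<lambda>_. c) \<in> R (\<pi> a)"
  by (rule regular_funsI[of _ "\<lambda>_. c" "\<lambda>_. 1"]) (auto intro: polyfuns.const)

lemma regular_add:
  assumes "a \<in> S" "f \<in> R (\<pi> a)" "g \<in> R (\<pi> a)"
  shows "(\<lambda>y. f y + g y) \<in> R (\<pi> a)"
proof -
  obtain P Q where f: "P \<in> polyfuns s J" "Q \<in> polyfuns s J" "Q a \<noteq> 0"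
    "\<And>b. b \<in> S \<Longrightarrow> Q b \<noteq> 0 \<Longrightarrow> f (\<pi> b) = P b / Q b"
    using regular_funsE[OF assms(2,1)] by blast
  obtain P' Q' where g: "P' \<in> polyfuns s J" "Q' \<in> polyfuns s J" "Q' a \<noteq> 0"
    "\<And>b. b \<in> S \<Longrightarrow> Q' b \<noteq> 0 \<Longrightarrow> g (\<pi> b) = P' b / Q' b"
    using regular_funsE[OF assms(3,1)] by blast
  show ?thesis
    by (rule regular_funsI[of _ "\<lambda>b. P b * Q' b + P' b * Q b" "\<lambda>b. Q b * Q' b"])
      (use assms(1) f g in \<open>auto intro!: polyfuns.intros simp: field_simps\<close>)
qed

lemma regular_mult:
  assumes "a \<in> S" "f \<in> R (\<pi> a)" "g \<in> R (\<pi> a)"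
  shows "(\<lambda>y. f y * g y) \<in> R (\<pi> a)"
proof -
  obtain P Q where f: "P \<in> polyfuns s J" "Q \<in> polyfuns s J" "Q a \<noteq> 0"
    "\<And>b. b \<in> S \<Longrightarrow> Q b \<noteq> 0 \<Longrightarrow> f (\<pi> b) = P b / Q b"
    using regular_funsE[OF assms(2,1)] by blast
  obtain P' Q' where g: "P' \<in> polyfuns s J" "Q' \<in> polyfuns s J" "Q' a \<noteq> 0"
    "\<And>b. b \<in> S \<Longrightarrow> Q' b \<noteq> 0 \<Longrightarrow> g (\<pi> b) = P' b / Q' b"
    using regular_funsE[OF assms(3,1)] by blast
  show ?thesis
    by (rule regular_funsI[of _ "\<lambda>b. P b * P' b" "\<lambda>b. Q b * Q' b"])
      (use assms(1) f g in \<open>auto intro!: polyfuns.intros\<close>)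
qed

lemma regular_cmult: "a \<in> S \<Longrightarrow> f \<in> R (\<pi> a) \<Longrightarrow> (\<lambda>y. c * f y) \<in> R (\<pi> a)"
  using regular_mult[of a "\<lambda>_. c" f] by (simp add: regular_const)

lemma regular_sum:
  "a \<in> S \<Longrightarrow> (\<And>i. i \<in> A \<Longrightarrow> f i \<in> R (\<pi> a)) \<Longrightarrow> (\<lambda>y. \<Sum>i\<in>A. f i y) \<in> R (\<pi> a)"
  by (induction A rule: infinite_finite_induct) (auto intro: regular_const regular_add)

text \<open>
  The property \<open>T\<close> holds on a basic open neighbourhood of \<open>\<pi> a\<close>, described in terms of points of \<open>S\<close>.
\<close>

definition near :: "('j \<Rightarrow> 'u) \<Rightarrow> ('x \<Rightarrow> bool) \<Rightarrow> bool"
  where "near a T \<longleftrightarrow> (\<exists>Q\<in>polyfuns s J. Q a \<noteq> 0 \<and> (\<forall>b\<in>S. Q b \<noteq> 0 \<longrightarrow> T (\<pi> b)))"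

lemma near_conj: "near a T \<Longrightarrow> near a T' \<Longrightarrow> near a (\<lambda>y. T y \<and> T' y)"
  unfolding near_def
proof (elim bexE conjE)
  fix Q Q' assume Q: "Q \<in> polyfuns s J" "Q a \<noteq> 0" "\<forall>b\<in>S. Q b \<noteq> 0 \<longrightarrow> T (\<pi> b)"
    "Q' \<in> polyfuns s J" "Q' a \<noteq> 0" "\<forall>b\<in>S. Q' b \<noteq> 0 \<longrightarrow> T' (\<pi> b)"
  then show "\<exists>Q\<in>polyfuns s J. Q a \<noteq> 0 \<and> (\<forall>b\<in>S. Q b \<noteq> 0 \<longrightarrow> T (\<pi> b) \<and> T' (\<pi> b))"
    by (intro bexI[of _ "\<lambda>b. Q b * Q' b"]) (auto intro: polyfuns.mult)
qed

lemma near_mono: "near a T \<Longrightarrow> (\<And>y. T y \<Longrightarrow> T' y) \<Longrightarrow> near a T'"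
  unfolding near_def by blast

lemma near_nonzero:
  assumes "a \<in> S" "f \<in> R (\<pi> a)" "f (\<pi> a) \<noteq> 0"
  shows "near a (\<lambda>y. f y \<noteq> 0)"
proof -
  obtain P Q where f: "P \<in> polyfuns s J" "Q \<in> polyfuns s J" "Q a \<noteq> 0"
    "\<And>b. b \<in> S \<Longrightarrow> Q b \<noteq> 0 \<Longrightarrow> f (\<pi> b) = P b / Q b"
    using regular_funsE[OF assms(2,1)] by blast
  then show ?thesis
    unfolding near_def using assms
    by (intro bexI[of _ "\<lambda>b. P b * Q b"]) (auto intro: polyfuns.mult)
qed

text \<open>
  The map \<open>\<pi>\<close> is open because the preimage of the image of an open set is the union of its
  translates by the maps that act transitively on the fibres.
\<close>

lemma openin_image_nonzero:
  assumes G: "G \<in> polyfuns s J"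
  shows "openin (quotient_top (subtopology (affine_zariski s J) S) \<pi>) (\<pi> ` {a \<in> S. G a \<noteq> 0})"
proof -
  let ?T = "subtopology (affine_zariski s J) S" and ?U = "\<pi> ` {a \<in> S. G a \<noteq> 0}"
  have top: "topspace ?T = S" using S_sub by (simp add: topspace_affine_zariski Int_absorb1)
  define \<F> where "\<F> = {P \<in> polyfuns s J. \<forall>a\<in>S. P a \<noteq> 0 \<longrightarrow> \<pi> a \<in> ?U}"
  have "\<exists>P\<in>\<F>. P a \<noteq> 0" if a: "a \<in> S" "\<pi> a \<in> ?U" for a
  proof -
    obtain a' where a': "a' \<in> S" "G a' \<noteq> 0" "\<pi> a = \<pi> a'" using a(2) by auto
    obtain F where F: "\<And>j \<phi>. j \<in> J \<Longrightarrow> Vector_Spaces.linear s (*) \<phi> \<Longrightarrow> (\<lambda>b. \<phi> (F b j)) \<in> polyfuns s J"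
      "\<And>b. b \<in> S \<Longrightarrow> F b \<in> S" "\<And>b. b \<in> S \<Longrightarrow> \<pi> (F b) = \<pi> b" "F a = a'"
      using fibre[OF a(1) a'(1,3)] by metis
    have G': "(\<lambda>b. G (F b)) \<in> \<F>"
      unfolding \<F>_def
    proof (intro CollectI conjI ballI impI)
      show "(\<lambda>b. G (F b)) \<in> polyfuns s J" using F(1) by (rule polyfuns_compose[OF G])
      fix b assume b: "b \<in> S" "G (F b) \<noteq> 0"
      then have "\<pi> (F b) \<in> ?U" using F(2) by blast
      then show "\<pi> b \<in> ?U" using F(3)[OF b(1)] by simp
    qed
    show ?thesis by (rule bexI[OF _ G']) (simp add: F(4) a'(2))
  qed
  then have "{a \<in> S. \<pi> a \<in> ?U} = {a \<in> J \<rightarrow>\<^sub>E UNIV. \<exists>P\<in>\<F>. P a \<noteq> 0} \<inter> S"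
    using S_sub by (auto simp: \<F>_def)
  moreover have "openin (affine_zariski s J) {a \<in> J \<rightarrow>\<^sub>E UNIV. \<exists>P\<in>\<F>. P a \<noteq> 0}"
    unfolding openin_affine_zariski by (intro exI[of _ \<F>]) (auto simp: \<F>_def)
  ultimately have "openin ?T {a \<in> S. \<pi> a \<in> ?U}" unfolding openin_subtopology by blast
  then show ?thesis unfolding openin_quotient_top top by auto
qed

subsection \<open>Derivations\<close>

context
  fixes D a assumes D: "D \<in> tangent_space (R (\<pi> a)) (\<pi> a)" and a: "a \<in> S"
begin

lemma deriv_add: "f \<in> R (\<pi> a) \<Longrightarrow> g \<in> R (\<pi> a) \<Longrightarrow> D (\<lambda>y. f y + g y) = D f + D g"
  and deriv_cmult: "f \<in> R (\<pi> a) \<Longrightarrow> D (\<lambda>y. c * f y) = c * D f"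
  and deriv_mult: "f \<in> R (\<pi> a) \<Longrightarrow> g \<in> R (\<pi> a) \<Longrightarrow>
    D (\<lambda>y. f y * g y) = f (\<pi> a) * D g + g (\<pi> a) * D f"
  using D by (auto simp: tangent_space_def)

lemma deriv_const: "D (\<lambda>_. c) = 0"
proof -
  have "D (\<lambda>y. 1 * 1) = 1 * D (\<lambda>_. 1) + 1 * D (\<lambda>_. 1)"
    by (rule deriv_mult) (auto intro: regular_const a)
  then have "D (\<lambda>_. 1) = 0" by (metis add_cancel_right_right mult_1)
  then show ?thesis using deriv_cmult[of "\<lambda>_. 1" c] regular_const[OF a] by simp
qed

lemma deriv_sum:
  "(\<And>i. i \<in> A \<Longrightarrow> f i \<in> R (\<pi> a)) \<Longrightarrow> D (\<lambda>y. \<Sum>i\<in>A. f i y) = (\<Sum>i\<in>A. D (f i))"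
  by (induction A rule: infinite_finite_induct)
    (auto simp: deriv_const deriv_add regular_sum a)

text \<open>
  Derivations are local: the difference of two functions that agree near the point is unchanged
  when multiplied by the indicator of the set where they differ, and both factors vanish there.
\<close>

lemma deriv_near:
  assumes f: "f \<in> R (\<pi> a)" and g: "g \<in> R (\<pi> a)" and near: "near a (\<lambda>y. f y = g y)"
  shows "D f = D g"
proof -
  define h where "h y = (if f y = g y then 0 else 1 :: 'k)" for y
  obtain Q where Q: "Q \<in> polyfuns s J" "Q a \<noteq> 0" "\<And>b. b \<in> S \<Longrightarrow> Q b \<noteq> 0 \<Longrightarrow> f (\<pi> b) = g (\<pi> b)"
    using near unfolding near_def by blast
  have h: "h \<in> R (\<pi> a)"
    by (rule regular_funsI[of _ "\<lambda>_. 0" Q]) (use Q a in \<open>auto simp: h_def intro: polyfuns.const\<close>)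
  have 0: "f (\<pi> a) = g (\<pi> a)" "h (\<pi> a) = 0" using Q(2,3) a by (auto simp: h_def)
  let ?d = "\<lambda>y. f y + (-1) * g y"
  have d: "?d \<in> R (\<pi> a)" by (intro regular_add regular_cmult f g a)
  have "D (\<lambda>y. ?d y * h y) = ?d (\<pi> a) * D h + h (\<pi> a) * D ?d" by (rule deriv_mult[OF d h])
  also have "\<dots> = 0" using 0 by simp
  also have "(\<lambda>y. ?d y * h y) = ?d" by (auto simp: h_def)
  finally have "D f + D (\<lambda>y. (-1) * g y) = 0" using deriv_add[OF f regular_cmult[OF a g]] by metis
  then have "D f + (-1) * D g = 0" by (simp only: deriv_cmult[OF g])
  then show ?thesis by simp
qed

text \<open>
  If a derivation acts on the coordinates of a system \<open>b\<close> of local coordinates as differentiation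
  along \<open>v\<close>, it acts on all polynomials in these coordinates in this way.
\<close>

lemma deriv_polyfun:
  assumes P: "P \<in> polyfuns s' J'"
    and b: "\<And>j \<phi>. j \<in> J' \<Longrightarrow> Vector_Spaces.linear s' (*) \<phi> \<Longrightarrow>
      (\<lambda>y. \<phi> (b y j)) \<in> R (\<pi> a) \<and> D (\<lambda>y. \<phi> (b y j)) = \<phi> (v j)"
  shows "(\<lambda>y. P (b y)) \<in> R (\<pi> a) \<and>
    (\<exists>p. (\<forall>t. P (line_point s' J' (b (\<pi> a)) v t) = poly p t) \<and> P (b (\<pi> a)) = poly p 0 \<and>
      D (\<lambda>y. P (b y)) = poly (pderiv p) 0)"
  using P
proof (induction P rule: polyfuns.induct)
  case (const c)
  then show ?case by (auto intro!: exI[of _ "[:c:]"] regular_const a simp: deriv_const)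
next
  case (coord j \<phi>)
  then show ?case using b[of j \<phi>]
    by (auto intro!: exI[of _ "[:\<phi> (b (\<pi> a) j), \<phi> (v j):]"]
        simp: line_point_def linear_rules[of s' "(*)" \<phi>] pderiv_pCons)
next
  case (add P Q)
  then obtain p q where p: "\<And>t. P (line_point s' J' (b (\<pi> a)) v t) = poly p t"
      "P (b (\<pi> a)) = poly p 0" "D (\<lambda>y. P (b y)) = poly (pderiv p) 0"
    and q: "\<And>t. Q (line_point s' J' (b (\<pi> a)) v t) = poly q t"
      "Q (b (\<pi> a)) = poly q 0" "D (\<lambda>y. Q (b y)) = poly (pderiv q) 0"
    and R: "(\<lambda>y. P (b y)) \<in> R (\<pi> a)" "(\<lambda>y. Q (b y)) \<in> R (\<pi> a)" by metis
  show ?case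
  proof (intro conjI exI[of _ "p + q"] allI)
    show "(\<lambda>y. P (b y) + Q (b y)) \<in> R (\<pi> a)" by (rule regular_add[OF a R])
    show "D (\<lambda>y. P (b y) + Q (b y)) = poly (pderiv (p + q)) 0"
      unfolding deriv_add[OF R] p q by (simp add: pderiv_add)
  qed (simp_all add: p q)
next
  case (mult P Q)
  then obtain p q where p: "\<And>t. P (line_point s' J' (b (\<pi> a)) v t) = poly p t"
      "P (b (\<pi> a)) = poly p 0" "D (\<lambda>y. P (b y)) = poly (pderiv p) 0"
    and q: "\<And>t. Q (line_point s' J' (b (\<pi> a)) v t) = poly q t"
      "Q (b (\<pi> a)) = poly q 0" "D (\<lambda>y. Q (b y)) = poly (pderiv q) 0"
    and R: "(\<lambda>y. P (b y)) \<in> R (\<pi> a)" "(\<lambda>y. Q (b y)) \<in> R (\<pi> a)" by metis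
  show ?case
  proof (intro conjI exI[of _ "p * q"] allI)
    show "(\<lambda>y. P (b y) * Q (b y)) \<in> R (\<pi> a)" by (rule regular_mult[OF a R])
    show "D (\<lambda>y. P (b y) * Q (b y)) = poly (pderiv (p * q)) 0"
      unfolding deriv_mult[OF R] p q by (simp add: pderiv_mult)
  qed (simp_all add: p q)
qed

text \<open>
  Every regular function is near the point a quotient of polynomials in the coordinates of a local
  section \<open>b\<close> of \<open>\<pi>\<close>, so a derivation that kills these coordinates is zero.
\<close>

lemma deriv_eq_0:
  assumes b: "\<And>j \<phi>. j \<in> J \<Longrightarrow> Vector_Spaces.linear s (*) \<phi> \<Longrightarrow>
      (\<lambda>y. \<phi> (b y j)) \<in> R (\<pi> a) \<and> D (\<lambda>y. \<phi> (b y j)) = 0"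
    and ba: "b (\<pi> a) = a" and sec: "near a (\<lambda>y. b y \<in> S \<and> \<pi> (b y) = y)"
    and f: "f \<in> R (\<pi> a)"
  shows "D f = 0"
proof -
  have kill: "(\<lambda>y. P (b y)) \<in> R (\<pi> a) \<and> D (\<lambda>y. P (b y)) = 0" if P: "P \<in> polyfuns s J" for P
  proof -
    interpret vector_space s by (rule vs)
    have b': "(\<lambda>y. \<phi> (b y j)) \<in> R (\<pi> a) \<and> D (\<lambda>y. \<phi> (b y j)) = \<phi> 0"
      if "j \<in> J" "Vector_Spaces.linear s (*) \<phi>" for j \<phi>
      using b[OF that] linear_rules(4)[OF that(2)] by simp
    obtain p where R: "(\<lambda>y. P (b y)) \<in> R (\<pi> a)"
      and p: "\<forall>t. P (line_point s J (b (\<pi> a)) (\<lambda>_. 0) t) = poly p t"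
        "D (\<lambda>y. P (b y)) = poly (pderiv p) 0"
      using deriv_polyfun[OF P, where b = b and v = "\<lambda>_. 0", OF b'] by metis
    have "poly p t = poly [:P a:] t" for t
      using p(1) ba polyfuns_cong[OF P, of "line_point s J a (\<lambda>_. 0) t" a]
      by (simp add: line_point_def)
    then have "p = [:P a:]" by (intro poly_eq_infinite[OF inf, of 1]) auto
    then show ?thesis using p(2) R by (simp add: pderiv_pCons)
  qed
  obtain P Q where PQ: "P \<in> polyfuns s J" "Q \<in> polyfuns s J" "Q a \<noteq> 0"
    "\<And>b. b \<in> S \<Longrightarrow> Q b \<noteq> 0 \<Longrightarrow> f (\<pi> b) = P b / Q b"
    using regular_funsE[OF f a] by blast
  note kP = kill[OF PQ(1)] and kQ = kill[OF PQ(2)]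
  have "near a (\<lambda>y. Q (b y) \<noteq> 0)" by (rule near_nonzero) (use kQ a ba PQ in auto)
  with sec have "near a (\<lambda>y. (b y \<in> S \<and> \<pi> (b y) = y) \<and> Q (b y) \<noteq> 0)" by (rule near_conj)
  then have nr: "near a (\<lambda>y. f y * Q (b y) = P (b y))"
  proof (rule near_mono)
    fix y assume y: "(b y \<in> S \<and> \<pi> (b y) = y) \<and> Q (b y) \<noteq> 0"
    then show "f y * Q (b y) = P (b y)" using PQ(4)[of "b y"] by simp
  qed
  have "D (\<lambda>y. f y * Q (b y)) = 0"
    using deriv_near[OF regular_mult[OF a f] _ nr] kP kQ by simp
  then show ?thesis using deriv_mult[OF f, of "\<lambda>y. Q (b y)"] kQ ba PQ(3) by simp
qed

end

lemma tangent_diff: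
  assumes a: "a \<in> S" and D: "D \<in> tangent_space (R (\<pi> a)) (\<pi> a)" "D' \<in> tangent_space (R (\<pi> a)) (\<pi> a)"
  shows "(\<lambda>f\<in>R (\<pi> a). D f - D' f) \<in> tangent_space (R (\<pi> a)) (\<pi> a)"
  unfolding tangent_space_def
proof (intro CollectI conjI ballI allI)
  fix f g assume f: "f \<in> R (\<pi> a)" and g: "g \<in> R (\<pi> a)"
  show "(\<lambda>f\<in>R (\<pi> a). D f - D' f) (\<lambda>y. f y + g y) =
      (\<lambda>f\<in>R (\<pi> a). D f - D' f) f + (\<lambda>f\<in>R (\<pi> a). D f - D' f) g"
    using f g regular_add[OF a f g] deriv_add[OF D(1) a f g] deriv_add[OF D(2) a f g] by simp
  show "(\<lambda>f\<in>R (\<pi> a). D f - D' f) (\<lambda>y. f y * g y) =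
      f (\<pi> a) * (\<lambda>f\<in>R (\<pi> a). D f - D' f) g + g (\<pi> a) * (\<lambda>f\<in>R (\<pi> a). D f - D' f) f"
    using f g regular_mult[OF a f g] deriv_mult[OF D(1) a f g] deriv_mult[OF D(2) a f g]
    by (simp add: algebra_simps)
next
  fix c f assume f: "f \<in> R (\<pi> a)"
  show "(\<lambda>f\<in>R (\<pi> a). D f - D' f) (\<lambda>y. c * f y) = c * (\<lambda>f\<in>R (\<pi> a). D f - D' f) f"
    using f regular_cmult[OF a f] deriv_cmult[OF D(1) a f] deriv_cmult[OF D(2) a f]
    by (simp add: algebra_simps)
qed simp

definition curve_deriv :: "('j \<Rightarrow> 'u) \<Rightarrow> ('j \<Rightarrow> 'u) \<Rightarrow> ('x \<Rightarrow> 'k) \<Rightarrow> 'k"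
  where "curve_deriv a v = (\<lambda>f\<in>R (\<pi> a). germ_deriv (\<lambda>t. f (\<pi> (line_point s J a v t))))"

lemma regular_germ:
  assumes "a \<in> S" "f \<in> R (\<pi> a)"
  obtains p q where "rational_germ (\<lambda>t. f (\<pi> (line_point s J a v t))) p q"
    "f (\<pi> a) = poly p 0 / poly q 0"
proof -
  obtain P Q where PQ: "P \<in> polyfuns s J" "Q \<in> polyfuns s J" "Q a \<noteq> 0"
    "\<And>b. b \<in> S \<Longrightarrow> Q b \<noteq> 0 \<Longrightarrow> f (\<pi> b) = P b / Q b"
    using regular_funsE[OF assms(2,1)] by blast
  obtain \<psi> where \<psi>: "\<psi> \<in> polyfuns s J" "\<psi> a \<noteq> 0" "\<And>b. b \<in> J \<rightarrow>\<^sub>E UNIV \<Longrightarrow> \<psi> b \<noteq> 0 \<Longrightarrow> b \<in> S"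
    using S_open[OF assms(1)] by blast
  obtain p where p: "\<And>t. P (line_point s J a v t) = poly p t" using polyfuns_line[OF PQ(1)] by blast
  obtain q where q: "\<And>t. Q (line_point s J a v t) = poly q t" using polyfuns_line[OF PQ(2)] by blast
  obtain u where u: "\<And>t. \<psi> (line_point s J a v t) = poly u t" using polyfuns_line[OF \<psi>(1)] by blast
  have 0: "line_point s J a v 0 = a" by (rule line_point_0[OF vs subsetD[OF S_sub assms(1)]])
  have "rational_germ (\<lambda>t. f (\<pi> (line_point s J a v t))) (p * u) (q * u)"
    unfolding rational_germ_def
  proof (intro conjI allI impI)
    show "poly (q * u) 0 \<noteq> 0" using q[of 0] u[of 0] 0 PQ(3) \<psi>(2) by simp
    fix t assume t: "poly (q * u) t \<noteq> 0"
    then have "line_point s J a v t \<in> S" using \<psi>(3) u[of t] by auto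
    then show "f (\<pi> (line_point s J a v t)) = poly (p * u) t / poly (q * u) t"
      using t PQ(4)[of "line_point s J a v t"] p[of t] q[of t] by simp
  qed
  moreover have "f (\<pi> a) = poly (p * u) 0 / poly (q * u) 0"
    using PQ(3) PQ(4)[of a] assms(1) p[of 0] q[of 0] u[of 0] 0 \<psi>(2) by simp
  ultimately show ?thesis by (rule that)
qed

lemma curve_deriv_apply:
  "f \<in> R (\<pi> a) \<Longrightarrow> curve_deriv a v f = germ_deriv (\<lambda>t. f (\<pi> (line_point s J a v t)))"
  by (simp add: curve_deriv_def)

lemma curve_deriv_tangent:
  assumes a: "a \<in> S"
  shows "curve_deriv a v \<in> tangent_space (R (\<pi> a)) (\<pi> a)"
  unfolding tangent_space_def
proof (intro CollectI conjI ballI allI)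
  show "curve_deriv a v \<in> extensional (R (\<pi> a))" by (simp add: curve_deriv_def)
next
  fix f g assume f: "f \<in> R (\<pi> a)" and g: "g \<in> R (\<pi> a)"
  obtain p q where pq: "rational_germ (\<lambda>t. f (\<pi> (line_point s J a v t))) p q"
    "f (\<pi> a) = poly p 0 / poly q 0" using regular_germ[OF a f] by blast
  obtain p' q' where pq': "rational_germ (\<lambda>t. g (\<pi> (line_point s J a v t))) p' q'"
    "g (\<pi> a) = poly p' 0 / poly q' 0" using regular_germ[OF a g] by blast
  have q0: "poly q 0 \<noteq> 0" "poly q' 0 \<noteq> 0" using pq(1) pq'(1) by (auto simp: rational_germ_def)
  note rules = germ_deriv_eq[OF inf rational_germ_combine(1)[OF pq(1) pq'(1)]]
    germ_deriv_eq[OF inf rational_germ_combine(2)[OF pq(1) pq'(1)]]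
    germ_deriv_eq[OF inf pq(1)] germ_deriv_eq[OF inf pq'(1)]
  show "curve_deriv a v (\<lambda>y. f y + g y) = curve_deriv a v f + curve_deriv a v g"
    unfolding curve_deriv_apply[OF f] curve_deriv_apply[OF g] curve_deriv_apply[OF regular_add[OF a f g]]
      rules quotient_deriv_combine(1)[OF q0] ..
  show "curve_deriv a v (\<lambda>y. f y * g y) = f (\<pi> a) * curve_deriv a v g + g (\<pi> a) * curve_deriv a v f"
    unfolding curve_deriv_apply[OF f] curve_deriv_apply[OF g] curve_deriv_apply[OF regular_mult[OF a f g]]
      rules quotient_deriv_combine(2)[OF q0] pq(2) pq'(2) ..
next
  fix c f assume f: "f \<in> R (\<pi> a)"
  obtain p q where pq: "rational_germ (\<lambda>t. f (\<pi> (line_point s J a v t))) p q"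
    "f (\<pi> a) = poly p 0 / poly q 0" using regular_germ[OF a f] by blast
  have q0: "poly q 0 \<noteq> 0" using pq(1) by (auto simp: rational_germ_def)
  show "curve_deriv a v (\<lambda>y. c * f y) = c * curve_deriv a v f"
    unfolding curve_deriv_apply[OF f] curve_deriv_apply[OF regular_cmult[OF a f]]
      germ_deriv_eq[OF inf pq(1)] germ_deriv_eq[OF inf rational_germ_combine(3)[OF pq(1) pq(1)]]
      quotient_deriv_combine(3)[OF q0 q0] ..
qed

end

section \<open>Frames and charts of Grassmannians\<close>

text \<open>
  The action of a matrix \<open>g\<close> on a family of vectors.
\<close>

definition comb ::
  "('k::field \<Rightarrow> 'u::ab_group_add \<Rightarrow> 'u) \<Rightarrow> nat \<Rightarrow> (nat \<Rightarrow> nat \<Rightarrow> 'k) \<Rightarrow> (nat \<Rightarrow> 'u) \<Rightarrow> nat \<Rightarrow> 'u"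
  where "comb s k g b j = (\<Sum>l<k. s (g j l) (b l))"

text \<open>
  The vector of a \<open>k\<close>-dimensional subspace \<open>F\<close> at which the functionals \<open>\<phi>\<close> take the values of the
  \<open>l\<close>-th standard basis vector. These vectors form the frame that represents \<open>F\<close> in the affine
  chart of the Grassmannian belonging to \<open>\<phi>\<close>.
\<close>

definition chart_frame :: "(nat \<Rightarrow> 'u \<Rightarrow> 'k::field) \<Rightarrow> nat \<Rightarrow> 'u set \<Rightarrow> nat \<Rightarrow> 'u"
  where "chart_frame \<phi> k F l = (THE e. e \<in> F \<and> (\<forall>m<k. \<phi> m e = (if m = l then 1 else 0)))"

lemma frame_span_cong: "(\<And>j. j < k \<Longrightarrow> a j = b j) \<Longrightarrow> frame_span s k a = frame_span s k b"
  unfolding frame_span_def by (metis (no_types, lifting) image_cong lessThan_iff)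

context vector_space
begin

lemma frame_span_eq: "frame_span scale k a = {(\<Sum>l<k. scale (c l) (a l)) | c. True}"
  by (simp add: frame_span_def span_family)

lemma frame_span_base: "l < k \<Longrightarrow> a l \<in> frame_span scale k a"
  unfolding frame_span_def by (simp add: span_base)

lemma subspace_frame_span: "subspace (frame_span scale k a)"
  by (simp add: frame_span_def)

lemma frame_span_subset: "subspace F \<Longrightarrow> (\<And>l. l < k \<Longrightarrow> a l \<in> F) \<Longrightarrow> frame_span scale k a \<subseteq> F"
  unfolding frame_span_def by (intro span_minimal) auto

lemma comb_in: "comb scale k g b j \<in> frame_span scale k b"
  unfolding comb_def
  by (intro subspace_sum subspace_scale subspace_frame_span) (auto intro: frame_span_base)

lemma frame_span_in_Gr: "frame_span scale k a \<in> Gr scale k \<longleftrightarrow> indep_family scale k a"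
  by (simp add: Gr_def indep_family_iff_dim frame_span_def)

lemma indep_family_cong:
  "(\<And>j. j < k \<Longrightarrow> a j = b j) \<Longrightarrow> indep_family scale k a \<longleftrightarrow> indep_family scale k b"
  unfolding indep_family_def by (simp cong: sum.cong_simp)

lemma frames_iff: "a \<in> frames scale k \<longleftrightarrow> a \<in> {..<k} \<rightarrow>\<^sub>E UNIV \<and> indep_family scale k a"
  by (simp add: frames_def frame_span_in_Gr)

lemma pow_frames_iff:
  "a \<in> pow_frames scale k r \<longleftrightarrow> a \<in> ({..<r} \<times> {..<k}) \<rightarrow>\<^sub>E UNIV \<and>
    (\<forall>i<r. indep_family scale k (\<lambda>j. a (i, j)))"
  unfolding pow_frames_def pow_span_def
  by (auto simp: frame_span_in_Gr[symmetric] PiE_iff)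

lemma comb_comb:
  "comb scale k h (comb scale k g b) m = comb scale k (\<lambda>m l. \<Sum>j<k. h m j * g j l) b m"
proof -
  have "comb scale k h (comb scale k g b) m = (\<Sum>j<k. \<Sum>l<k. scale (h m j * g j l) (b l))"
    by (simp add: comb_def scale_sum_right)
  also have "\<dots> = (\<Sum>l<k. \<Sum>j<k. scale (h m j * g j l) (b l))" by (rule sum.swap)
  finally show ?thesis by (simp add: comb_def scale_sum_left)
qed

text \<open>
  Two frames of one space are related by matrices \<open>g\<close> and \<open>h\<close>. Independence of \<open>a\<close> turns
  \<open>a = h (g a)\<close> into \<open>h g = 1\<close>. Hence \<open>g\<close> preserves the span of every family, not only of \<open>a\<close>.
\<close>

lemma change_of_frame:
  assumes a: "indep_family scale k a" and eq: "frame_span scale k a = frame_span scale k a'"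
  obtains g where "\<And>j. j < k \<Longrightarrow> a' j = comb scale k g a j"
    "\<And>b. frame_span scale k (comb scale k g b) = frame_span scale k b"
proof -
  have "\<exists>c. j < k \<longrightarrow> a' j = (\<Sum>l<k. scale (c l) (a l))" for j
    using frame_span_base[of j k a'] unfolding eq[symmetric] by (auto simp: frame_span_eq)
  then obtain g where g: "\<And>j. j < k \<Longrightarrow> a' j = comb scale k g a j"
    unfolding comb_def by metis
  have "\<exists>c. j < k \<longrightarrow> a j = (\<Sum>l<k. scale (c l) (a' l))" for j
    using frame_span_base[of j k a] unfolding eq by (auto simp: frame_span_eq)
  then obtain h where h: "\<And>j. j < k \<Longrightarrow> a j = comb scale k h a' j"
    unfolding comb_def by metis
  have hg: "(\<Sum>j<k. h m j * g j l) = (if l = m then 1 else 0)" if "m < k" "l < k" for m l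
  proof -
    have "a m = comb scale k h (comb scale k g a) m"
      using h[OF that(1)] g by (simp add: comb_def)
    also have "\<dots> = (\<Sum>l<k. scale (\<Sum>j<k. h m j * g j l) (a l))"
      by (simp only: comb_comb) (simp add: comb_def)
    finally have "(\<Sum>l<k. scale ((\<Sum>j<k. h m j * g j l) - (if l = m then 1 else 0)) (a l)) = 0"
      using that by (simp add: scale_left_diff_distrib sum_subtractf sum_delta_scale)
    then have "\<forall>l<k. (\<Sum>j<k. h m j * g j l) - (if l = m then 1 else 0) = 0"
      using spec[OF a[unfolded indep_family_def],
          of "\<lambda>l. (\<Sum>j<k. h m j * g j l) - (if l = m then 1 else 0)"] by simp
    then show ?thesis using that by simp
  qed
  have "frame_span scale k (comb scale k g b) = frame_span scale k b" for b
  proof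
    show "frame_span scale k (comb scale k g b) \<subseteq> frame_span scale k b"
      by (intro frame_span_subset subspace_frame_span comb_in)
    show "frame_span scale k b \<subseteq> frame_span scale k (comb scale k g b)"
    proof (intro frame_span_subset subspace_frame_span)
      fix m assume m: "m < k"
      have "comb scale k h (comb scale k g b) m = (\<Sum>l<k. scale (\<Sum>j<k. h m j * g j l) (b l))"
        by (simp only: comb_comb) (simp add: comb_def)
      also have "\<dots> = b m" using m by (simp add: hg sum_delta_scale)
      finally show "b m \<in> frame_span scale k (comb scale k g b)" by (metis comb_in)
    qed
  qed
  then show ?thesis using that g by blast
qed

lemma fdet_kernel_family:
  assumes \<phi>: "\<And>m. Vector_Spaces.linear scale (*) (\<phi> m)"
    and det: "fdet k (\<lambda>m j. \<phi> m (b j)) \<noteq> 0"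
    and e: "e = (\<Sum>j<k. scale (c j) (b j))" "\<And>m. m < k \<Longrightarrow> \<phi> m e = 0"
  shows "\<And>j. j < k \<Longrightarrow> c j = 0" "e = 0"
proof -
  have c: "c j = 0" if "j < k" for j
  proof (rule fdet_nonzero_kernel[OF det _ that])
    fix m assume "m < k"
    then have "\<phi> m e = 0" by (rule e(2))
    then show "(\<Sum>j<k. \<phi> m (b j) * c j) = 0"
      by (simp add: e(1) linear_rules[OF \<phi>] mult.commute)
  qed
  then show "\<And>j. j < k \<Longrightarrow> c j = 0" .
  show "e = 0" using c by (simp add: e(1))
qed

text \<open>
  A nonvanishing determinant against functionals certifies independence. Since the determinant is \<open>1\<close>
  for the functionals dual to an independent family, independence is an open condition.
\<close>

lemma indep_family_fdet:
  assumes \<phi>: "\<And>m. Vector_Spaces.linear scale (*) (\<phi> m)"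
    and det: "fdet k (\<lambda>m j. \<phi> m (b j)) \<noteq> 0"
  shows "indep_family scale k b"
  unfolding indep_family_def
  using fdet_kernel_family(1)[OF \<phi> det, of 0] by (metis linear_rules(4)[OF \<phi>])

lemma polyfuns_functional_fdet:
  assumes "\<And>m. Vector_Spaces.linear scale (*) (\<phi> m)" "\<And>j. j < k \<Longrightarrow> x j \<in> J"
  shows "(\<lambda>b. fdet k (\<lambda>m j. \<phi> m (b (x j)))) \<in> polyfuns scale J"
    "j < k \<Longrightarrow> l < k \<Longrightarrow> (\<lambda>b. fadj k (\<lambda>m j. \<phi> m (b (x j))) j l) \<in> polyfuns scale J"
  using assms by (auto intro!: polyfuns_fdet polyfuns_fadj polyfuns.coord)

lemma polyfuns_comb:
  assumes "Vector_Spaces.linear scale (*) \<phi>" "\<And>l. l < k \<Longrightarrow> x l \<in> J"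
  shows "(\<lambda>b. \<phi> (comb scale k g (\<lambda>l. b (x l)) j)) \<in> polyfuns scale J"
proof -
  have "(\<lambda>b. \<phi> (comb scale k g (\<lambda>l. b (x l)) j)) = (\<lambda>b. \<Sum>l<k. g j l * \<phi> (b (x l)))"
    by (simp add: comb_def linear_rules[OF assms(1)])
  moreover have "(\<lambda>b. \<Sum>l<k. g j l * \<phi> (b (x l))) \<in> polyfuns scale J"
    using assms by (intro polyfuns_sum polyfuns.mult polyfuns.const polyfuns.coord) auto
  ultimately show ?thesis by simp
qed

lemma homogeneous_presentation_Gr:
  assumes inf: "infinite (UNIV :: 'a set)"
  shows "homogeneous_presentation scale {..<k} (frames scale k) (frame_span scale k)"
proof
  show "infinite (UNIV :: 'a set)" by fact
  show "frames scale k \<subseteq> {..<k} \<rightarrow>\<^sub>E UNIV" by (auto simp: frames_iff)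
next
  fix a a' assume a: "a \<in> frames scale k" "a' \<in> frames scale k"
    "frame_span scale k a = frame_span scale k a'"
  then obtain g where g: "\<And>j. j < k \<Longrightarrow> a' j = comb scale k g a j"
    "\<And>b. frame_span scale k (comb scale k g b) = frame_span scale k b"
    using change_of_frame[of k a a'] by (auto simp: frames_iff)
  define F where "F b = (\<lambda>j\<in>{..<k}. comb scale k g b j)" for b
  have span: "frame_span scale k (F b) = frame_span scale k b" for b
    using g(2)[of b] frame_span_cong[of k "F b" "comb scale k g b" scale] by (simp add: F_def)
  show "\<exists>F. (\<forall>j\<in>{..<k}. \<forall>\<phi>. Vector_Spaces.linear scale (*) \<phi> \<longrightarrow>
        (\<lambda>b. \<phi> (F b j)) \<in> polyfuns scale {..<k}) \<and>
      (\<forall>b\<in>frames scale k. F b \<in> frames scale k \<and> frame_span scale k (F b) = frame_span scale k b) \<and>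
      F a = a'"
  proof (intro exI[of _ F] conjI ballI allI impI)
    fix j \<phi> assume "j \<in> {..<k}" "Vector_Spaces.linear scale (*) \<phi>"
    then show "(\<lambda>b. \<phi> (F b j)) \<in> polyfuns scale {..<k}"
      using polyfuns_comb[of \<phi> k "\<lambda>l. l"] by (simp add: F_def)
  next
    fix b assume "b \<in> frames scale k"
    then show "F b \<in> frames scale k" using span[of b] by (simp add: frames_def) (simp add: F_def)
    show "frame_span scale k (F b) = frame_span scale k b" by (rule span)
  next
    show "F a = a'" using a(2) g(1)
      by (auto simp: F_def frames_def fun_eq_iff PiE_def extensional_def)
  qed
next
  fix a assume "a \<in> frames scale k"
  then obtain \<phi> where \<phi>: "\<And>m. Vector_Spaces.linear scale (*) (\<phi> m)"
    "\<And>m l. m < k \<Longrightarrow> l < k \<Longrightarrow> \<phi> m (a l) = (if m = l then 1 else 0)"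
    using dual_functionals[of k a] by (auto simp: frames_iff)
  show "\<exists>\<psi>\<in>polyfuns scale {..<k}. \<psi> a \<noteq> 0 \<and>
    (\<forall>b\<in>{..<k} \<rightarrow>\<^sub>E UNIV. \<psi> b \<noteq> 0 \<longrightarrow> b \<in> frames scale k)"
  proof (intro bexI[of _ "\<lambda>b. fdet k (\<lambda>m j. \<phi> m (b j))"] conjI ballI impI)
    show "fdet k (\<lambda>m j. \<phi> m (a j)) \<noteq> 0" using fdet_delta[of k "\<lambda>m j. \<phi> m (a j)"] \<phi>(2) by simp
    show "(\<lambda>b. fdet k (\<lambda>m j. \<phi> m (b j))) \<in> polyfuns scale {..<k}"
      using polyfuns_functional_fdet(1)[of \<phi> k "\<lambda>j. j"] \<phi>(1) by simp
    fix b assume "b \<in> {..<k} \<rightarrow>\<^sub>E (UNIV :: 'b set)" "fdet k (\<lambda>m j. \<phi> m (b j)) \<noteq> 0"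
    then show "b \<in> frames scale k" using indep_family_fdet[OF \<phi>(1)] by (simp add: frames_iff)
  qed
qed

lemma homogeneous_presentation_Gr_pow:
  assumes inf: "infinite (UNIV :: 'a set)"
  shows "homogeneous_presentation scale ({..<r} \<times> {..<k}) (pow_frames scale k r) (pow_span scale k r)"
proof
  let ?J = "{..<r} \<times> {..<k}"
  show "infinite (UNIV :: 'a set)" by fact
  show "pow_frames scale k r \<subseteq> ?J \<rightarrow>\<^sub>E UNIV" by (rule subsetI) (simp only: pow_frames_iff)
next
  let ?J = "{..<r} \<times> {..<k}"
  fix a a' assume a: "a \<in> pow_frames scale k r" "a' \<in> pow_frames scale k r"
    "pow_span scale k r a = pow_span scale k r a'"
  have ex: "\<exists>g. (\<forall>j<k. a' (i, j) = comb scale k g (\<lambda>j. a (i, j)) j) \<and>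
      (\<forall>b. frame_span scale k (comb scale k g b) = frame_span scale k b)" if i: "i < r" for i
  proof -
    have "indep_family scale k (\<lambda>j. a (i, j))" using a(1) i by (simp add: pow_frames_iff)
    moreover have "frame_span scale k (\<lambda>j. a (i, j)) = frame_span scale k (\<lambda>j. a' (i, j))"
      using fun_cong[OF a(3), of i] i by (simp add: pow_span_def)
    ultimately obtain g where "\<And>j. j < k \<Longrightarrow> a' (i, j) = comb scale k g (\<lambda>j. a (i, j)) j"
      "\<And>b. frame_span scale k (comb scale k g b) = frame_span scale k b"
      by (rule change_of_frame) (rule that, assumption+)
    then show ?thesis by (intro exI[of _ g]) simp
  qed
  obtain g where g: "\<And>i j. i < r \<Longrightarrow> j < k \<Longrightarrow> a' (i, j) = comb scale k (g i) (\<lambda>j. a (i, j)) j"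
    "\<And>i b. i < r \<Longrightarrow> frame_span scale k (comb scale k (g i) b) = frame_span scale k b"
    using ex by metis
  define F where "F b = (\<lambda>(i, j)\<in>?J. comb scale k (g i) (\<lambda>j. b (i, j)) j)" for b
  have span: "pow_span scale k r (F b) = pow_span scale k r b" for b
  proof
    fix i
    show "pow_span scale k r (F b) i = pow_span scale k r b i"
    proof (cases "i < r")
      case True
      then have "frame_span scale k (\<lambda>j. F b (i, j)) = frame_span scale k (comb scale k (g i) (\<lambda>j. b (i, j)))"
        by (intro frame_span_cong) (simp add: F_def)
      with True show ?thesis using g(2) by (simp add: pow_span_def)
    qed (simp add: pow_span_def)
  qed
  show "\<exists>F. (\<forall>j\<in>?J. \<forall>\<phi>. Vector_Spaces.linear scale (*) \<phi> \<longrightarrow> (\<lambda>b. \<phi> (F b j)) \<in> polyfuns scale ?J) \<and>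
      (\<forall>b\<in>pow_frames scale k r. F b \<in> pow_frames scale k r \<and>
        pow_span scale k r (F b) = pow_span scale k r b) \<and> F a = a'"
  proof (intro exI[of _ F] conjI ballI allI impI)
    fix x \<phi> assume "x \<in> ?J" "Vector_Spaces.linear scale (*) \<phi>"
    moreover obtain i j where "x = (i, j)" by fastforce
    ultimately show "(\<lambda>b. \<phi> (F b x)) \<in> polyfuns scale ?J"
      using polyfuns_comb[of \<phi> k "\<lambda>l. (i, l)" ?J "g i" j] by (simp add: F_def)
  next
    fix b assume "b \<in> pow_frames scale k r"
    then show "F b \<in> pow_frames scale k r" using span[of b]
      by (simp add: pow_frames_def) (simp add: F_def)
    show "pow_span scale k r (F b) = pow_span scale k r b" by (rule span)
  next
    show "F a = a'"
    proof
      fix x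
      show "F a x = a' x" using a(2) g(1)
        using PiE_arb[of a' ?J _ x] by (cases x) (auto simp: F_def pow_frames_iff)
    qed
  qed
next
  let ?J = "{..<r} \<times> {..<k}"
  fix a assume a: "a \<in> pow_frames scale k r"
  have ex: "\<exists>\<phi>. (\<forall>m. Vector_Spaces.linear scale (*) (\<phi> m)) \<and>
      (\<forall>m<k. \<forall>l<k. \<phi> m (a (i, l)) = (if m = l then 1 else 0))" if i: "i < r" for i
  proof -
    have "indep_family scale k (\<lambda>j. a (i, j))" using a i by (simp add: pow_frames_iff)
    then obtain \<phi> where "\<And>m. Vector_Spaces.linear scale (*) (\<phi> m)"
      "\<And>m l. m < k \<Longrightarrow> l < k \<Longrightarrow> \<phi> m (a (i, l)) = (if m = l then 1 else 0)"
      by (rule dual_functionals) (rule that, assumption+)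
    then show ?thesis by (intro exI[of _ \<phi>]) simp
  qed
  obtain \<phi> where \<phi>: "\<And>i m. i < r \<Longrightarrow> Vector_Spaces.linear scale (*) (\<phi> i m)"
    "\<And>i m l. i < r \<Longrightarrow> m < k \<Longrightarrow> l < k \<Longrightarrow> \<phi> i m (a (i, l)) = (if m = l then 1 else 0)"
    using ex by metis
  show "\<exists>\<psi>\<in>polyfuns scale ?J. \<psi> a \<noteq> 0 \<and>
    (\<forall>b\<in>?J \<rightarrow>\<^sub>E UNIV. \<psi> b \<noteq> 0 \<longrightarrow> b \<in> pow_frames scale k r)"
  proof (intro bexI[of _ "\<lambda>b. \<Prod>i<r. fdet k (\<lambda>m j. \<phi> i m (b (i, j)))"] conjI ballI impI)
    show "(\<Prod>i<r. fdet k (\<lambda>m j. \<phi> i m (a (i, j)))) \<noteq> 0"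
      using fdet_delta[of k "\<lambda>m j. \<phi> _ m (a (_, j))"] \<phi>(2) by simp
    show "(\<lambda>b. \<Prod>i<r. fdet k (\<lambda>m j. \<phi> i m (b (i, j)))) \<in> polyfuns scale ?J"
      using \<phi>(1) by (intro polyfuns_prod polyfuns_functional_fdet(1)) auto
    fix b assume b: "b \<in> ?J \<rightarrow>\<^sub>E (UNIV :: 'b set)" "(\<Prod>i<r. fdet k (\<lambda>m j. \<phi> i m (b (i, j)))) \<noteq> 0"
    have "indep_family scale k (\<lambda>j. b (i, j))" if "i < r" for i
      by (rule indep_family_fdet[of "\<phi> i"]) (use \<phi>(1) b(2) that in auto)
    then show "b \<in> pow_frames scale k r" using b(1) by (simp add: pow_frames_iff)
  qed
qed

subsection \<open>Charts\<close>

lemma chart_frame_eqI: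
  assumes \<phi>: "\<And>m. Vector_Spaces.linear scale (*) (\<phi> m)"
    and det: "fdet k (\<lambda>m j. \<phi> m (b j)) \<noteq> 0"
    and e: "e \<in> frame_span scale k b" "\<And>m. m < k \<Longrightarrow> \<phi> m e = (if m = l then 1 else 0)"
  shows "chart_frame \<phi> k (frame_span scale k b) l = e"
  unfolding chart_frame_def
proof (rule the_equality)
  show "e \<in> frame_span scale k b \<and> (\<forall>m<k. \<phi> m e = (if m = l then 1 else 0))" using e by blast
  fix e' assume e': "e' \<in> frame_span scale k b \<and> (\<forall>m<k. \<phi> m e' = (if m = l then 1 else 0))"
  then have "e' - e \<in> frame_span scale k b" using e(1) by (auto intro: subspace_diff subspace_frame_span)
  then obtain c where c: "e' - e = (\<Sum>j<k. scale (c j) (b j))" by (auto simp: frame_span_eq)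
  have "e' - e = 0"
    by (rule fdet_kernel_family(2)[OF \<phi> det c]) (use e e' in \<open>simp add: linear_rules[OF \<phi>]\<close>)
  then show "e' = e" by simp
qed

context
  fixes \<phi> k b
  assumes \<phi>: "\<And>m. Vector_Spaces.linear scale (*) (\<phi> m)"
    and det: "fdet k (\<lambda>m j. \<phi> m (b j)) \<noteq> 0"
begin

text \<open>Cramer's rule.\<close>

lemma chart_frame_formula:
  assumes "l < k"
  shows "chart_frame \<phi> k (frame_span scale k b) l =
    (\<Sum>j<k. scale (fadj k (\<lambda>m j. \<phi> m (b j)) j l / fdet k (\<lambda>m j. \<phi> m (b j))) (b j))"
proof (rule chart_frame_eqI[OF \<phi> det])
  let ?A = "\<lambda>m j. \<phi> m (b j)"
  show "(\<Sum>j<k. scale (fadj k ?A j l / fdet k ?A) (b j)) \<in> frame_span scale k b"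
    by (auto simp: frame_span_eq)
  fix m assume m: "m < k"
  have "\<phi> m (\<Sum>j<k. scale (fadj k ?A j l / fdet k ?A) (b j)) =
      (\<Sum>j<k. ?A m j * fadj k ?A j l) / fdet k ?A"
    by (simp add: linear_rules[OF \<phi>] sum_divide_distrib mult.commute)
  also have "\<dots> = (if m = l then 1 else 0)" using det fdet_fadj[OF m assms, of ?A] by simp
  finally show "\<phi> m (\<Sum>j<k. scale (fadj k ?A j l / fdet k ?A) (b j)) = (if m = l then 1 else 0)" .
qed

lemma chart_frame_in: "l < k \<Longrightarrow> chart_frame \<phi> k (frame_span scale k b) l \<in> frame_span scale k b"
  by (subst chart_frame_formula) (auto simp: frame_span_eq)

lemma chart_frame_dual:
  assumes "l < k" "m < k"
  shows "\<phi> m (chart_frame \<phi> k (frame_span scale k b) l) = (if m = l then 1 else 0)"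
proof -
  let ?A = "\<lambda>m j. \<phi> m (b j)"
  have "\<phi> m (chart_frame \<phi> k (frame_span scale k b) l) = (\<Sum>j<k. ?A m j * fadj k ?A j l) / fdet k ?A"
    using assms by (simp add: chart_frame_formula linear_rules[OF \<phi>] sum_divide_distrib mult.commute)
  then show ?thesis using det fdet_fadj[OF assms(2,1), of ?A] by simp
qed

text \<open>
  The functionals \<open>\<phi>\<close> are coordinates on the subspace with respect to its chart frame. This relation is
  linear in the chart frame, and later it is differentiated instead of Cramer's formula.
\<close>

lemma chart_frame_expand:
  assumes "w \<in> frame_span scale k b"
  shows "w = (\<Sum>l<k. scale (\<phi> l w) (chart_frame \<phi> k (frame_span scale k b) l))" (is "w = ?w")
proof -
  have "w - ?w \<in> frame_span scale k b"
    using assms by (intro subspace_diff subspace_frame_span subspace_sum subspace_scale)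
      (auto intro: chart_frame_in)
  then obtain c where c: "w - ?w = (\<Sum>j<k. scale (c j) (b j))" by (auto simp: frame_span_eq)
  have "w - ?w = 0"
    by (rule fdet_kernel_family(2)[OF \<phi> det c])
      (simp add: linear_rules[OF \<phi>] chart_frame_dual sum_delta_mult)
  then show ?thesis by simp
qed

lemma frame_span_chart_frame:
  "frame_span scale k (chart_frame \<phi> k (frame_span scale k b)) = frame_span scale k b"
proof
  show "frame_span scale k (chart_frame \<phi> k (frame_span scale k b)) \<subseteq> frame_span scale k b"
    by (intro frame_span_subset subspace_frame_span chart_frame_in)
  show "frame_span scale k b \<subseteq> frame_span scale k (chart_frame \<phi> k (frame_span scale k b))"
  proof
    fix w assume "w \<in> frame_span scale k b"
    then have w: "w = (\<Sum>l<k. scale (\<phi> l w) (chart_frame \<phi> k (frame_span scale k b) l))"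
      by (rule chart_frame_expand)
    show "w \<in> frame_span scale k (chart_frame \<phi> k (frame_span scale k b))"
      by (subst w) (auto simp: frame_span_eq)
  qed
qed

end

lemma chart_regular:
  assumes a: "a \<in> frames scale k" and \<phi>: "\<And>m. Vector_Spaces.linear scale (*) (\<phi> m)"
    and dual: "\<And>m l. m < k \<Longrightarrow> l < k \<Longrightarrow> \<phi> m (a l) = (if m = l then 1 else 0)"
    and \<mu>: "Vector_Spaces.linear scale (*) \<mu>" and l: "l < k"
  shows "(\<lambda>F. \<mu> (chart_frame \<phi> k F l)) \<in> Gr_regular scale k (frame_span scale k a)"
  unfolding Gr_regular_def regular_funs_def
proof (intro CollectI bexI[OF _ a] conjI refl bexI)
  let ?A = "\<lambda>b m j. \<phi> m (b j)"
  show "(\<lambda>b. fdet k (?A b)) \<in> polyfuns scale {..<k}"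
    using polyfuns_functional_fdet(1)[of \<phi> k "\<lambda>j. j"] \<phi>(1) by simp
  show "(\<lambda>b. \<Sum>j<k. fadj k (?A b) j l * \<mu> (b j)) \<in> polyfuns scale {..<k}"
    using polyfuns_functional_fdet(2)[of \<phi> k "\<lambda>j. j"] \<phi>(1) l \<mu>
    by (intro polyfuns_sum polyfuns.mult polyfuns.coord) auto
  show "fdet k (?A a) \<noteq> 0" using fdet_delta[of k "?A a"] dual by simp
  show "\<forall>b\<in>frames scale k. fdet k (?A b) \<noteq> 0 \<longrightarrow>
      \<mu> (chart_frame \<phi> k (frame_span scale k b) l) =
      (\<Sum>j<k. fadj k (?A b) j l * \<mu> (b j)) / fdet k (?A b)"
    using l by (auto simp: chart_frame_formula[OF \<phi>] linear_rules[OF \<mu>] sum_divide_distrib)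
qed

text \<open>
  The projections of a power of a Grassmannian to its factors are morphisms.
\<close>

lemma Gr_regular_projection:
  assumes a: "a \<in> pow_frames scale k r" and i: "i < r"
    and inf: "infinite (UNIV :: 'a set)"
    and f: "f \<in> Gr_regular scale k (frame_span scale k (\<lambda>j. a (i, j)))"
  shows "(\<lambda>M. f (M i)) \<in> Gr_pow_regular scale k r (pow_span scale k r a)"
proof -
  interpret G: homogeneous_presentation scale "{..<k}" "frames scale k" "frame_span scale k"
    by (rule homogeneous_presentation_Gr[OF inf])
  define p where "p b = (\<lambda>j\<in>{..<k}. b (i, j))" for b :: "nat \<times> nat \<Rightarrow> 'b"
  have p_span: "frame_span scale k (\<lambda>j. b (i, j)) = frame_span scale k (p b)" for b
    by (rule frame_span_cong) (simp add: p_def)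
  have p_fr: "p b \<in> frames scale k" if "b \<in> pow_frames scale k r" for b
    using that i unfolding pow_frames_iff frames_iff
    by (auto simp: p_def indep_family_cong[of k "\<lambda>j\<in>{..<k}. b (i, j)" "\<lambda>j. b (i, j)"])
  obtain P Q where PQ: "P \<in> polyfuns scale {..<k}" "Q \<in> polyfuns scale {..<k}" "Q (p a) \<noteq> 0"
    "\<And>b. b \<in> frames scale k \<Longrightarrow> Q b \<noteq> 0 \<Longrightarrow> f (frame_span scale k b) = P b / Q b"
    using G.regular_funsE[OF f[unfolded Gr_regular_def p_span] p_fr[OF a]] by blast
  have p_poly: "(\<lambda>b. \<phi> (p b j)) \<in> polyfuns scale ({..<r} \<times> {..<k})"
    if "j \<in> {..<k}" "Vector_Spaces.linear scale (*) \<phi>" for j \<phi>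
    using that i polyfuns.coord[of "(i, j)" "{..<r} \<times> {..<k}" scale \<phi>] by (simp add: p_def)
  show ?thesis
    unfolding Gr_pow_regular_def regular_funs_def
  proof (intro CollectI bexI[OF _ a] conjI refl bexI)
    show "(\<lambda>b. Q (p b)) \<in> polyfuns scale ({..<r} \<times> {..<k})"
      by (rule polyfuns_compose[OF PQ(2) p_poly])
    show "(\<lambda>b. P (p b)) \<in> polyfuns scale ({..<r} \<times> {..<k})"
      by (rule polyfuns_compose[OF PQ(1) p_poly])
    show "Q (p a) \<noteq> 0" by fact
    show "\<forall>b\<in>pow_frames scale k r. Q (p b) \<noteq> 0 \<longrightarrow> f (pow_span scale k r b i) = P (p b) / Q (p b)"
      using PQ(4) p_fr i by (auto simp: pow_span_def p_span)
  qed
qed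

end

subsection \<open>Charts of powers of Grassmannians\<close>

definition pow_chart ::
  "(nat \<Rightarrow> nat \<Rightarrow> 'u \<Rightarrow> 'k::field) \<Rightarrow> nat \<Rightarrow> nat \<Rightarrow> (nat \<Rightarrow> 'u set) \<Rightarrow> nat \<times> nat \<Rightarrow> 'u"
  where "pow_chart \<phi> k r M = (\<lambda>(i, j)\<in>{..<r} \<times> {..<k}. chart_frame (\<phi> i) k (M i) j)"

context vector_space
begin

context
  fixes \<phi> :: "nat \<Rightarrow> nat \<Rightarrow> 'b \<Rightarrow> 'a" and k r :: nat and a :: "nat \<times> nat \<Rightarrow> 'b"
  assumes a: "a \<in> pow_frames scale k r"
    and \<phi>: "\<And>i m. i < r \<Longrightarrow> Vector_Spaces.linear scale (*) (\<phi> i m)"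
    and dual: "\<And>i m l. i < r \<Longrightarrow> m < k \<Longrightarrow> l < k \<Longrightarrow> \<phi> i m (a (i, l)) = (if m = l then 1 else 0)"
begin

lemma pow_chart_base: "pow_chart \<phi> k r (pow_span scale k r a) = a"
proof
  fix x :: "nat \<times> nat"
  obtain i j where x: "x = (i, j)" by fastforce
  show "pow_chart \<phi> k r (pow_span scale k r a) x = a x"
  proof (cases "i < r \<and> j < k")
    case True
    have "chart_frame (\<phi> i) k (frame_span scale k (\<lambda>j. a (i, j))) j = a (i, j)"
    proof (rule chart_frame_eqI)
      show "fdet k (\<lambda>m j. \<phi> i m (a (i, j))) \<noteq> 0"
        using fdet_delta[of k "\<lambda>m j. \<phi> i m (a (i, j))"] dual True by simp
      show "a (i, j) \<in> frame_span scale k (\<lambda>j. a (i, j))"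
        using frame_span_base[of j k "\<lambda>j. a (i, j)"] True by simp
    qed (use \<phi> dual True in auto)
    then show ?thesis using True by (simp add: x pow_chart_def pow_span_def)
  next
    case False
    then show ?thesis
      using a PiE_arb[of a "{..<r} \<times> {..<k}" _ x] by (auto simp: x pow_chart_def pow_frames_iff)
  qed
qed

lemma pow_chart_regular:
  assumes "i < r" "j < k" and \<mu>: "Vector_Spaces.linear scale (*) \<mu>" and inf: "infinite (UNIV :: 'a set)"
  shows "(\<lambda>M. \<mu> (pow_chart \<phi> k r M (i, j))) \<in> Gr_pow_regular scale k r (pow_span scale k r a)"
proof -
  let ?a = "\<lambda>j\<in>{..<k}. a (i, j)"
  have fr: "?a \<in> frames scale k"
    using a assms(1) indep_family_cong[of k ?a "\<lambda>j. a (i, j)"] by (simp add: pow_frames_iff frames_iff)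
  have sp: "frame_span scale k ?a = frame_span scale k (\<lambda>j. a (i, j))"
    by (rule frame_span_cong) simp
  have "(\<lambda>F. \<mu> (chart_frame (\<phi> i) k F j)) \<in> Gr_regular scale k (frame_span scale k ?a)"
    by (rule chart_regular[OF fr _ _ \<mu> assms(2)]) (use \<phi> dual assms(1) in auto)
  then have "(\<lambda>M. \<mu> (chart_frame (\<phi> i) k (M i) j)) \<in> Gr_pow_regular scale k r (pow_span scale k r a)"
    unfolding sp by (rule Gr_regular_projection[OF a assms(1) inf])
  then show ?thesis using assms(1,2) by (simp add: pow_chart_def)
qed

text \<open>
  The chart as a local section makes every regular function a quotient of polynomials in its coordinates.
  The normalisation makes some combinations of the coordinates constant, so that derivations kill them.
\<close>

lemma pow_chart_section:
  "\<exists>Q\<in>polyfuns scale ({..<r} \<times> {..<k}). Q a \<noteq> 0 \<and> (\<forall>b\<in>pow_frames scale k r. Q b \<noteq> 0 \<longrightarrow>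
    pow_chart \<phi> k r (pow_span scale k r b) \<in> pow_frames scale k r \<and>
    pow_span scale k r (pow_chart \<phi> k r (pow_span scale k r b)) = pow_span scale k r b \<and>
    (\<forall>i<r. \<forall>j<k. \<forall>m<k. \<phi> i m (pow_chart \<phi> k r (pow_span scale k r b) (i, j)) = (if m = j then 1 else 0)))"
proof (intro bexI[of _ "\<lambda>b. \<Prod>i<r. fdet k (\<lambda>m j. \<phi> i m (b (i, j)))"] conjI[of "_ \<noteq> _"] ballI impI)
  show "(\<Prod>i<r. fdet k (\<lambda>m j. \<phi> i m (a (i, j)))) \<noteq> 0"
    using fdet_delta[of k "\<lambda>m j. \<phi> _ m (a (_, j))"] dual by simp
  show "(\<lambda>b. \<Prod>i<r. fdet k (\<lambda>m j. \<phi> i m (b (i, j)))) \<in> polyfuns scale ({..<r} \<times> {..<k})"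
    using \<phi> by (intro polyfuns_prod polyfuns_functional_fdet(1)) auto
next
  fix b assume b: "b \<in> pow_frames scale k r" "(\<Prod>i<r. fdet k (\<lambda>m j. \<phi> i m (b (i, j)))) \<noteq> 0"
  let ?M = "pow_span scale k r b"
  let ?c = "pow_chart \<phi> k r ?M"
  have Mi: "?M i = frame_span scale k (\<lambda>j. b (i, j))" if "i < r" for i
    using that by (simp add: pow_span_def)
  have det: "fdet k (\<lambda>m j. \<phi> i m (b (i, j))) \<noteq> 0" if "i < r" for i using b(2) that by simp
  have "frame_span scale k (\<lambda>j. ?c (i, j)) = ?M i" if i: "i < r" for i
  proof -
    have "frame_span scale k (\<lambda>j. ?c (i, j)) = frame_span scale k (chart_frame (\<phi> i) k (?M i))"
      by (rule frame_span_cong) (use i in \<open>simp add: pow_chart_def\<close>)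
    then show ?thesis
      using frame_span_chart_frame[OF \<phi> det, OF i i] unfolding Mi[OF i] by simp
  qed
  then have sp: "pow_span scale k r ?c = ?M"
    by (auto simp: pow_span_def fun_eq_iff)
  moreover have "?M \<in> {..<r} \<rightarrow>\<^sub>E Gr scale k" using b(1) by (simp add: pow_frames_def)
  ultimately have "?c \<in> pow_frames scale k r"
    by (simp add: pow_frames_def) (simp add: pow_chart_def)
  moreover have "\<phi> i m (?c (i, j)) = (if m = j then 1 else 0)" if "i < r" "j < k" "m < k" for i j m
    using chart_frame_dual[OF \<phi> det, OF that(1,1,2,3)] that by (simp add: pow_chart_def Mi)
  ultimately show "?c \<in> pow_frames scale k r \<and> pow_span scale k r ?c = ?M \<and>
    (\<forall>i<r. \<forall>j<k. \<forall>m<k. \<phi> i m (?c (i, j)) = (if m = j then 1 else 0))" using sp by blast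
qed

end

end

section \<open>The exterior square and the decomposability map in frames\<close>

locale exterior_square_space =
  V: vector_space s + W: vector_space s'
  for s :: "'k::field \<Rightarrow> 'v::ab_group_add \<Rightarrow> 'v" and s' :: "'k \<Rightarrow> 'w::ab_group_add \<Rightarrow> 'w" +
  fixes wedge :: "'v \<Rightarrow> 'v \<Rightarrow> 'w" and d :: nat
  assumes ext_square: "exterior_square s s' wedge"
    and dim_V: "V.dim UNIV = d" and d2: "d \<ge> 2"
    and inf: "infinite (UNIV :: 'k set)"
begin

lemma wedge_linear:
  "Vector_Spaces.linear s s' (wedge x)" "Vector_Spaces.linear s s' (\<lambda>x. wedge x y)"
  and wedge_self [simp]: "wedge x x = 0"
  using ext_square by (auto simp: exterior_square_def alternating_bilinear_def)

lemmas wedge_right = linear_rules[OF wedge_linear(1)]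
lemmas wedge_left = linear_rules[OF wedge_linear(2)]

lemma wedge_swap: "wedge y x = - wedge x y"
proof -
  have "wedge x y + wedge y x = wedge (x + y) (x + y)"
    by (simp only: wedge_left wedge_right) simp
  also have "\<dots> = 0" by (rule wedge_self)
  finally have "wedge x y + wedge y x = 0" .
  then show ?thesis by (simp add: add_eq_0_iff)
qed

lemma dual_basis_exists:
  obtains e e' where "dual_basis s d e e'"
proof -
  have "indep_family s 0 (\<lambda>_. 0)" by (simp add: indep_family_def)
  then show ?thesis using V.extend_to_dual_basis[of 0 _ d] dim_V d2 that by (metis less_le_trans pos2)
qed

text \<open>
  A minor of size two of the coordinates of \<open>x\<close> and \<open>y\<close> factors through \<open>x \<and> y\<close>. These
  functionals suffice for every computation in \<open>W\<close> below.
\<close>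

lemma minor_functional:
  assumes "Vector_Spaces.linear s (*) \<gamma>" "Vector_Spaces.linear s (*) \<beta>"
  obtains \<theta> where "Vector_Spaces.linear s' (*) \<theta>"
    "\<And>x y. \<theta> (wedge x y) = \<gamma> x * \<beta> y - \<gamma> y * \<beta> x"
proof -
  have "alternating_bilinear s (*) (\<lambda>x y. \<gamma> x * \<beta> y - \<gamma> y * \<beta> x)"
    unfolding alternating_bilinear_def
  proof (intro conjI allI)
    fix z
    show "Vector_Spaces.linear s (*) (\<lambda>y. \<gamma> z * \<beta> y - \<gamma> y * \<beta> z)"
      using linear_functional_combination[OF assms(2,1), of "\<gamma> z" "- \<beta> z"]
      by (simp add: mult.commute)
    show "Vector_Spaces.linear s (*) (\<lambda>x. \<gamma> x * \<beta> z - \<gamma> z * \<beta> x)"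
      using linear_functional_combination[OF assms, of "\<beta> z" "- \<gamma> z"]
      by (simp add: mult.commute)
    show "\<gamma> z * \<beta> z - \<gamma> z * \<beta> z = 0" by simp
  qed
  then have "\<exists>!f. Vector_Spaces.linear s' (*) f \<and> (\<forall>x y. f (wedge x y) = \<gamma> x * \<beta> y - \<gamma> y * \<beta> x)"
    using ext_square unfolding exterior_square_def by simp
  then obtain f where "Vector_Spaces.linear s' (*) f \<and> (\<forall>x y. f (wedge x y) = \<gamma> x * \<beta> y - \<gamma> y * \<beta> x)"
    by (rule ex1E)
  then show ?thesis by (intro that[of f]) simp_all
qed

lemma wedge_expand:
  assumes "dual_basis s d e e'"
  shows "wedge u v = (\<Sum>m<d. \<Sum>n<d. s' (e' m u * e' n v) (wedge (e m) (e n)))"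
proof -
  have u: "u = (\<Sum>m<d. s (e' m u) (e m))" and v: "v = (\<Sum>n<d. s (e' n v) (e n))"
    using assms unfolding dual_basis_def by blast+
  have "wedge u v = wedge (\<Sum>m<d. s (e' m u) (e m)) (\<Sum>n<d. s (e' n v) (e n))"
    using u v by simp
  also have "\<dots> = (\<Sum>m<d. s' (e' m u) (wedge (e m) (\<Sum>n<d. s (e' n v) (e n))))"
    by (simp only: wedge_left)
  also have "\<dots> = (\<Sum>m<d. \<Sum>n<d. s' (e' m u * e' n v) (wedge (e m) (e n)))"
    by (simp only: wedge_right W.scale_sum_right W.scale_scale)
  finally show ?thesis .
qed

lemma polyfuns_wedge:
  assumes \<mu>: "Vector_Spaces.linear s' (*) \<mu>" and "x \<in> J" "y \<in> J"
  shows "(\<lambda>a. \<mu> (wedge (a x) (a y))) \<in> polyfuns s J"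
proof -
  obtain e e' where e: "dual_basis s d e e'" by (rule dual_basis_exists)
  have "(\<lambda>a. \<mu> (wedge (a x) (a y))) =
      (\<lambda>a. \<Sum>m<d. \<Sum>n<d. (e' m (a x) * e' n (a y)) * \<mu> (wedge (e m) (e n)))"
    by (subst wedge_expand[OF e]) (simp add: linear_rules[OF \<mu>])
  moreover have "\<dots> \<in> polyfuns s J"
    using assms e unfolding dual_basis_def
    by (intro polyfuns_sum polyfuns.mult polyfuns.coord polyfuns.const) auto
  ultimately show ?thesis by simp
qed

definition wedges :: "(nat \<times> nat \<Rightarrow> 'v) \<Rightarrow> nat \<Rightarrow> 'w"
  where "wedges a j = wedge (a (j, 0)) (a (j, 1))"

lemma polyfuns_wedges:
  assumes "Vector_Spaces.linear s' (*) \<mu>" "j < r"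
  shows "(\<lambda>a. \<mu> (wedges a j)) \<in> polyfuns s ({..<r} \<times> {..<2})"
  unfolding wedges_def using assms by (intro polyfuns_wedge) auto

lemma wedge_nonzero:
  assumes "indep_family s 2 x"
  shows "wedge (x 0) (x 1) \<noteq> 0"
proof -
  obtain \<phi> where \<phi>: "\<And>m. Vector_Spaces.linear s (*) (\<phi> m)"
    "\<And>m l. m < 2 \<Longrightarrow> l < 2 \<Longrightarrow> \<phi> m (x l) = (if m = l then 1 else 0)"
    using V.dual_functionals[OF assms] by blast
  obtain \<theta> where \<theta>: "Vector_Spaces.linear s' (*) \<theta>"
    "\<And>x y. \<theta> (wedge x y) = \<phi> 0 x * \<phi> 1 y - \<phi> 0 y * \<phi> 1 x"
    using minor_functional[OF \<phi>(1) \<phi>(1)] by blast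
  have "\<theta> (wedge (x 0) (x 1)) = 1" using \<phi>(2) by (simp add: \<theta>(2))
  then show ?thesis using linear_rules(4)[OF \<theta>(1)] by auto
qed

lemma sum_lessThan_2: "(\<Sum>l<2::nat. f l) = f 0 + (f 1 :: 'b::comm_monoid_add)"
  by (simp add: numeral_2_eq_2)

lemma indep_family_2_if_wedge_nonzero:
  assumes "wedge (x 0) (x 1) \<noteq> 0"
  shows "indep_family s 2 x"
  unfolding indep_family_def
proof (intro allI impI)
  fix c l assume c: "(\<Sum>l<2. s (c l) (x l)) = 0" and l: "l < (2::nat)"
  have "s' (c 0) (wedge (x 0) (x 1)) = wedge (\<Sum>l<2. s (c l) (x l)) (x 1)"
    by (simp add: sum_lessThan_2 wedge_left)
  then have "c 0 = 0" using assms c by (simp add: wedge_left)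
  have "s' (c 1) (wedge (x 0) (x 1)) = wedge (x 0) (\<Sum>l<2. s (c l) (x l))"
    by (simp add: sum_lessThan_2 wedge_right)
  then have "c 1 = 0" using assms c by (simp add: wedge_right)
  show "c l = 0" using l \<open>c 0 = 0\<close> \<open>c 1 = 0\<close> by (auto simp: less_2_cases_iff)
qed

lemma indep_family_nonzero:
  assumes "indep_family s' k b" "l < k"
  shows "b l \<noteq> 0"
proof
  assume "b l = 0"
  then have "(\<Sum>m<k. s' (if m = l then 1 else 0) (b m)) = 0"
    using assms(2) by (simp add: W.sum_delta_scale)
  then have "\<forall>m<k. (if m = l then 1 else 0) = (0::'k)"
    using spec[OF assms(1)[unfolded indep_family_def], of "\<lambda>m. if m = l then 1 else 0"] by simp
  then show False using assms(2) by auto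
qed

lemma pow_frames_if_indep_wedges:
  assumes "a \<in> ({..<r} \<times> {..<2}) \<rightarrow>\<^sub>E UNIV" "indep_family s' r (wedges a)"
  shows "a \<in> pow_frames s 2 r"
  unfolding V.pow_frames_iff
proof (intro conjI allI impI)
  fix i assume "i < r"
  then have "wedges a i \<noteq> 0" by (rule indep_family_nonzero[OF assms(2)])
  then show "indep_family s 2 (\<lambda>j. a (i, j))"
    unfolding wedges_def by (rule indep_family_2_if_wedge_nonzero)
qed (rule assms(1))

text \<open>
  The wedge of two combinations of \<open>x 0\<close> and \<open>x 1\<close> is a multiple of \<open>x 0 \<and> x 1\<close>, also when the two
  vectors are dependent and both sides vanish.
\<close>

lemma ext2_frame_span: "ext2 s' wedge (frame_span s 2 x) = W.span {wedge (x 0) (x 1)}"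
  unfolding ext2_def
proof
  let ?X = "{wedge y z | y z. y \<in> frame_span s 2 x \<and> z \<in> frame_span s 2 x}"
  show "W.span ?X \<subseteq> W.span {wedge (x 0) (x 1)}"
  proof (rule W.span_minimal)
    show "?X \<subseteq> W.span {wedge (x 0) (x 1)}"
    proof
      fix w assume "w \<in> ?X"
      then obtain c c' where w: "w = wedge (\<Sum>l<2. s (c l) (x l)) (\<Sum>l<2. s (c' l) (x l))"
        by (auto simp: V.frame_span_eq)
      have "w = s' (c 0 * c' 1 - c 1 * c' 0) (wedge (x 0) (x 1))"
        unfolding w sum_lessThan_2
        by (simp add: wedge_left wedge_right wedge_swap[of "x 0" "x 1"] W.scale_left_diff_distrib
            algebra_simps del: One_nat_def)
      then show "w \<in> W.span {wedge (x 0) (x 1)}"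
        by (auto intro: W.span_scale W.span_base)
    qed
  qed simp
  have "wedge (x 0) (x 1) \<in> ?X"
    using V.frame_span_base[of 0 2 x] V.frame_span_base[of 1 2 x] by auto
  then show "W.span {wedge (x 0) (x 1)} \<subseteq> W.span ?X" by (intro W.span_mono) auto
qed

lemma decomp_map_pow_span:
  "decomp_map s' wedge r (pow_span s 2 r a) = frame_span s' r (wedges a)"
proof -
  have *: "ext2 s' wedge (pow_span s 2 r a i) = W.span {wedges a i}" if "i < r" for i
    using that by (simp add: pow_span_def ext2_frame_span wedges_def)
  have "(\<Union>i<r. ext2 s' wedge (pow_span s 2 r a i)) = (\<Union>i<r. W.span {wedges a i})"
    using * by auto
  moreover have "W.span (\<Union>i<r. W.span {wedges a i}) = W.span (wedges a ` {..<r})"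
  proof
    show "W.span (\<Union>i<r. W.span {wedges a i}) \<subseteq> W.span (wedges a ` {..<r})"
      by (intro W.span_minimal UN_least W.span_mono) auto
    show "W.span (wedges a ` {..<r}) \<subseteq> W.span (\<Union>i<r. W.span {wedges a i})"
      by (intro W.span_mono) (auto intro: W.span_base)
  qed
  ultimately show ?thesis by (simp add: decomp_map_def frame_span_def)
qed

lemma decomp_domain_iff:
  assumes a: "a \<in> pow_frames s 2 r"
  shows "pow_span s 2 r a \<in> decomp_domain s s' wedge r \<longleftrightarrow> indep_family s' r (wedges a)"
proof -
  have Gr: "pow_span s 2 r a \<in> {..<r} \<rightarrow>\<^sub>E Gr s 2" using a by (simp add: pow_frames_def)
  have ext2: "ext2 s' wedge (pow_span s 2 r a i) = {s' c (wedges a i) | c. True}" if "i < r" for i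
    using that by (auto simp: pow_span_def ext2_frame_span wedges_def W.span_singleton)
  have ne: "wedges a i \<noteq> 0" if "i < r" for i
    using a that wedge_nonzero by (auto simp: V.pow_frames_iff wedges_def)
  show ?thesis
  proof
    assume L: "pow_span s 2 r a \<in> decomp_domain s s' wedge r"
    show "indep_family s' r (wedges a)"
      unfolding indep_family_def
    proof (intro allI impI)
      fix c l assume c: "(\<Sum>l<r. s' (c l) (wedges a l)) = 0" and l: "l < r"
      have in_ext2: "\<forall>i<r. s' (c i) (wedges a i) \<in> ext2 s' wedge (pow_span s 2 r a i)"
        using ext2 by auto
      have "\<forall>w. (\<forall>i<r. w i \<in> ext2 s' wedge (pow_span s 2 r a i)) \<and> (\<Sum>i<r. w i) = 0 \<longrightarrow>
          (\<forall>i<r. w i = 0)" using L unfolding decomp_domain_def by (elim CollectE conjE)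
      then have "\<forall>i<r. s' (c i) (wedges a i) = 0"
        by (rule spec[where x = "\<lambda>i. s' (c i) (wedges a i)", THEN mp]) (intro conjI in_ext2 c)
      then show "c l = 0" using ne l by simp
    qed
  next
    assume ind: "indep_family s' r (wedges a)"
    have "\<forall>i<r. w i = 0"
      if w: "\<forall>i<r. w i \<in> ext2 s' wedge (pow_span s 2 r a i)" "(\<Sum>i<r. w i) = 0" for w
    proof -
      have "\<forall>i. \<exists>c. i < r \<longrightarrow> w i = s' c (wedges a i)" using w(1) ext2 by auto
      then obtain c where c: "\<And>i. i < r \<Longrightarrow> w i = s' (c i) (wedges a i)" by metis
      then have "\<forall>i<r. c i = 0" using ind w(2) unfolding indep_family_def by simp
      then show ?thesis using c by simp
    qed
    then show "pow_span s 2 r a \<in> decomp_domain s s' wedge r"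
      using Gr by (simp add: decomp_domain_def)
  qed
qed

text \<open>The decomposability map is a morphism because it is given by the polynomial map \<open>wedges\<close> on frames.\<close>

lemma regular_pullback:
  assumes a: "a \<in> pow_frames s 2 r" and ind: "indep_family s' r (wedges a)"
    and f: "f \<in> Gr_regular s' r (frame_span s' r (wedges a))"
  shows "f \<circ> decomp_map s' wedge r \<in> Gr_pow_regular s 2 r (pow_span s 2 r a)"
proof -
  interpret G: homogeneous_presentation s' "{..<r}" "frames s' r" "frame_span s' r"
    by (rule W.homogeneous_presentation_Gr[OF inf])
  define p where "p b = (\<lambda>j\<in>{..<r}. wedges b j)" for b
  have p_span: "frame_span s' r (wedges b) = frame_span s' r (p b)" for b
    by (rule frame_span_cong) (simp add: p_def)
  have p_fr: "p b \<in> frames s' r" if "indep_family s' r (wedges b)" for b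
    using that unfolding W.frames_iff
    by (auto simp: p_def W.indep_family_cong[of r "\<lambda>j\<in>{..<r}. wedges b j" "wedges b"])
  obtain P Q where PQ: "P \<in> polyfuns s' {..<r}" "Q \<in> polyfuns s' {..<r}" "Q (p a) \<noteq> 0"
    "\<And>b. b \<in> frames s' r \<Longrightarrow> Q b \<noteq> 0 \<Longrightarrow> f (frame_span s' r b) = P b / Q b"
    using G.regular_funsE[OF f[unfolded Gr_regular_def p_span] p_fr[OF ind]] by blast
  have p_poly: "(\<lambda>b. \<phi> (p b j)) \<in> polyfuns s ({..<r} \<times> {..<2})"
    if "j \<in> {..<r}" "Vector_Spaces.linear s' (*) \<phi>" for j \<phi>
    using that polyfuns_wedges[of \<phi> j r] by (simp add: p_def)
  obtain \<phi> where \<phi>: "\<And>m. Vector_Spaces.linear s' (*) (\<phi> m)"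
    "\<And>m l. m < r \<Longrightarrow> l < r \<Longrightarrow> \<phi> m (wedges a l) = (if m = l then 1 else 0)"
    using W.dual_functionals[OF ind] by blast
  define \<delta> where "\<delta> b = fdet r (\<lambda>m j. \<phi> m (wedges b j))" for b
  have \<delta>: "\<delta> \<in> polyfuns s ({..<r} \<times> {..<2})"
    unfolding \<delta>_def using \<phi>(1) by (intro polyfuns_fdet polyfuns_wedges)
  have \<delta>a: "\<delta> a = 1" unfolding \<delta>_def using \<phi>(2) by (rule fdet_delta)
  show ?thesis
    unfolding Gr_pow_regular_def regular_funs_def
  proof (intro CollectI bexI[OF _ a] conjI refl bexI)
    show "(\<lambda>b. Q (p b) * \<delta> b) \<in> polyfuns s ({..<r} \<times> {..<2})"
      by (rule polyfuns.mult[OF polyfuns_compose[OF PQ(2) p_poly] \<delta>])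
    show "(\<lambda>b. P (p b) * \<delta> b) \<in> polyfuns s ({..<r} \<times> {..<2})"
      by (rule polyfuns.mult[OF polyfuns_compose[OF PQ(1) p_poly] \<delta>])
    show "Q (p a) * \<delta> a \<noteq> 0" using PQ(3) \<delta>a by simp
    show "\<forall>b\<in>pow_frames s 2 r. Q (p b) * \<delta> b \<noteq> 0 \<longrightarrow>
      (f \<circ> decomp_map s' wedge r) (pow_span s 2 r b) = P (p b) * \<delta> b / (Q (p b) * \<delta> b)"
    proof (intro ballI impI)
      fix b assume b: "Q (p b) * \<delta> b \<noteq> 0"
      have "indep_family s' r (wedges b)"
        by (rule W.indep_family_fdet[of \<phi>]) (use \<phi>(1) b in \<open>auto simp: \<delta>_def\<close>)
      then have "p b \<in> frames s' r" by (rule p_fr)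
      then show "(f \<circ> decomp_map s' wedge r) (pow_span s 2 r b) = P (p b) * \<delta> b / (Q (p b) * \<delta> b)"
        using PQ(4)[of "p b"] b by (simp add: decomp_map_pow_span p_span)
    qed
  qed
qed

end

section \<open>Transversality implies immersion\<close>

context exterior_square_space
begin

text \<open>
  The affine cone over the lines \<open>\<Lambda>\<^sup>2 L\<close> has at \<open>x \<and> y\<close> the tangent space \<open>L \<and> V\<close>. Transversality says
  that the span of the wedges meets it, for each plane, only in the line of that plane itself.
\<close>

definition transversal_at :: "nat \<Rightarrow> nat \<Rightarrow> (nat \<times> nat \<Rightarrow> 'v) \<Rightarrow> bool"
  where "transversal_at r i a \<longleftrightarrow> (\<forall>c u v.
    (\<Sum>j<r. s' (c j) (wedges a j)) = wedge u (a (i, 1)) + wedge (a (i, 0)) v \<longrightarrow>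
    (\<forall>j<r. j \<noteq> i \<longrightarrow> c j = 0))"

definition transversal :: "nat \<Rightarrow> (nat \<times> nat \<Rightarrow> 'v) \<Rightarrow> bool"
  where "transversal r a \<longleftrightarrow> (\<forall>i<r. transversal_at r i a)"

text \<open>
  Velocities of \<open>x\<close> and \<open>y\<close> that are normalised to lie in a complement of \<open>L\<close> are determined by the
  velocity of \<open>x \<and> y\<close> modulo \<open>x \<and> y\<close>. Each functional that vanishes on \<open>L\<close>, paired with one of the
  dual functionals of the basis, gives a minor that evaluates one of the two velocities.
\<close>

lemma wedge_tangent_zero:
  fixes \<phi> :: "nat \<Rightarrow> 'v \<Rightarrow> 'k"
  assumes \<phi>: "\<And>m. Vector_Spaces.linear s (*) (\<phi> m)"
    and dual: "\<And>m l. m < 2 \<Longrightarrow> l < 2 \<Longrightarrow> \<phi> m (x l) = (if m = l then 1 else 0)"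
    and u: "\<phi> 0 u = 0" "\<phi> 1 u = 0" and v: "\<phi> 0 v = 0" "\<phi> 1 v = 0"
    and eq: "wedge u (x 1) + wedge (x 0) v = s' c (wedge (x 0) (x 1))"
  shows "u = 0" "v = 0"
proof -
  have x: "\<phi> 0 (x 0) = 1" "\<phi> 1 (x 0) = 0" "\<phi> 0 (x 1) = 0" "\<phi> 1 (x 1) = 1"
    using dual[of 0 0] dual[of 1 0] dual[of 0 1] dual[of 1 1] by auto
  have "\<gamma> u = 0 \<and> \<gamma> v = 0" if \<gamma>: "Vector_Spaces.linear s (*) \<gamma>" for \<gamma>
  proof -
    \<comment> \<open>subtract multiples of the dual functionals to make \<open>\<gamma>\<close> vanish on the plane\<close>
    define \<gamma>' where "\<gamma>' = (\<lambda>z. 1 * \<gamma> z + 1 * ((- \<gamma> (x 0)) * \<phi> 0 z + (- \<gamma> (x 1)) * \<phi> 1 z))"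
    have \<gamma>': "Vector_Spaces.linear s (*) \<gamma>'"
      unfolding \<gamma>'_def by (intro linear_functional_combination \<gamma> \<phi>)
    have vals: "\<gamma>' (x 0) = 0" "\<gamma>' (x 1) = 0" "\<gamma>' u = \<gamma> u" "\<gamma>' v = \<gamma> v"
      unfolding \<gamma>'_def by (simp_all only: x u v) simp_all
    obtain \<theta> where \<theta>: "Vector_Spaces.linear s' (*) \<theta>"
      "\<And>x y. \<theta> (wedge x y) = \<gamma>' x * \<phi> 1 y - \<gamma>' y * \<phi> 1 x"
      using minor_functional[OF \<gamma>' \<phi>] by blast
    have "\<theta> (wedge u (x 1) + wedge (x 0) v) = \<theta> (s' c (wedge (x 0) (x 1)))" using eq by simp
    then have 1: "\<gamma> u = 0" by (simp only: linear_rules[OF \<theta>(1)] \<theta>(2) vals x u v) simp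
    obtain \<theta> where \<theta>: "Vector_Spaces.linear s' (*) \<theta>"
      "\<And>x y. \<theta> (wedge x y) = \<phi> 0 x * \<gamma>' y - \<phi> 0 y * \<gamma>' x"
      using minor_functional[OF \<phi> \<gamma>'] by blast
    have "\<theta> (wedge u (x 1) + wedge (x 0) v) = \<theta> (s' c (wedge (x 0) (x 1)))" using eq by simp
    then have "\<gamma> v = 0" by (simp only: linear_rules[OF \<theta>(1)] \<theta>(2) vals x u v) simp
    with 1 show ?thesis ..
  qed
  then show "u = 0" "v = 0"
    using functional_separates[OF V.vector_space_axioms, of u 0]
      functional_separates[OF V.vector_space_axioms, of v 0] by (auto simp: linear_rules(4))
qed

text \<open>
  The linear coefficient is the velocity of \<open>x\<^sub>j \<and> y\<^sub>j\<close> by the product rule.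
\<close>

lemma wedges_line:
  assumes "Vector_Spaces.linear s' (*) \<mu>" "j < r"
  shows "\<mu> (wedges (line_point s ({..<r} \<times> {..<2}) a v t) j) =
    poly [:\<mu> (wedges a j), \<mu> (wedge (v (j, 0)) (a (j, 1)) + wedge (a (j, 0)) (v (j, 1))),
      \<mu> (wedge (v (j, 0)) (v (j, 1))):] t"
  using assms(2)
  by (simp add: wedges_def line_point_def wedge_left wedge_right linear_rules[OF assms(1)] algebra_simps
      del: One_nat_def)

text \<open>
  The injectivity of the differential at a transversal tuple. Let \<open>b\<close> be the chart frame of a
  tuple of planes, let \<open>v\<close> be the velocity of \<open>b\<close> under \<open>D\<close>, and let \<open>\<eta> j\<close> be the resulting velocity of
  the wedge \<open>w\<^sub>j\<close>. If \<open>\<mu>\<close> vanishes on \<open>E\<close> and \<open>\<psi>\<close> is dual to the \<open>w\<^sub>l\<close>, then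
  \<open>\<mu> (w\<^sub>j) = \<Sum>\<^sub>l \<psi>\<^sub>l (w\<^sub>j) g\<^sub>l\<close> near the tuple, where \<open>g\<^sub>l\<close> is the pullback of the chart coordinate
  belonging to \<open>\<mu>\<close> and \<open>l\<close>. Both \<open>g\<^sub>l\<close> and \<open>D g\<^sub>l\<close> vanish at the tuple, so the product rule gives
  \<open>\<mu> (\<eta> j) = 0\<close>. Thus \<open>\<eta> j\<close> lies in \<open>E\<close> and in \<open>L\<^sub>j \<and> V\<close>, which by transversality forces \<open>v = 0\<close>.
\<close>

lemma deriv_zero_if_kills_pullbacks:
  assumes a: "a \<in> pow_frames s 2 r" and ind: "indep_family s' r (wedges a)"
    and trans: "transversal r a"
    and D: "D \<in> tangent_space (Gr_pow_regular s 2 r (pow_span s 2 r a)) (pow_span s 2 r a)"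
    and kills: "\<And>f. f \<in> Gr_regular s' r (decomp_map s' wedge r (pow_span s 2 r a)) \<Longrightarrow>
      D (f \<circ> decomp_map s' wedge r) = 0"
    and f: "f \<in> Gr_pow_regular s 2 r (pow_span s 2 r a)"
  shows "D f = 0"
proof -
  let ?J = "{..<r} \<times> {..<2::nat}"
  let ?\<pi> = "pow_span s 2 r" and ?\<Psi> = "decomp_map s' wedge r"
  interpret G: homogeneous_presentation s ?J "pow_frames s 2 r" ?\<pi>
    by (rule V.homogeneous_presentation_Gr_pow[OF inf])
  have R: "Gr_pow_regular s 2 r = G.R" by (simp add: fun_eq_iff Gr_pow_regular_def)
  note D = D[unfolded R]
  have ex: "\<exists>\<phi>. (\<forall>m. Vector_Spaces.linear s (*) (\<phi> m)) \<and>
      (\<forall>m<2. \<forall>l<2. \<phi> m (a (i, l)) = (if m = l then 1 else 0))" if i: "i < r" for i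
  proof -
    have "indep_family s 2 (\<lambda>j. a (i, j))" using a i by (simp add: V.pow_frames_iff)
    then obtain \<phi> where "\<And>m. Vector_Spaces.linear s (*) (\<phi> m)"
      "\<And>m l. m < 2 \<Longrightarrow> l < 2 \<Longrightarrow> \<phi> m (a (i, l)) = (if m = l then 1 else 0)"
      by (rule V.dual_functionals) (rule that, assumption+)
    then show ?thesis by (intro exI[of _ \<phi>]) simp
  qed
  obtain \<phi> where \<phi>: "\<And>i m. i < r \<Longrightarrow> Vector_Spaces.linear s (*) (\<phi> i m)"
    and dual: "\<And>i m l. i < r \<Longrightarrow> m < 2 \<Longrightarrow> l < 2 \<Longrightarrow> \<phi> i m (a (i, l)) = (if m = l then 1 else 0)"
    using ex by metis
  define b where "b = pow_chart \<phi> 2 r"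
  have base: "b (?\<pi> a) = a"
    unfolding b_def by (rule V.pow_chart_base[OF a]) (use \<phi> dual in auto)
  have reg: "(\<lambda>M. \<mu> (b M (i, j))) \<in> G.R (?\<pi> a)"
    if "i < r" "j < 2" "Vector_Spaces.linear s (*) \<mu>" for i j \<mu>
    using V.pow_chart_regular[OF a _ _ that(1,2,3) inf, of \<phi>] \<phi> dual unfolding b_def R by blast
  obtain Q where Q: "Q \<in> polyfuns s ?J" "Q a \<noteq> 0" and
    sec: "\<And>c. c \<in> pow_frames s 2 r \<Longrightarrow> Q c \<noteq> 0 \<Longrightarrow> b (?\<pi> c) \<in> pow_frames s 2 r \<and>
      ?\<pi> (b (?\<pi> c)) = ?\<pi> c \<and>
      (\<forall>i<r. \<forall>j<2. \<forall>m<2. \<phi> i m (b (?\<pi> c) (i, j)) = (if m = j then 1 else 0))"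
    using V.pow_chart_section[OF a \<phi> dual] unfolding b_def by blast
  obtain e e' where e: "dual_basis s d e e'" by (rule dual_basis_exists)
  then have e'_lin: "\<And>n. n < d \<Longrightarrow> Vector_Spaces.linear s (*) (e' n)"
    and e_sum: "\<And>x. x = (\<Sum>n<d. s (e' n x) (e n))"
    unfolding dual_basis_def by blast+
  \<comment> \<open>the velocity with which the derivation moves the frame\<close>
  define v where "v x = (\<Sum>n<d. s (D (\<lambda>M. e' n (b M x))) (e n))" for x
  have vel: "(\<lambda>M. \<mu> (b M x)) \<in> G.R (?\<pi> a) \<and> D (\<lambda>M. \<mu> (b M x)) = \<mu> (v x)"
    if x: "x \<in> ?J" and \<mu>: "Vector_Spaces.linear s (*) \<mu>" for x \<mu>
  proof -
    obtain i j where ij: "x = (i, j)" "i < r" "j < 2" using x by auto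
    have "\<mu> (b M x) = (\<Sum>n<d. \<mu> (e n) * e' n (b M x))" for M
      by (subst e_sum[of "b M x"]) (simp add: linear_rules[OF \<mu>] mult.commute)
    then have "D (\<lambda>M. \<mu> (b M x)) = D (\<lambda>M. \<Sum>n<d. \<mu> (e n) * e' n (b M x))" by simp
    also have "\<dots> = (\<Sum>n<d. D (\<lambda>M. \<mu> (e n) * e' n (b M x)))"
      by (rule G.deriv_sum[OF D a]) (use ij reg e'_lin in \<open>auto intro!: G.regular_cmult a\<close>)
    also have "\<dots> = (\<Sum>n<d. \<mu> (e n) * D (\<lambda>M. e' n (b M x)))"
      by (intro sum.cong refl G.deriv_cmult[OF D a]) (use ij reg e'_lin in auto)
    also have "\<dots> = \<mu> (v x)" by (simp add: v_def linear_rules[OF \<mu>] mult.commute)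
    finally show ?thesis using reg[OF ij(2,3) \<mu>] ij(1) by simp
  qed
  have v\<phi>: "\<phi> i m (v (i, j)) = 0" if ijm: "i < r" "j < 2" "m < 2" for i j m
  proof -
    have nr: "G.near a (\<lambda>M. \<phi> i m (b M (i, j)) = (if m = j then 1 else 0))"
      unfolding G.near_def using Q sec ijm by blast
    have "\<phi> i m (v (i, j)) = D (\<lambda>M. \<phi> i m (b M (i, j)))"
      using vel[of "(i, j)" "\<phi> i m"] ijm \<phi> by simp
    also have "\<dots> = D (\<lambda>_. if m = j then 1 else 0)"
      by (rule G.deriv_near[OF D a reg[OF ijm(1,2) \<phi>[OF ijm(1)]] G.regular_const[OF a] nr])
    also have "\<dots> = 0" by (rule G.deriv_const[OF D a])
    finally show ?thesis .
  qed
  define \<eta> where "\<eta> j = wedge (v (j, 0)) (a (j, 1)) + wedge (a (j, 0)) (v (j, 1))" for j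
  have dw: "(\<lambda>M. \<mu> (wedges (b M) j)) \<in> G.R (?\<pi> a) \<and> D (\<lambda>M. \<mu> (wedges (b M) j)) = \<mu> (\<eta> j)"
    if \<mu>: "Vector_Spaces.linear s' (*) \<mu>" and j: "j < r" for \<mu> j
  proof -
    obtain p where Rw: "(\<lambda>M. \<mu> (wedges (b M) j)) \<in> G.R (?\<pi> a)"
      and p: "\<And>t. \<mu> (wedges (line_point s ?J a v t) j) = poly p t"
        "D (\<lambda>M. \<mu> (wedges (b M) j)) = poly (pderiv p) 0"
      using G.deriv_polyfun[OF D a polyfuns_wedges[OF \<mu> j], where b = b and v = v, OF vel]
      unfolding base by metis
    have "p = [:\<mu> (wedges a j), \<mu> (\<eta> j), \<mu> (wedge (v (j, 0)) (v (j, 1))):]"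
      by (rule poly_eq_infinite[OF inf, of 1])
        (simp_all only: p(1)[symmetric] wedges_line[OF \<mu> j] \<eta>_def, simp)
    then have "poly (pderiv p) 0 = \<mu> (\<eta> j)" by (simp add: pderiv_pCons)
    then show ?thesis using Rw p(2) by simp
  qed
  let ?E = "frame_span s' r (wedges a)"
  have E: "?\<Psi> (?\<pi> a) = ?E" by (rule decomp_map_pow_span)
  obtain \<psi> where \<psi>: "\<And>m. Vector_Spaces.linear s' (*) (\<psi> m)"
    and \<psi>dual: "\<And>m l. m < r \<Longrightarrow> l < r \<Longrightarrow> \<psi> m (wedges a l) = (if m = l then 1 else 0)"
    using W.dual_functionals[OF ind] by blast
  define \<delta> where "\<delta> c = fdet r (\<lambda>m j. \<psi> m (wedges c j))" for c
  have \<delta>: "\<delta> \<in> polyfuns s ?J"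
    unfolding \<delta>_def using \<psi> by (intro polyfuns_fdet polyfuns_wedges)
  have \<delta>a: "\<delta> a = 1" unfolding \<delta>_def using \<psi>dual by (rule fdet_delta)
  have \<eta>E: "\<eta> j \<in> ?E" if j: "j < r" for j
  proof (rule ccontr)
    assume "\<eta> j \<notin> ?E"
    then obtain \<mu> where \<mu>: "Vector_Spaces.linear s' (*) \<mu>" "\<mu> (\<eta> j) = 1" "\<And>w. w \<in> ?E \<Longrightarrow> \<mu> w = 0"
      using W.subspace_separation[OF W.subspace_frame_span] by blast
    define g where "g l M = \<mu> (chart_frame \<psi> r (?\<Psi> M) l)" for l M
    have g: "g l \<in> G.R (?\<pi> a)" "D (g l) = 0" "g l (?\<pi> a) = 0" if l: "l < r" for l
    proof -
      let ?w = "\<lambda>l\<in>{..<r}. wedges a l"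
      have fr: "?w \<in> frames s' r"
        using ind W.indep_family_cong[of r ?w "wedges a"] by (simp add: W.frames_iff)
      have sp: "frame_span s' r ?w = ?E" by (rule frame_span_cong) simp
      have "(\<lambda>F. \<mu> (chart_frame \<psi> r F l)) \<in> Gr_regular s' r (frame_span s' r ?w)"
        by (rule W.chart_regular[OF fr _ _ \<mu>(1) l]) (use \<psi> \<psi>dual in auto)
      then have rg: "(\<lambda>F. \<mu> (chart_frame \<psi> r F l)) \<in> Gr_regular s' r ?E" unfolding sp .
      have gl: "g l = (\<lambda>F. \<mu> (chart_frame \<psi> r F l)) \<circ> ?\<Psi>" by (simp add: g_def fun_eq_iff)
      show "g l \<in> G.R (?\<pi> a)" unfolding gl R[symmetric] by (rule regular_pullback[OF a ind rg])
      show "D (g l) = 0" unfolding gl by (rule kills) (use rg E in simp)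
      have "chart_frame \<psi> r ?E l \<in> ?E"
        by (rule W.chart_frame_in[OF \<psi> _ l]) (use \<delta>a in \<open>simp add: \<delta>_def\<close>)
      then show "g l (?\<pi> a) = 0" unfolding g_def E by (rule \<mu>(3))
    qed
    have nr: "G.near a (\<lambda>M. \<mu> (wedges (b M) j) = (\<Sum>l<r. \<psi> l (wedges (b M) j) * g l M))"
      unfolding G.near_def
    proof (intro bexI[of _ "\<lambda>c. Q c * \<delta> c"] conjI ballI impI)
      show "(\<lambda>c. Q c * \<delta> c) \<in> polyfuns s ?J" by (rule polyfuns.mult[OF Q(1) \<delta>])
      show "Q a * \<delta> a \<noteq> 0" using Q(2) \<delta>a by simp
      fix c assume c: "c \<in> pow_frames s 2 r" "Q c * \<delta> c \<noteq> 0"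
      let ?M = "?\<pi> c"
      have "?\<pi> (b ?M) = ?M" using sec c by simp
      then have "frame_span s' r (wedges (b ?M)) = ?\<Psi> ?M" by (metis decomp_map_pow_span)
      then have "wedges (b ?M) j \<in> ?\<Psi> ?M" using W.frame_span_base[OF j, of "wedges (b ?M)"] by simp
      then have in_span: "wedges (b ?M) j \<in> frame_span s' r (wedges c)"
        by (simp add: decomp_map_pow_span)
      have det: "fdet r (\<lambda>m j. \<psi> m (wedges c j)) \<noteq> 0" using c(2) by (simp add: \<delta>_def)
      have "wedges (b ?M) j = (\<Sum>l<r. s' (\<psi> l (wedges (b ?M) j))
          (chart_frame \<psi> r (frame_span s' r (wedges c)) l))"
        by (rule W.chart_frame_expand[of \<psi> r "wedges c", OF \<psi> det in_span])
      then have "\<mu> (wedges (b ?M) j) = \<mu> (\<Sum>l<r. s' (\<psi> l (wedges (b ?M) j))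
          (chart_frame \<psi> r (frame_span s' r (wedges c)) l))" by (rule arg_cong)
      then show "\<mu> (wedges (b ?M) j) = (\<Sum>l<r. \<psi> l (wedges (b ?M) j) * g l ?M)"
        by (simp only: linear_rules[OF \<mu>(1)] g_def decomp_map_pow_span)
    qed
    have prodR: "(\<lambda>M. \<psi> l (wedges (b M) j) * g l M) \<in> G.R (?\<pi> a)" if "l < r" for l
      using that dw[OF \<psi> j] g(1) by (intro G.regular_mult a) auto
    have "\<mu> (\<eta> j) = D (\<lambda>M. \<mu> (wedges (b M) j))" using dw[OF \<mu>(1) j] by simp
    also have "\<dots> = D (\<lambda>M. \<Sum>l<r. \<psi> l (wedges (b M) j) * g l M)"
      by (rule G.deriv_near[OF D a _ G.regular_sum nr]) (use dw[OF \<mu>(1) j] a prodR in auto)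
    also have "\<dots> = (\<Sum>l<r. D (\<lambda>M. \<psi> l (wedges (b M) j) * g l M))"
      by (rule G.deriv_sum[OF D a]) (use prodR in auto)
    also have "\<dots> = (\<Sum>l<r. \<psi> l (wedges (b (?\<pi> a)) j) * D (g l) + g l (?\<pi> a) * D (\<lambda>M. \<psi> l (wedges (b M) j)))"
      by (intro sum.cong refl G.deriv_mult[OF D a]) (use dw[OF \<psi> j] g(1) in auto)
    also have "\<dots> = 0" using g by simp
    finally show False using \<mu>(2) by simp
  qed
  have v0: "v (j, 0) = 0 \<and> v (j, 1) = 0" if j: "j < r" for j
  proof -
    obtain c where c: "\<eta> j = (\<Sum>l<r. s' (c l) (wedges a l))"
      using \<eta>E[OF j] by (auto simp: W.frame_span_eq)
    have c0: "c l = 0" if "l < r" "l \<noteq> j" for l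
      using trans c[symmetric] j that unfolding transversal_def transversal_at_def \<eta>_def by metis
    have "(\<Sum>l<r. s' (c l) (wedges a l)) = (\<Sum>l<r. s' (if l = j then c j else 0) (wedges a l))"
      by (intro sum.cong refl) (use c0 in auto)
    then have eq: "wedge (v (j, 0)) (a (j, 1)) + wedge (a (j, 0)) (v (j, 1)) =
        s' (c j) (wedge (a (j, 0)) (a (j, 1)))"
      unfolding c[unfolded \<eta>_def] using j by (simp add: W.sum_delta_scale wedges_def)
    show ?thesis
      by (intro conjI; rule wedge_tangent_zero[of "\<phi> j" "\<lambda>l. a (j, l)", OF \<phi>[OF j] dual[OF j] _ _ _ _ eq])
        (use v\<phi>[OF j] in auto)
  qed
  show ?thesis
  proof (rule G.deriv_eq_0[OF D a, where b = b])
    fix x \<mu> assume x: "x \<in> ?J" and \<mu>: "Vector_Spaces.linear s (*) \<mu>"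
    obtain i j where ij: "x = (i, j)" "i < r" "j < 2" using x by auto
    have "v x = 0" using v0[OF ij(2)] ij by (auto simp: less_2_cases_iff)
    then show "(\<lambda>M. \<mu> (b M x)) \<in> G.R (?\<pi> a) \<and> D (\<lambda>M. \<mu> (b M x)) = 0"
      using vel[OF x \<mu>] linear_rules(4)[OF \<mu>] by simp
  next
    show "b (?\<pi> a) = a" by (rule base)
    show "G.near a (\<lambda>M. b M \<in> pow_frames s 2 r \<and> ?\<pi> (b M) = M)"
      unfolding G.near_def using Q sec by blast
    show "f \<in> G.R (?\<pi> a)" using f unfolding R .
  qed
qed

lemma immersion_if_transversal:
  assumes a: "a \<in> pow_frames s 2 r" and ind: "indep_family s' r (wedges a)"
    and trans: "transversal r a"
  shows "decomp_immersion_at s s' wedge r (pow_span s 2 r a)"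
  unfolding decomp_immersion_at_def
proof (rule inj_onI)
  let ?\<pi> = "pow_span s 2 r" and ?\<Psi> = "decomp_map s' wedge r"
  interpret G: homogeneous_presentation s "{..<r} \<times> {..<2}" "pow_frames s 2 r" ?\<pi>
    by (rule V.homogeneous_presentation_Gr_pow[OF inf])
  have R: "Gr_pow_regular s 2 r = G.R" by (simp add: fun_eq_iff Gr_pow_regular_def)
  fix D D' assume D: "D \<in> tangent_space (Gr_pow_regular s 2 r (?\<pi> a)) (?\<pi> a)"
    "D' \<in> tangent_space (Gr_pow_regular s 2 r (?\<pi> a)) (?\<pi> a)"
    and eq: "differential (Gr_regular s' r (?\<Psi> (?\<pi> a))) ?\<Psi> D =
      differential (Gr_regular s' r (?\<Psi> (?\<pi> a))) ?\<Psi> D'"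
  let ?D = "\<lambda>f\<in>G.R (?\<pi> a). D f - D' f"
  have diff: "?D \<in> tangent_space (Gr_pow_regular s 2 r (?\<pi> a)) (?\<pi> a)"
    using G.tangent_diff[OF a] D unfolding R by blast
  have kills: "?D (f \<circ> ?\<Psi>) = 0" if f: "f \<in> Gr_regular s' r (?\<Psi> (?\<pi> a))" for f
  proof -
    have "f \<circ> ?\<Psi> \<in> G.R (?\<pi> a)"
      using regular_pullback[OF a ind] f unfolding R decomp_map_pow_span by blast
    moreover have "D (f \<circ> ?\<Psi>) = D' (f \<circ> ?\<Psi>)"
      using fun_cong[OF eq, of f] f by (simp add: differential_def)
    ultimately show ?thesis by simp
  qed
  have "?D f = 0" if "f \<in> G.R (?\<pi> a)" for f
    by (rule deriv_zero_if_kills_pullbacks[OF a ind trans diff kills]) (simp_all only: R that)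
  then have "D f = D' f" if "f \<in> G.R (?\<pi> a)" for f using that by fastforce
  then show "D = D'"
    using D unfolding R tangent_space_def by (intro extensionalityI[of _ "G.R (?\<pi> a)"]) auto
qed

end

section \<open>Immersion implies transversality\<close>

context exterior_square_space
begin

text \<open>
  A functional that vanishes on the plane sees the chart frame of a moving plane move with the same
  velocity as the given frame: the frames differ by a matrix that is the identity at \<open>t = 0\<close>.
\<close>

lemma chart_frame_velocity:
  assumes \<phi>: "\<And>m. Vector_Spaces.linear s (*) (\<phi> m)"
    and dual: "\<And>m l. m < 2 \<Longrightarrow> l < 2 \<Longrightarrow> \<phi> m (x l) = (if m = l then 1 else 0)"
    and \<gamma>: "Vector_Spaces.linear s (*) \<gamma>" "\<gamma> (x 0) = 0" "\<gamma> (x 1) = 0"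
    and l: "l < (2::nat)"
  shows "germ_deriv (\<lambda>t. \<gamma> (chart_frame \<phi> 2 (frame_span s 2 (\<lambda>l. x l + s t (v l))) l)) = \<gamma> (v l)"
proof -
  have x: "\<phi> 0 (x 0) = 1" "\<phi> 1 (x 0) = 0" "\<phi> 0 (x 1) = 0" "\<phi> 1 (x 1) = 1"
    using dual[of 0 0] dual[of 1 0] dual[of 0 1] dual[of 1 1] by auto
  define b where "b t l = x l + s t (v l)" for t l
  have vals: "\<phi> 0 (b t 0) = 1 + t * \<phi> 0 (v 0)" "\<phi> 1 (b t 0) = t * \<phi> 1 (v 0)"
    "\<phi> 0 (b t 1) = t * \<phi> 0 (v 1)" "\<phi> 1 (b t 1) = 1 + t * \<phi> 1 (v 1)"
    "\<gamma> (b t 0) = t * \<gamma> (v 0)" "\<gamma> (b t 1) = t * \<gamma> (v 1)" for t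
    unfolding b_def by (simp_all only: linear_rules[OF \<phi>] linear_rules[OF \<gamma>(1)] x \<gamma>(2,3)) simp_all
  \<comment> \<open>the determinant of the chart along the line, and the numerators of Cramer's rule\<close>
  define q where "q = [:1, \<phi> 0 (v 0):] * [:1, \<phi> 1 (v 1):] - [:0, \<phi> 0 (v 1):] * [:0, \<phi> 1 (v 0):]"
  define p where "p = (if l = 0
    then [:1, \<phi> 1 (v 1):] * [:0, \<gamma> (v 0):] - [:0, \<phi> 1 (v 0):] * [:0, \<gamma> (v 1):]
    else [:1, \<phi> 0 (v 0):] * [:0, \<gamma> (v 1):] - [:0, \<phi> 0 (v 1):] * [:0, \<gamma> (v 0):])"
  have q: "poly q t = fdet 2 (\<lambda>m j. \<phi> m (b t j))" for t
    unfolding fdet_2 vals q_def by (simp add: algebra_simps)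
  have "rational_germ (\<lambda>t. \<gamma> (chart_frame \<phi> 2 (frame_span s 2 (b t)) l)) p q"
    unfolding rational_germ_def
  proof (intro conjI allI impI)
    show "poly q 0 \<noteq> 0" by (simp add: q_def)
    fix t assume qt: "poly q t \<noteq> 0"
    then have det: "fdet 2 (\<lambda>m j. \<phi> m (b t j)) \<noteq> 0" by (simp add: q)
    have det2: "fdet 2 (\<lambda>m j. \<phi> m (b t j)) = \<phi> 0 (b t 0) * \<phi> 1 (b t 1) - \<phi> 0 (b t 1) * \<phi> 1 (b t 0)"
      by (rule fdet_2)
    define n where "n j = (if l = 0 then (if j = 0 then \<phi> 1 (b t 1) else - \<phi> 1 (b t 0))
      else (if j = 0 then - \<phi> 0 (b t 1) else \<phi> 0 (b t 0)))" for j :: nat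
    let ?e = "s (n 0 / poly q t) (b t 0) + s (n 1 / poly q t) (b t 1)"
    have e: "\<mu> ?e = (n 0 * \<mu> (b t 0) + n 1 * \<mu> (b t 1)) / poly q t"
      if "Vector_Spaces.linear s (*) \<mu>" for \<mu>
      by (simp only: linear_rules[OF that] add_divide_distrib times_divide_eq_left)
    have "chart_frame \<phi> 2 (frame_span s 2 (b t)) l = ?e"
    proof (rule V.chart_frame_eqI[OF \<phi> det])
      show "?e \<in> frame_span s 2 (b t)"
        unfolding V.frame_span_eq sum_lessThan_2 by (intro CollectI exI[of _ "\<lambda>j. n j / poly q t"]) simp
      fix m :: nat assume m: "m < 2"
      have "n 0 * \<phi> m (b t 0) + n 1 * \<phi> m (b t 1) = (if m = l then poly q t else 0)"
        using m l by (auto simp: less_2_cases_iff n_def q det2 algebra_simps)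
      then show "\<phi> m ?e = (if m = l then 1 else 0)" using qt unfolding e[OF \<phi>] by simp
    qed
    then have "\<gamma> (chart_frame \<phi> 2 (frame_span s 2 (b t)) l) =
        (n 0 * \<gamma> (b t 0) + n 1 * \<gamma> (b t 1)) / poly q t"
      by (simp only: e[OF \<gamma>(1)])
    also have "n 0 * \<gamma> (b t 0) + n 1 * \<gamma> (b t 1) = poly p t"
      unfolding n_def p_def vals by (simp add: algebra_simps)
    finally show "\<gamma> (chart_frame \<phi> 2 (frame_span s 2 (b t)) l) = poly p t / poly q t" .
  qed
  then have "germ_deriv (\<lambda>t. \<gamma> (chart_frame \<phi> 2 (frame_span s 2 (b t)) l)) = quotient_deriv p q"
    by (rule germ_deriv_eq[OF inf])
  also have "\<dots> = \<gamma> (v l)"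
    using l by (auto simp: quotient_deriv_def p_def q_def pderiv_mult pderiv_diff pderiv_pCons less_2_cases_iff)
  finally show ?thesis unfolding b_def[abs_def] .
qed

text \<open>
  The summand \<open>s' t \<eta>\<close> is a combination of members that the two families share.
\<close>

lemma frame_span_perturb:
  assumes i: "i < r" and c: "\<eta> = (\<Sum>j<r. s' (if j = i then 0 else c j) (w j))"
  shows "frame_span s' r (\<lambda>j. if j = i then w i + s' t \<eta> + z else w j) =
    frame_span s' r (\<lambda>j. if j = i then w i + z else w j)" (is "frame_span s' r ?w = frame_span s' r ?w'")
proof -
  have in_b: "\<eta> \<in> frame_span s' r b" if "\<And>j. j \<noteq> i \<Longrightarrow> b j = w j" for b
  proof -
    have "\<eta> = (\<Sum>j<r. s' (if j = i then 0 else c j) (b j))"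
      unfolding c by (intro sum.cong refl) (use that in auto)
    then show ?thesis unfolding W.frame_span_eq
      by (intro CollectI exI[of _ "\<lambda>j. if j = i then 0 else c j"]) simp
  qed
  have in_span: "\<eta> \<in> frame_span s' r ?w" "\<eta> \<in> frame_span s' r ?w'"
    by (auto intro: in_b)
  have wi: "w i + s' t \<eta> + z \<in> frame_span s' r ?w" "w i + z \<in> frame_span s' r ?w'"
    using W.frame_span_base[OF i, of ?w] W.frame_span_base[OF i, of ?w'] by simp_all
  show ?thesis
  proof (intro subset_antisym W.frame_span_subset W.subspace_frame_span)
    fix l assume l: "l < r"
    have "w i + z + s' t \<eta> \<in> frame_span s' r ?w'"
      by (intro W.subspace_add W.subspace_scale W.subspace_frame_span in_span wi)
    then show "?w l \<in> frame_span s' r ?w'"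
      using W.frame_span_base[OF l, of ?w'] by (auto simp: algebra_simps)
    have "w i + s' t \<eta> + z - s' t \<eta> \<in> frame_span s' r ?w"
      by (intro W.subspace_diff W.subspace_scale W.subspace_frame_span in_span wi)
    then show "?w' l \<in> frame_span s' r ?w"
      using W.frame_span_base[OF l, of ?w] by (auto simp: algebra_simps)
  qed
qed

text \<open>
  The derivative of \<open>t\<^sup>2\<close> at \<open>0\<close> is zero.
\<close>

lemma germ_deriv_square:
  fixes p q :: "'k poly"
  assumes "rational_germ h p q"
  shows "germ_deriv (\<lambda>t. h (t * t)) = 0"
proof -
  let ?X = "[:0, 0, 1:] :: 'k poly"
  have "rational_germ (\<lambda>t. h (t * t)) (pcompose p ?X) (pcompose q ?X)"
    using assms by (simp add: rational_germ_def poly_pcompose)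
  then have "germ_deriv (\<lambda>t. h (t * t)) = quotient_deriv (pcompose p ?X) (pcompose q ?X)"
    by (rule germ_deriv_eq[OF inf])
  then show ?thesis by (simp add: quotient_deriv_def pderiv_pcompose poly_pcompose pderiv_pCons)
qed

text \<open>
  A relation that violates transversality at \<open>i\<close> yields \<open>\<eta> = u \<and> y + x \<and> v\<close> in the span of the
  wedges \<open>w\<^sub>j\<close> with \<open>j \<noteq> i\<close>. Along the line in direction \<open>(u, v)\<close> in the factor \<open>i\<close>, the wedge \<open>w\<^sub>i\<close>
  becomes \<open>w\<^sub>i + t \<eta> + t\<^sup>2 (u \<and> v)\<close>, and the term \<open>t \<eta>\<close> does not change the span. So the derivation
  along this line vanishes on pullbacks, and by the assumed immersion it vanishes on all
  regular functions. Testing it on chart coordinates puts \<open>u\<close> and \<open>v\<close> into the plane, which makes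
  \<open>\<eta>\<close> a multiple of \<open>w\<^sub>i\<close> and contradicts independence.
\<close>

lemma transversal_if_immersion:
  assumes a: "a \<in> pow_frames s 2 r" and ind: "indep_family s' r (wedges a)"
    and imm: "decomp_immersion_at s s' wedge r (pow_span s 2 r a)"
  shows "transversal r a"
  unfolding transversal_def transversal_at_def
proof (intro allI impI, rule ccontr)
  let ?J = "{..<r} \<times> {..<2::nat}"
  let ?\<pi> = "pow_span s 2 r" and ?\<Psi> = "decomp_map s' wedge r"
  interpret G: homogeneous_presentation s ?J "pow_frames s 2 r" ?\<pi>
    by (rule V.homogeneous_presentation_Gr_pow[OF inf])
  interpret H: homogeneous_presentation s' "{..<r}" "frames s' r" "frame_span s' r"
    by (rule W.homogeneous_presentation_Gr[OF inf])
  have R: "Gr_pow_regular s 2 r = G.R" by (simp add: fun_eq_iff Gr_pow_regular_def)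
  have RW: "Gr_regular s' r = H.R" by (simp add: fun_eq_iff Gr_regular_def)
  fix i c u0 v j0 assume i: "i < r" and j0: "j0 < r" "j0 \<noteq> i" "c j0 \<noteq> 0"
    and eq0: "(\<Sum>j<r. s' (c j) (wedges a j)) = wedge u0 (a (i, 1)) + wedge (a (i, 0)) v"
  let ?x = "\<lambda>l. a (i, l)"
  \<comment> \<open>absorb the multiple of \<open>wedges a i\<close> in the relation into \<open>u\<close>\<close>
  define u where "u = u0 - s (c i) (?x 0)"
  define \<eta> where "\<eta> = wedge u (?x 1) + wedge (?x 0) v"
  have \<eta>: "\<eta> = (\<Sum>j<r. s' (if j = i then 0 else c j) (wedges a j))"
  proof -
    have "\<eta> = (\<Sum>j<r. s' (c j) (wedges a j)) - s' (c i) (wedges a i)"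
      unfolding \<eta>_def eq0 u_def by (simp add: wedge_left wedges_def)
    also have "s' (c i) (wedges a i) = (\<Sum>j<r. s' (if j = i then c i else 0) (wedges a j))"
      by (rule W.sum_delta_scale[OF i, symmetric])
    finally show ?thesis
      by (auto simp: sum_subtractf[symmetric] W.scale_left_diff_distrib[symmetric] intro!: sum.cong)
  qed
  define dir where "dir x = (if fst x = i then if snd x = 0 then u else v else 0)" for x :: "nat \<times> nat"
  let ?l = "line_point s ?J a dir"
  have wl: "wedges (?l t) j = (if j = i then wedges a i + s' t \<eta> + s' (t * t) (wedge u v) else wedges a j)"
    if "j < r" for j t
    using that i by (simp add: line_point_def wedges_def dir_def \<eta>_def wedge_left wedge_right
        W.scale_right_distrib algebra_simps del: One_nat_def)
  define z where "z j = (if j = i then wedge u v else 0)" for j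
  let ?w = "\<lambda>j\<in>{..<r}. wedges a j"
  have w_fr: "?w \<in> frames s' r"
    using ind W.indep_family_cong[of r ?w "wedges a"] by (simp add: W.frames_iff)
  have w_sp: "frame_span s' r ?w = frame_span s' r (wedges a)" by (rule frame_span_cong) simp
  \<comment> \<open>up to a change of frame, the image of the line depends on \<open>t\<^sup>2\<close> only\<close>
  have \<Psi>l: "?\<Psi> (?\<pi> (?l t)) = frame_span s' r (line_point s' {..<r} ?w z (t * t))" for t
  proof -
    have "?\<Psi> (?\<pi> (?l t)) = frame_span s' r
        (\<lambda>j. if j = i then wedges a i + s' t \<eta> + s' (t * t) (wedge u v) else wedges a j)"
      unfolding decomp_map_pow_span by (rule frame_span_cong) (rule wl)
    also have "\<dots> = frame_span s' r (\<lambda>j. if j = i then wedges a i + s' (t * t) (wedge u v) else wedges a j)"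
      by (rule frame_span_perturb[OF i \<eta>])
    also have "\<dots> = frame_span s' r (line_point s' {..<r} ?w z (t * t))"
      by (rule frame_span_cong) (auto simp: line_point_def z_def)
    finally show ?thesis .
  qed
  let ?D = "G.curve_deriv a dir" and ?Z = "\<lambda>f\<in>G.R (?\<pi> a). G.curve_deriv a dir f - G.curve_deriv a dir f"
  have D: "?D \<in> tangent_space (G.R (?\<pi> a)) (?\<pi> a)" by (rule G.curve_deriv_tangent[OF a])
  have D0: "?Z \<in> tangent_space (G.R (?\<pi> a)) (?\<pi> a)" by (rule G.tangent_diff[OF a D D])
  have "differential (Gr_regular s' r (?\<Psi> (?\<pi> a))) ?\<Psi> ?D =
      differential (Gr_regular s' r (?\<Psi> (?\<pi> a))) ?\<Psi> ?Z"
    unfolding differential_def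
  proof (rule restrict_ext)
    fix f assume "f \<in> Gr_regular s' r (?\<Psi> (?\<pi> a))"
    then have f: "f \<in> Gr_regular s' r (frame_span s' r (wedges a))" by (simp add: decomp_map_pow_span)
    have fR: "f \<circ> ?\<Psi> \<in> G.R (?\<pi> a)" using regular_pullback[OF a ind f] unfolding R .
    obtain p q where pq: "rational_germ (\<lambda>t. f (frame_span s' r (line_point s' {..<r} ?w z t))) p q"
      using H.regular_germ[OF w_fr, of f z] f unfolding RW w_sp by blast
    have "?D (f \<circ> ?\<Psi>) = germ_deriv (\<lambda>t. f (frame_span s' r (line_point s' {..<r} ?w z (t * t))))"
      using fR by (simp add: G.curve_deriv_apply \<Psi>l)
    then show "?D (f \<circ> ?\<Psi>) = ?Z (f \<circ> ?\<Psi>)" using germ_deriv_square[OF pq] fR by simp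
  qed
  then have D_eq: "?D = ?Z" using imm D D0 unfolding decomp_immersion_at_def inj_on_def R by blast
  have x_ind: "indep_family s 2 ?x" using a i by (simp add: V.pow_frames_iff)
  obtain \<phi> where \<phi>: "\<And>m. Vector_Spaces.linear s (*) (\<phi> m)"
    and dual: "\<And>m l. m < 2 \<Longrightarrow> l < 2 \<Longrightarrow> \<phi> m (?x l) = (if m = l then 1 else 0)"
    using V.dual_functionals[OF x_ind] by blast
  have vel: "dir (i, l) \<in> frame_span s 2 ?x" if l: "l < 2" for l
  proof (rule ccontr)
    assume "dir (i, l) \<notin> frame_span s 2 ?x"
    then obtain \<gamma> where \<gamma>: "Vector_Spaces.linear s (*) \<gamma>" "\<gamma> (dir (i, l)) = 1"
      "\<And>w. w \<in> frame_span s 2 ?x \<Longrightarrow> \<gamma> w = 0"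
      using V.subspace_separation[OF V.subspace_frame_span] by blast
    let ?x' = "\<lambda>j\<in>{..<2}. a (i, j)"
    have fr: "?x' \<in> frames s 2"
      using x_ind V.indep_family_cong[of 2 ?x' ?x] by (simp add: V.frames_iff)
    have sp: "frame_span s 2 ?x' = frame_span s 2 ?x" by (rule frame_span_cong) simp
    have "(\<lambda>F. \<gamma> (chart_frame \<phi> 2 F l)) \<in> Gr_regular s 2 (frame_span s 2 ?x')"
      by (rule V.chart_regular[OF fr \<phi> _ \<gamma>(1) l]) (use dual in auto)
    then have g: "(\<lambda>M. \<gamma> (chart_frame \<phi> 2 (M i) l)) \<in> G.R (?\<pi> a)"
      unfolding sp R[symmetric] by (rule V.Gr_regular_projection[OF a i inf])
    have "?\<pi> (?l t) i = frame_span s 2 (\<lambda>l. ?x l + s t (dir (i, l)))" for t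
      using i by (simp add: pow_span_def) (rule frame_span_cong, simp add: line_point_def)
    then have "?D (\<lambda>M. \<gamma> (chart_frame \<phi> 2 (M i) l)) =
        germ_deriv (\<lambda>t. \<gamma> (chart_frame \<phi> 2 (frame_span s 2 (\<lambda>l. ?x l + s t (dir (i, l)))) l))"
      using g by (simp add: G.curve_deriv_apply)
    also have "\<dots> = \<gamma> (dir (i, l))"
      using chart_frame_velocity[OF \<phi> dual \<gamma>(1) _ _ l, of "\<lambda>l. dir (i, l)"] \<gamma>(3) V.frame_span_base[of _ 2 ?x]
      by simp
    finally have "?D (\<lambda>M. \<gamma> (chart_frame \<phi> 2 (M i) l)) = 1" using \<gamma>(2) by simp
    moreover have "?Z (\<lambda>M. \<gamma> (chart_frame \<phi> 2 (M i) l)) = 0" using g by simp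
    ultimately show False using D_eq by simp
  qed
  have "u \<in> frame_span s 2 ?x" "v \<in> frame_span s 2 ?x" using vel[of 0] vel[of 1] by (auto simp: dir_def)
  then obtain \<alpha> \<beta> where uv: "u = (\<Sum>l<2. s (\<alpha> l) (?x l))" "v = (\<Sum>l<2. s (\<beta> l) (?x l))"
    by (auto simp: V.frame_span_eq)
  have "\<eta> = s' (\<alpha> 0 + \<beta> 1) (wedges a i)"
    unfolding \<eta>_def uv sum_lessThan_2 wedges_def
    by (simp add: wedge_left wedge_right W.scale_left_distrib del: One_nat_def)
  also have "\<dots> = (\<Sum>j<r. s' (if j = i then \<alpha> 0 + \<beta> 1 else 0) (wedges a j))"
    by (rule W.sum_delta_scale[OF i, symmetric])
  finally have "(\<Sum>j<r. s' ((if j = i then \<alpha> 0 + \<beta> 1 else 0) - (if j = i then 0 else c j)) (wedges a j)) = 0"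
    using \<eta> by (simp add: W.scale_left_diff_distrib sum_subtractf)
  then have "\<forall>j<r. (if j = i then \<alpha> 0 + \<beta> 1 else 0) - (if j = i then 0 else c j) = 0"
    using spec[OF ind[unfolded indep_family_def],
        of "\<lambda>j. (if j = i then \<alpha> 0 + \<beta> 1 else 0) - (if j = i then 0 else c j)"] by simp
  then show False using j0 by auto
qed

end

section \<open>Transversal tuples exist exactly in the stated range\<close>

definition pairs :: "nat \<Rightarrow> nat \<Rightarrow> (nat \<times> nat) set"
  where "pairs k d = {(m, n). k \<le> m \<and> m < n \<and> n < d}"

lemma finite_pairs: "finite (pairs k d)"
  by (rule finite_subset[of _ "{..<d} \<times> {..<d}"]) (auto simp: pairs_def)

lemma card_pairs: "k \<le> d \<Longrightarrow> card (pairs k d) = (d - k) choose 2"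
proof (induction d rule: dec_induct)
  case base
  have "pairs k k = {}" by (auto simp: pairs_def)
  then show ?case by simp
next
  case (step d)
  have "pairs k (Suc d) = pairs k d \<union> (\<lambda>m. (m, d)) ` {k..<d}"
    by (auto simp: pairs_def less_Suc_eq)
  moreover have "pairs k d \<inter> (\<lambda>m. (m, d)) ` {k..<d} = {}" by (auto simp: pairs_def)
  ultimately have "card (pairs k (Suc d)) = card (pairs k d) + card ((\<lambda>m. (m, d)) ` {k..<d})"
    by (simp add: card_Un_disjoint finite_pairs)
  also have "card ((\<lambda>m. (m, d)) ` {k..<d}) = d - k" by (subst card_image) (auto simp: inj_on_def)
  also have "card (pairs k d) + (d - k) = (Suc d - k) choose 2"
    using step by (simp add: Suc_diff_le numeral_2_eq_2)
  finally show ?case .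
qed

context exterior_square_space
begin

lemma minors_exist:
  assumes "dual_basis s d e e'"
  obtains \<theta> where "\<And>m n. Vector_Spaces.linear s' (*) (\<theta> m n)"
    "\<And>m n x y. \<theta> m n (wedge x y) = e' m x * e' n y - e' m y * e' n x"
proof -
  have lin: "Vector_Spaces.linear s (*) (e' n)" for n using assms by (simp add: dual_basis_def)
  have "\<exists>\<theta>. Vector_Spaces.linear s' (*) \<theta> \<and> (\<forall>x y. \<theta> (wedge x y) = e' m x * e' n y - e' m y * e' n x)"
    for m n using minor_functional[OF lin[of m] lin[of n]] by metis
  then show ?thesis using that by metis
qed

lemma span_basis_wedges:
  assumes e: "dual_basis s d e e'"
  shows "W.span ((\<lambda>(m, n). wedge (e m) (e n)) ` pairs 0 d) = UNIV"
proof -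
  let ?S = "W.span ((\<lambda>(m, n). wedge (e m) (e n)) ` pairs 0 d)"
  have base: "wedge (e m) (e n) \<in> ?S" if "m < d" "n < d" for m n
  proof -
    have lt: "wedge (e m) (e n) \<in> ?S" if "m < n" "n < d" for m n
      using that by (intro W.span_base) (auto simp: pairs_def)
    consider "m < n" | "m = n" | "n < m" by linarith
    then show ?thesis
    proof cases
      case 3
      then have "- wedge (e n) (e m) \<in> ?S" using lt that by (intro W.span_neg)
      then show ?thesis by (simp only: wedge_swap[of "e m" "e n"])
    qed (use lt that W.span_zero in auto)
  qed
  have "wedge x y \<in> ?S" for x y
    unfolding wedge_expand[OF e, of x y] using base by (intro W.span_sum W.span_scale) auto
  then have "W.span {wedge x y | x y. True} \<subseteq> ?S" by (intro W.span_minimal) auto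
  then show ?thesis using exterior_square_span[OF W.vector_space_axioms ext_square] by auto
qed

text \<open>
  With respect to a basis of \<open>V\<close> that begins with a basis \<open>x, y\<close> of one of the planes, the bivectors
  without component in the span of the \<open>e\<^sub>m \<and> e\<^sub>n\<close> with \<open>2 \<le> m < n\<close> are those of the form
  \<open>u \<and> y + x \<and> v\<close>. Hence transversality makes the other bivectors independent in the projection to a
  space of dimension \<open>(d - 2) choose 2\<close>.
\<close>

lemma card_le_if_transversal:
  assumes a: "a \<in> pow_frames s 2 r" and r: "1 \<le> r" and trans: "transversal r a"
  shows "r \<le> ((d - 2) choose 2) + 1"
proof -
  let ?x = "\<lambda>l. a (0, l)"
  have "indep_family s 2 ?x" using a r by (simp add: V.pow_frames_iff)
  then obtain e e' where e: "dual_basis s d e e'" and ex: "\<And>l. l < 2 \<Longrightarrow> e l = a (0, l)"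
    using V.extend_to_dual_basis[of 2 ?x d] dim_V d2 by (metis less_le_trans pos2)
  have delta: "e' m (e n) = (if m = n then 1 else 0)" if "m < d" "n < d" for m n
    using e that by (simp add: dual_basis_def)
  obtain \<theta> where \<theta>: "\<And>m n. Vector_Spaces.linear s' (*) (\<theta> m n)"
    "\<And>m n x y. \<theta> m n (wedge x y) = e' m x * e' n y - e' m y * e' n x"
    using minors_exist[OF e] by blast
  let ?B = "(\<lambda>(m, n). wedge (e m) (e n)) ` pairs 2 d"
  define f where "f w = (\<Sum>(m, n)\<in>pairs 2 d. s' (\<theta> m n w) (wedge (e m) (e n)))" for w
  have f_add: "f (w + w') = f w + f w'" and f_scale: "f (s' t w) = s' t (f w)" for w w' t
    unfolding f_def
    by (auto simp: linear_rules[OF \<theta>(1)] W.scale_left_distrib W.scale_sum_right sum.distrib[symmetric]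
        intro!: sum.cong)
  have f_zero: "f 0 = 0" using f_scale[of 0 0] by simp
  define T where "T = {wedge u (e 1) + wedge (e 0) v | u v. True}"
  have sub_T: "W.subspace T"
    unfolding W.subspace_def
  proof (intro conjI ballI allI)
    show "0 \<in> T" unfolding T_def by (intro CollectI exI[of _ 0]) (simp add: wedge_left wedge_right)
  next
    fix w w' assume "w \<in> T" "w' \<in> T"
    then obtain u v u' v' where "w = wedge u (e 1) + wedge (e 0) v" "w' = wedge u' (e 1) + wedge (e 0) v'"
      unfolding T_def by blast
    then show "w + w' \<in> T" unfolding T_def
      by (intro CollectI exI[of _ "u + u'"] exI[of _ "v + v'"]) (simp add: wedge_left wedge_right)
  next
    fix t w assume "w \<in> T"
    then obtain u v where "w = wedge u (e 1) + wedge (e 0) v" unfolding T_def by blast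
    then show "s' t w \<in> T" unfolding T_def
      by (intro CollectI exI[of _ "s t u"] exI[of _ "s t v"])
        (simp add: wedge_left wedge_right W.scale_right_distrib)
  qed
  have T_wedge: "wedge u (e 1) \<in> T" "wedge (e 0) v \<in> T" for u v
    unfolding T_def
    by (intro CollectI exI[of _ u] exI[of _ 0], simp add: wedge_right)
      (intro CollectI exI[of _ 0] exI[of _ v], simp add: wedge_left)
  let ?K = "{w. w - f w \<in> T}"
  have "W.subspace ?K"
    unfolding W.subspace_def
  proof (intro conjI ballI allI)
    show "0 \<in> ?K" using W.subspace_0[OF sub_T] by (simp add: f_zero)
  next
    fix w w' assume "w \<in> ?K" "w' \<in> ?K"
    then have "(w - f w) + (w' - f w') \<in> T" using W.subspace_add[OF sub_T] by blast
    then show "w + w' \<in> ?K" by (simp add: f_add algebra_simps)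
  next
    fix t w assume "w \<in> ?K"
    then have "s' t (w - f w) \<in> T" using W.subspace_scale[OF sub_T] by blast
    then show "s' t w \<in> ?K" by (simp add: f_scale W.scale_right_diff_distrib)
  qed
  moreover have "(\<lambda>(m, n). wedge (e m) (e n)) ` pairs 0 d \<subseteq> ?K"
  proof clarsimp
    fix m n assume "(m, n) \<in> pairs 0 d"
    then have mn: "m < n" "n < d" by (auto simp: pairs_def)
    have \<theta>e: "\<theta> m' n' (wedge (e m) (e n)) = (if (m', n') = (m, n) then 1 else 0)"
      if "(m', n') \<in> pairs 2 d" for m' n'
      using that mn by (auto simp: \<theta>(2) delta pairs_def)
    have f: "f (wedge (e m) (e n)) = (\<Sum>p\<in>pairs 2 d. if p = (m, n) then wedge (e m) (e n) else 0)"
      unfolding f_def by (intro sum.cong refl) (auto simp: \<theta>e split: if_splits)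
    show "wedge (e m) (e n) - f (wedge (e m) (e n)) \<in> T"
    proof (cases "(m, n) \<in> pairs 2 d")
      case True
      then have "f (wedge (e m) (e n)) = wedge (e m) (e n)" using f by (simp add: finite_pairs)
      then show ?thesis using W.subspace_0[OF sub_T] by simp
    next
      case False
      then have "f (wedge (e m) (e n)) = 0" using f by (simp add: finite_pairs)
      moreover have "m = 0 \<or> m = 1" using False mn by (auto simp: pairs_def)
      moreover have "wedge (e 1) (e n) \<in> T"
        using W.subspace_neg[OF sub_T T_wedge(1)[of "e n"]] by (simp only: wedge_swap[of "e 1" "e n"] minus_minus)
      ultimately show ?thesis using T_wedge(2) by auto
    qed
  qed
  ultimately have "W.span ((\<lambda>(m, n). wedge (e m) (e n)) ` pairs 0 d) \<subseteq> ?K"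
    by (intro W.span_minimal)
  then have K: "w - f w \<in> T" for w using span_basis_wedges[OF e] by auto
  have "indep_family s' (r - 1) (\<lambda>j. f (wedges a (Suc j)))"
    unfolding indep_family_def
  proof (intro allI impI)
    fix c l assume c: "(\<Sum>j<r - 1. s' (c j) (f (wedges a (Suc j)))) = 0" and l: "l < r - 1"
    define w where "w = (\<Sum>j<r - 1. s' (c j) (wedges a (Suc j)))"
    have "f (\<Sum>j<n. s' (c j) (wedges a (Suc j))) = (\<Sum>j<n. s' (c j) (f (wedges a (Suc j))))" for n
      by (induction n) (simp_all add: f_zero f_add f_scale)
    then have "f w = 0" using c by (simp add: w_def)
    then have "w \<in> T" using K[of w] by simp
    then obtain u v where uv: "w = wedge u (a (0, 1)) + wedge (a (0, 0)) v"
      unfolding T_def using ex by auto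
    have "(\<Sum>j<r. s' (case j of 0 \<Rightarrow> 0 | Suc j \<Rightarrow> c j) (wedges a j)) = w"
    proof -
      obtain q where q: "r = Suc q" using r by (cases r) auto
      show ?thesis unfolding q w_def by (simp only: sum.lessThan_Suc_shift) simp
    qed
    then have "(case Suc l of 0 \<Rightarrow> 0 | Suc j \<Rightarrow> c j) = 0"
      using trans[unfolded transversal_def transversal_at_def, rule_format, of 0 "\<lambda>j. case j of 0 \<Rightarrow> 0 | Suc j \<Rightarrow> c j" u v "Suc l"]
        uv l r by simp
    then show "c l = 0" by simp
  qed
  then have ind: "inj_on (\<lambda>j. f (wedges a (Suc j))) {..<r - 1}"
    "W.independent ((\<lambda>j. f (wedges a (Suc j))) ` {..<r - 1})"
    by (auto simp: W.indep_family_iff)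
  have "f w \<in> W.span ?B" for w
    unfolding f_def by (intro W.span_sum) (auto intro!: W.span_scale intro: W.span_base)
  then have "card ((\<lambda>j. f (wedges a (Suc j))) ` {..<r - 1}) \<le> card ?B"
    using W.independent_span_bound[OF _ ind(2), of ?B] finite_pairs by blast
  also have "\<dots> \<le> (d - 2) choose 2" using card_image_le[OF finite_pairs, of _ 2 d] card_pairs[OF d2] by metis
  finally show ?thesis using ind(1) by (simp add: card_image)
qed

text \<open>
  The coefficient of \<open>w \<and> w'\<close> at \<open>e\<^sub>0 \<and> e\<^sub>1 \<and> e\<^sub>m \<and> e\<^sub>n\<close>, expressed by the coefficients of \<open>w\<close> and \<open>w'\<close>.
  As a function of \<open>w'\<close> it is a functional that detects bivectors outside \<open>L \<and> V\<close> if \<open>w\<close> is the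
  wedge of a basis of \<open>L\<close>.
\<close>

definition wedge4 :: "(nat \<Rightarrow> nat \<Rightarrow> 'w \<Rightarrow> 'k) \<Rightarrow> nat \<times> nat \<Rightarrow> 'w \<Rightarrow> 'w \<Rightarrow> 'k"
  where "wedge4 \<theta> p w w' = (case p of (m, n) \<Rightarrow>
    \<theta> 0 1 w * \<theta> m n w' - \<theta> 0 m w * \<theta> 1 n w' + \<theta> 0 n w * \<theta> 1 m w' +
    \<theta> 1 m w * \<theta> 0 n w' - \<theta> 1 n w * \<theta> 0 m w' + \<theta> m n w * \<theta> 0 1 w')"

lemma wedge4_linear:
  assumes "\<And>m n. Vector_Spaces.linear s' (*) (\<theta> m n)"
  shows "Vector_Spaces.linear s' (*) (wedge4 \<theta> p w)"
  by (rule linear_functionalI[OF W.vector_space_axioms])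
    (simp_all add: wedge4_def linear_rules[OF assms] algebra_simps split: prod.split)

lemma wedge4_tangent:
  assumes lin: "\<And>m n. Vector_Spaces.linear s' (*) (\<theta> m n)"
    and \<theta>: "\<And>m n x y. \<theta> m n (wedge x y) = e' m x * e' n y - e' m y * e' n x"
  shows "wedge4 \<theta> p (wedge x y) (wedge u y + wedge x v) = 0"
  by (simp add: wedge4_def linear_rules[OF lin] \<theta> algebra_simps split: prod.split)

text \<open>
  The determinant has in the row \<open>l \<noteq> i\<close> the coefficients of the \<open>w\<^sub>i \<and> w\<^sub>j\<close> at
  \<open>e\<^sub>0 \<and> e\<^sub>1 \<and> e\<^sub>m \<and> e\<^sub>n\<close> for a pair \<open>(m, n)\<close> chosen for \<open>l\<close>, and in the row \<open>i\<close> the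
  coefficients of the \<open>w\<^sub>j\<close> at \<open>e\<^sub>0 \<and> e\<^sub>1\<close>. The rows \<open>l \<noteq> i\<close> vanish on \<open>L\<^sub>i \<and> V\<close>, which gives
  transversality; the row \<open>i\<close> makes the matrix square and gives independence of all the \<open>w\<^sub>j\<close>. At
  the tuple of \<open>\<langle>e\<^sub>0, e\<^sub>1\<rangle>\<close> and the planes \<open>\<langle>e\<^sub>m, e\<^sub>n\<rangle>\<close> of the chosen pairs the matrix is the identity.
\<close>

lemma generic_polynomial_at:
  assumes r: "r \<le> ((d - 2) choose 2) + 1" and i: "i < r"
  obtains G where "G \<in> polyfuns s ({..<r} \<times> {..<2})"
    "\<exists>a \<in> ({..<r} \<times> {..<2}) \<rightarrow>\<^sub>E UNIV. G a \<noteq> 0"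
    "\<And>a. G a \<noteq> 0 \<Longrightarrow> indep_family s' r (wedges a) \<and> transversal_at r i a"
proof -
  let ?J = "{..<r} \<times> {..<2::nat}"
  obtain e e' where e: "dual_basis s d e e'" by (rule dual_basis_exists)
  have delta: "e' m (e n) = (if m = n then 1 else 0)" if "m < d" "n < d" for m n
    using e that by (simp add: dual_basis_def)
  obtain \<theta> where lin: "\<And>m n. Vector_Spaces.linear s' (*) (\<theta> m n)"
    and \<theta>: "\<And>m n x y. \<theta> m n (wedge x y) = e' m x * e' n y - e' m y * e' n x"
    using minors_exist[OF e] by blast
  have "card ({..<r} - {i}) \<le> card (pairs 2 d)" using r i card_pairs[OF d2] by simp
  then obtain p where p: "p ` ({..<r} - {i}) \<subseteq> pairs 2 d" "inj_on p ({..<r} - {i})"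
    using card_le_inj[of "{..<r} - {i}" "pairs 2 d"] finite_pairs by auto
  define T where "T w l = (if l = i then \<theta> 0 1 else wedge4 \<theta> (p l) w)" for w l
  have T_lin: "Vector_Spaces.linear s' (*) (T w l)" for w l
    using lin wedge4_linear[OF lin] by (simp add: T_def)
  define G where "G a = fdet r (\<lambda>l j. T (wedges a i) l (wedges a j))" for a
  have poly: "(\<lambda>a. T (wedges a i) l (wedges a j)) \<in> polyfuns s ?J" if "j < r" for l j
  proof -
    note P = polyfuns_wedges[OF lin i] polyfuns_wedges[OF lin that]
    obtain m n where "p l = (m, n)" by fastforce
    then show ?thesis
      by (cases "l = i") (auto simp: T_def wedge4_def intro!: P polyfuns.add polyfuns_diff polyfuns.mult)
  qed
  show ?thesis
  proof (rule that)
    show "G \<in> polyfuns s ?J" unfolding G_def using poly by (intro polyfuns_fdet)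
  next
    define q where "q j = (if j = i then (0, 1) else p j)" for j
    define a where "a = (\<lambda>(j, l)\<in>?J. e (if l = 0 then fst (q j) else snd (q j)))"
    have w: "wedges a j = wedge (e (fst (q j))) (e (snd (q j)))" if "j < r" for j
      using that by (simp add: wedges_def a_def)
    have wi: "wedges a i = wedge (e 0) (e 1)" using w[OF i] by (simp add: q_def)
    have q: "q j = (0, 1) \<and> j = i \<or> j \<noteq> i \<and> q j = p j \<and> p j \<in> pairs 2 d" if "j < r" for j
      using that p(1) by (auto simp: q_def)
    have "T (wedges a i) l (wedges a j) = (if l = j then 1 else 0)" if lj: "l < r" "j < r" for l j
    proof -
      obtain m n where mn: "q j = (m, n)" by fastforce
      have j: "m = 0 \<and> n = 1 \<and> j = i \<or> j \<noteq> i \<and> p j = (m, n) \<and> 2 \<le> m \<and> m < n \<and> n < d"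
        using q[OF lj(2)] mn by (auto simp: pairs_def)
      then have mnd: "m < d" "n < d" using d2 by auto
      show ?thesis
      proof (cases "l = i")
        case True
        then show ?thesis using j mn mnd d2 by (auto simp: T_def w[OF lj(2)] \<theta> delta)
      next
        case False
        obtain m' n' where mn': "p l = (m', n')" by fastforce
        then have l: "2 \<le> m'" "m' < n'" "n' < d" using p(1) lj(1) False by (auto simp: pairs_def)
        have "T (wedges a i) l (wedges a j) = \<theta> m' n' (wedge (e m) (e n))"
          using False l d2 by (simp add: T_def wedge4_def mn' wi w[OF lj(2)] mn \<theta> delta)
        also have "\<dots> = (if (m', n') = (m, n) then 1 else 0)"
          using j l mnd by (auto simp: \<theta> delta)
        also have "(m', n') = (m, n) \<longleftrightarrow> l = j"
          using j l mn' False lj p(2) by (auto simp: inj_on_def)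
        finally show ?thesis .
      qed
    qed
    then have "G a = 1" unfolding G_def by (rule fdet_delta)
    moreover have "a \<in> ?J \<rightarrow>\<^sub>E UNIV" by (simp add: a_def)
    ultimately show "\<exists>a\<in>?J \<rightarrow>\<^sub>E UNIV. G a \<noteq> 0" by (metis zero_neq_one)
  next
    fix a assume G: "G a \<noteq> 0"
    let ?T = "T (wedges a i)"
    have det: "fdet r (\<lambda>l j. ?T l (wedges a j)) \<noteq> 0" using G by (simp add: G_def)
    have T0: "?T l (wedge u (a (i, 1)) + wedge (a (i, 0)) v) = 0" if "l \<noteq> i" for l u v
      using that wedge4_tangent[OF lin \<theta>] by (simp add: T_def wedges_def)
    have Ti: "?T l (wedges a i) = 0" if "l \<noteq> i" for l
      using T0[OF that, of "a (i, 0)" 0] by (simp add: wedges_def wedge_right)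
    have \<tau>: "?T i (wedges a i) \<noteq> 0"
    proof
      assume 0: "?T i (wedges a i) = 0"
      have "(if i = i then 1 else 0 :: 'k) = 0"
      proof (rule fdet_nonzero_kernel[OF det _ i, where c = "\<lambda>j. if j = i then 1 else 0"])
        fix l assume "l < r"
        have "(\<Sum>j<r. ?T l (wedges a j) * (if j = i then 1 else 0)) = ?T l (wedges a i)"
          using i by (rule sum_delta_mult)
        then show "(\<Sum>j<r. ?T l (wedges a j) * (if j = i then 1 else 0)) = 0" using 0 Ti by (cases "l = i") auto
      qed
      then show False by simp
    qed
    have "indep_family s' r (wedges a)" by (rule W.indep_family_fdet[OF T_lin det])
    moreover have "transversal_at r i a"
      unfolding transversal_at_def
    proof (intro allI impI)
      fix c u v j
      assume eq: "(\<Sum>j<r. s' (c j) (wedges a j)) = wedge u (a (i, 1)) + wedge (a (i, 0)) v"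
        and j: "j < r" "j \<noteq> i"
      let ?\<eta> = "\<Sum>j<r. s' (c j) (wedges a j)"
      \<comment> \<open>correct the coefficient at \<open>i\<close> so that also the functional \<open>\<theta> 0 1\<close> vanishes\<close>
      define \<kappa> where "\<kappa> = ?T i ?\<eta> / ?T i (wedges a i)"
      have "c j - (if j = i then \<kappa> else 0) = 0"
      proof (rule fdet_nonzero_kernel[OF det _ j(1)])
        fix l assume "l < r"
        have "(\<Sum>j<r. ?T l (wedges a j) * (c j - (if j = i then \<kappa> else 0))) =
            (\<Sum>j<r. c j * ?T l (wedges a j)) - \<kappa> * (\<Sum>j<r. ?T l (wedges a j) * (if j = i then 1 else 0))"
          by (auto simp: sum_distrib_left sum_subtractf[symmetric] algebra_simps intro!: sum.cong)
        also have "(\<Sum>j<r. c j * ?T l (wedges a j)) = ?T l ?\<eta>" by (simp add: linear_rules[OF T_lin])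
        also have "(\<Sum>j<r. ?T l (wedges a j) * (if j = i then 1 else 0)) = ?T l (wedges a i)"
          using i by (rule sum_delta_mult)
        also have "?T l ?\<eta> - \<kappa> * ?T l (wedges a i) = 0"
          using Ti[of l] T0[of l u v] \<tau> by (cases "l = i") (simp_all add: \<kappa>_def eq)
        finally show "(\<Sum>j<r. ?T l (wedges a j) * (c j - (if j = i then \<kappa> else 0))) = 0" .
      qed
      then show "c j = 0" using j by simp
    qed
    ultimately show "indep_family s' r (wedges a) \<and> transversal_at r i a" ..
  qed
qed

lemma generic_polynomial:
  assumes r: "1 \<le> r" "r \<le> ((d - 2) choose 2) + 1"
  obtains G where "G \<in> polyfuns s ({..<r} \<times> {..<2})"
    "\<exists>a \<in> ({..<r} \<times> {..<2}) \<rightarrow>\<^sub>E UNIV. G a \<noteq> 0"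
    "\<And>a. G a \<noteq> 0 \<Longrightarrow> indep_family s' r (wedges a) \<and> transversal r a"
proof -
  let ?J = "{..<r} \<times> {..<2::nat}"
  have "\<exists>G. G \<in> polyfuns s ?J \<and> (\<exists>a \<in> ?J \<rightarrow>\<^sub>E UNIV. G a \<noteq> 0) \<and>
    (\<forall>a. G a \<noteq> 0 \<longrightarrow> indep_family s' r (wedges a) \<and> transversal_at r i a)" if i: "i < r" for i
  proof (rule generic_polynomial_at[OF r(2) i])
    fix G assume G: "G \<in> polyfuns s ?J" "\<exists>a \<in> ?J \<rightarrow>\<^sub>E UNIV. G a \<noteq> 0"
      "\<And>a. G a \<noteq> 0 \<Longrightarrow> indep_family s' r (wedges a) \<and> transversal_at r i a"
    show ?thesis by (intro exI[of _ G] conjI[OF G(1)] conjI[OF G(2)] allI impI G(3))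
  qed
  then obtain G where G: "\<And>i. i < r \<Longrightarrow> G i \<in> polyfuns s ?J \<and> (\<exists>a \<in> ?J \<rightarrow>\<^sub>E UNIV. G i a \<noteq> 0)"
    "\<And>i a. i < r \<Longrightarrow> G i a \<noteq> 0 \<Longrightarrow> indep_family s' r (wedges a) \<and> transversal_at r i a"
    by metis
  show ?thesis
  proof (rule that)
    show "(\<lambda>a. \<Prod>i<r. G i a) \<in> polyfuns s ?J" using G(1) by (intro polyfuns_prod) auto
    show "\<exists>a \<in> ?J \<rightarrow>\<^sub>E UNIV. (\<Prod>i<r. G i a) \<noteq> 0"
      using G(1) by (intro polyfuns_prod_nonzero[OF inf V.vector_space_axioms]) auto
    fix a assume "(\<Prod>i<r. G i a) \<noteq> 0"
    then have ne: "G i a \<noteq> 0" if "i < r" for i using that by simp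
    have "indep_family s' r (wedges a)" using G(2)[of 0 a] ne r(1) by simp
    moreover have "transversal r a" unfolding transversal_def using G(2) ne by blast
    ultimately show "indep_family s' r (wedges a) \<and> transversal r a" ..
  qed
qed

text \<open>
  Planes spanned by distinct pairs of basis vectors have independent wedges. Without a point in the
  domain the empty set would be a dense open subset.
\<close>

lemma decomp_domain_nonempty:
  assumes "r \<le> d choose 2"
  shows "decomp_domain s s' wedge r \<noteq> {}"
proof -
  let ?J = "{..<r} \<times> {..<2::nat}"
  obtain e e' where e: "dual_basis s d e e'" by (rule dual_basis_exists)
  have delta: "e' m (e n) = (if m = n then 1 else 0)" if "m < d" "n < d" for m n
    using e that by (simp add: dual_basis_def)
  obtain \<theta> where lin: "\<And>m n. Vector_Spaces.linear s' (*) (\<theta> m n)"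
    and \<theta>: "\<And>m n x y. \<theta> m n (wedge x y) = e' m x * e' n y - e' m y * e' n x"
    using minors_exist[OF e] by blast
  obtain p where p: "p ` {..<r} \<subseteq> pairs 0 d" "inj_on p {..<r}"
    using card_le_inj[of "{..<r}" "pairs 0 d"] finite_pairs assms card_pairs[of 0 d] by auto
  define a where "a = (\<lambda>(j, l)\<in>?J. e (if l = 0 then fst (p j) else snd (p j)))"
  have "indep_family s' r (wedges a)"
  proof (rule W.indep_family_dual)
    fix l j assume lj: "l < r" "j < r"
    obtain m n where mn: "p l = (m, n)" by fastforce
    obtain m' n' where mn': "p j = (m', n')" by fastforce
    have b: "m < n" "n < d" "m' < n'" "n' < d" using p(1) lj mn mn' by (force simp: pairs_def)+
    have "wedges a j = wedge (e m') (e n')" using lj by (simp add: wedges_def a_def mn')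
    then have "(case p l of (m, n) \<Rightarrow> \<theta> m n) (wedges a j) = (if p l = p j then 1 else 0)"
      using b by (auto simp: mn mn' \<theta> delta)
    also have "p l = p j \<longleftrightarrow> l = j" using p(2) lj by (auto simp: inj_on_def)
    finally show "(case p l of (m, n) \<Rightarrow> \<theta> m n) (wedges a j) = (if l = j then 1 else 0)" .
  qed (simp add: lin split: prod.split)
  moreover from this have "a \<in> pow_frames s 2 r"
    by (rule pow_frames_if_indep_wedges[rotated]) (simp add: a_def)
  ultimately show ?thesis using decomp_domain_iff by blast
qed

end

section \<open>Density of the transversal tuples\<close>

context exterior_square_space
begin

lemma dense_immersion_iff:
  assumes r: "1 \<le> r" "r \<le> d choose 2"
  shows "(\<exists>U. openin (subtopology (Gr_pow_zariski s 2 r) (decomp_domain s s' wedge r)) U \<and>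
      subtopology (Gr_pow_zariski s 2 r) (decomp_domain s s' wedge r) closure_of U
        = decomp_domain s s' wedge r \<and>
      (\<forall>L\<in>U. decomp_immersion_at s s' wedge r L))
    \<longleftrightarrow> r \<le> ((d - 2) choose 2) + 1"
    (is "(\<exists>U. openin (subtopology ?X ?dom) U \<and> _ U \<and> _ U) \<longleftrightarrow> _")
proof
  let ?\<pi> = "pow_span s 2 r" and ?S = "pow_frames s 2 r"
  have lift: "\<exists>a\<in>?S. ?\<pi> a = L \<and> indep_family s' r (wedges a)" if L: "L \<in> ?dom" for L
  proof -
    have "L \<in> {..<r} \<rightarrow>\<^sub>E Gr s 2" using L by (simp add: decomp_domain_def)
    then have "L \<in> topspace ?X" by (simp add: topspace_Gr_pow_zariski V.vector_space_axioms)
    then obtain a where "a \<in> ?S" "?\<pi> a = L"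
      unfolding Gr_pow_zariski_def topspace_quotient_top by auto
    then show ?thesis using L decomp_domain_iff by blast
  qed
  {
    assume "\<exists>U. openin (subtopology ?X ?dom) U \<and> subtopology ?X ?dom closure_of U = ?dom \<and>
      (\<forall>L\<in>U. decomp_immersion_at s s' wedge r L)"
    then obtain U where U: "openin (subtopology ?X ?dom) U" "subtopology ?X ?dom closure_of U = ?dom"
      "\<And>L. L \<in> U \<Longrightarrow> decomp_immersion_at s s' wedge r L" by blast
    have "U \<noteq> {}" using U(2) decomp_domain_nonempty[OF r(2)] by auto
    then obtain L where L: "L \<in> U" by blast
    then have "L \<in> ?dom" using openin_subset[OF U(1)] by auto
    then obtain a where a: "a \<in> ?S" "?\<pi> a = L" "indep_family s' r (wedges a)" using lift by blast
    have "transversal r a"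
      by (rule transversal_if_immersion[OF a(1,3)]) (use U(3)[OF L] a(2) in simp)
    then show "r \<le> ((d - 2) choose 2) + 1" by (rule card_le_if_transversal[OF a(1) r(1)])
  next
    assume "r \<le> ((d - 2) choose 2) + 1"
    then obtain G where G: "G \<in> polyfuns s ({..<r} \<times> {..<2})"
      "\<exists>a \<in> ({..<r} \<times> {..<2}) \<rightarrow>\<^sub>E UNIV. G a \<noteq> 0"
      "\<And>a. G a \<noteq> 0 \<Longrightarrow> indep_family s' r (wedges a) \<and> transversal r a"
      using generic_polynomial[OF r(1)] by metis
    interpret G: homogeneous_presentation s "{..<r} \<times> {..<2}" ?S ?\<pi>
      by (rule V.homogeneous_presentation_Gr_pow[OF inf])
    define U where "U = ?\<pi> ` {a \<in> ?S. G a \<noteq> 0}"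
    have U_dom: "U \<subseteq> ?dom" using G(3) decomp_domain_iff by (auto simp: U_def)
    have U_open: "openin ?X U"
      unfolding U_def Gr_pow_zariski_def by (rule G.openin_image_nonzero[OF G(1)])
    have "openin (subtopology ?X ?dom) U"
      unfolding openin_subtopology using U_open U_dom by (intro exI[of _ U]) auto
    moreover have "subtopology ?X ?dom closure_of U = ?dom"
    proof
      show "subtopology ?X ?dom closure_of U \<subseteq> ?dom"
        using closure_of_subset_topspace[of "subtopology ?X ?dom" U] by auto
      show "?dom \<subseteq> subtopology ?X ?dom closure_of U"
      proof
        fix L assume L: "L \<in> ?dom"
        obtain a where a: "a \<in> ?S" "?\<pi> a = L" using lift[OF L] by blast
        have "\<exists>y\<in>U. y \<in> N" if N: "L \<in> N" "openin (subtopology ?X ?dom) N" for N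
        proof -
          obtain N' where N': "openin ?X N'" "N = N' \<inter> ?dom" using N(2) unfolding openin_subtopology by blast
          let ?A = "subtopology (affine_zariski s ({..<r} \<times> {..<2})) ?S"
          have "openin ?A {b \<in> topspace ?A. ?\<pi> b \<in> N'}"
            using N'(1) unfolding Gr_pow_zariski_def openin_quotient_top by blast
          moreover have "topspace ?A = ?S"
            using G.S_sub by (simp add: topspace_affine_zariski Int_absorb1)
          ultimately obtain O' where O': "openin (affine_zariski s ({..<r} \<times> {..<2})) O'"
            "{b \<in> ?S. ?\<pi> b \<in> N'} = O' \<inter> ?S" unfolding openin_subtopology by auto
          then obtain F where F: "F \<subseteq> polyfuns s ({..<r} \<times> {..<2})"
            "O' = {b \<in> ({..<r} \<times> {..<2}) \<rightarrow>\<^sub>E UNIV. \<exists>P\<in>F. P b \<noteq> 0}"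
            unfolding openin_affine_zariski by blast
          have "a \<in> O'" using a N(1) N'(2) O'(2) by blast
          then obtain P where P: "P \<in> F" "P a \<noteq> 0" "a \<in> ({..<r} \<times> {..<2}) \<rightarrow>\<^sub>E UNIV" using F(2) by blast
          obtain a0 where a0: "a0 \<in> ({..<r} \<times> {..<2}) \<rightarrow>\<^sub>E UNIV" "G a0 \<noteq> 0" using G(2) by blast
          obtain b where b: "b \<in> ({..<r} \<times> {..<2}) \<rightarrow>\<^sub>E UNIV" "P b \<noteq> 0" "G b \<noteq> 0"
            by (rule polyfuns_common_nonzero[OF inf V.vector_space_axioms subsetD[OF F(1) P(1)] P(3,2) G(1) a0])
          have bS: "b \<in> ?S" using pow_frames_if_indep_wedges[OF b(1)] G(3)[OF b(3)] by blast
          have "b \<in> O'" using b P(1) F(2) by blast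
          then have "?\<pi> b \<in> N'" using bS O'(2) by blast
          moreover have "?\<pi> b \<in> U" using bS b(3) by (auto simp: U_def)
          ultimately show ?thesis using U_dom N'(2) by blast
        qed
        moreover have "L \<in> topspace (subtopology ?X ?dom)"
          using L by (simp add: topspace_Gr_pow_zariski V.vector_space_axioms decomp_domain_def)
        ultimately show "L \<in> subtopology ?X ?dom closure_of U" unfolding in_closure_of by blast
      qed
    qed
    moreover have "\<forall>L\<in>U. decomp_immersion_at s s' wedge r L"
      using G(3) immersion_if_transversal by (auto simp: U_def)
    ultimately show "\<exists>U. openin (subtopology ?X ?dom) U \<and> subtopology ?X ?dom closure_of U = ?dom \<and>
      (\<forall>L\<in>U. decomp_immersion_at s s' wedge r L)" by blast
  }
qed

end

section \<open>The field of p-adic numbers is infinite\<close>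

text \<open>A positive integer \<open>n\<close> is nonzero in \<open>\<int>\<^sub>p\<close> since \<open>n < p\<^sup>n\<close>.\<close>

lemma padic_res_of_nat: "padic_res (of_nat n :: 'p::prime_card padic_int) m = int n mod int CARD('p) ^ m"
  by (induction n) (simp_all add: zero_padic_int.rep_eq plus_padic_int.rep_eq one_padic_int.rep_eq
      mod_add_eq add.commute)

lemma padic_int_of_nat_nonzero:
  assumes "n \<noteq> 0"
  shows "(of_nat n :: 'p::prime_card padic_int) \<noteq> 0"
proof
  assume "(of_nat n :: 'p padic_int) = 0"
  then have "int n mod int CARD('p) ^ n = 0"
    using padic_res_of_nat[of n n, where 'p = 'p] by (simp add: zero_padic_int.rep_eq)
  moreover have "n < CARD('p) ^ n"
    by (rule power_gt_expt) (use prime_gt_1_nat[OF prime_card[where 'a = 'p]] in simp)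
  then have "int n < int CARD('p) ^ n" by (metis of_nat_less_iff of_nat_power)
  ultimately show False using assms by simp
qed

lemma infinite_padic: "infinite (UNIV :: 'p::prime_card padic set)"
proof -
  have "inj (of_nat :: nat \<Rightarrow> 'p padic)"
  proof (rule linorder_injI)
    fix m n :: nat assume "m < n"
    then have "(of_nat (n - m) :: 'p padic_int) \<noteq> 0" by (intro padic_int_of_nat_nonzero) simp
    then have "(of_nat (n - m) :: 'p padic) \<noteq> 0"
      by (simp add: Fract_of_nat_eq[symmetric] Zero_fract_def eq_fract del: of_nat_diff)
    then show "(of_nat m :: 'p padic) \<noteq> of_nat n" using \<open>m < n\<close> by (simp add: of_nat_diff)
  qed
  then show ?thesis by (metis finite_imageD infinite_UNIV_nat finite_subset subset_UNIV)
qed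

section \<open>Immersion on a dense open set\<close>

theorem theorem4p6p1:
  fixes scaleV :: "'p::prime_card padic \<Rightarrow> 'v::ab_group_add \<Rightarrow> 'v"
    and scaleW :: "'p padic \<Rightarrow> 'w::ab_group_add \<Rightarrow> 'w"
    and wedge :: "'v \<Rightarrow> 'v \<Rightarrow> 'w"
    and p d r :: nat
  assumes "CARD('p) = p" and "p > 3"
    and "vector_space scaleV" and "vector_space.dim scaleV UNIV = d" and "d \<ge> 2"
    and "vector_space scaleW" and "exterior_square scaleV scaleW wedge"
    and "1 \<le> r" and "r \<le> d choose 2"
  shows "(\<exists>U. openin (subtopology (Gr_pow_zariski scaleV 2 r) (decomp_domain scaleV scaleW wedge r)) U \<and>
            subtopology (Gr_pow_zariski scaleV 2 r) (decomp_domain scaleV scaleW wedge r) closure_of U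
              = decomp_domain scaleV scaleW wedge r \<and>
            (\<forall>L\<in>U. decomp_immersion_at scaleV scaleW wedge r L))
         \<longleftrightarrow> r \<le> ((d - 2) choose 2) + 1"
proof -
  have "exterior_square_space scaleV scaleW wedge d"
    using assms infinite_padic[where 'p = 'p]
    by (simp add: exterior_square_space_def exterior_square_space_axioms_def)
  then show ?thesis using assms(8,9) by (rule exterior_square_space.dense_immersion_iff)
qed

end
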